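(* Let $p$ be a prime number, $n\ge 1$ an integer, let $m=\frac{p^n-1}{p-1}$, and let $0\le i\le j$ be integers. (a) If $j-i<n$ then $$\beta^{-i,2j}(K(\mathbb{F}_p^n))={n\brack j-i}_p\,\beta^{-i,2j}(K(\mathbb{F}_p^{j-i})).$$ (b) If $j-i=n$ then $$\beta^{-i,2j}(K(\mathbb{F}_p^n))=\sum_{k=0}^n\frac{(-1)^{n-k}p^{\frac12k(k-1)}(p)_n}{k!\,(p-1)^k(p)_{n-k}}\binom{m-k}{j-k}-\sum_{l=0}^{n-1}(-1)^{n-l}\beta^{-j+l,2j}(K(\mathbb{F}_p^n)).$$
   Context: $K(\mathbb{F}_p^n)$ is the simplicial complex whose vertices are the $1$-dimensional subspaces (lines) of $\mathbb{F}_p^n$ and whose simplices are the sets of lines $\{l_1,\dots,l_k\}$ spanning a $k$-dimensional subspace, including the empty set (so $K(\mathbb{F}_p^0)=\{\emptyset\}$ has no vertices); it has $m=\frac{p^n-1}{p-1}$ vertices. Let $\mathbf{k}$ be $\mathbb{Z}$ or a prime field. For a simplicial complex $\mathcal{K}$ on $[s]=\{1,\dots,s\}$, $\mathbf{k}[\mathcal{K}]=\mathbf{k}[v_1,\dots,v_s]/(v_{i_1}\cdots v_{i_k}:\{i_1,\dots,i_k\}\notin\mathcal{K})$ is its Stanley–Reisner ring, and the bigraded Betti number $\beta^{-i,2j}(\mathcal{K})$ is the rank (dimension, if $\mathbf{k}$ is a field) over $\mathbf{k}$ of $\mathrm{Tor}^{-i,2j}_{\mathbf{k}[v_1,\dots,v_s]}(\mathbf{k}[\mathcal{K}],\mathbf{k})$,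 where $-i$ is the (negated) homological degree and $2j$ is the internal degree with $\deg v_t=2$. Equivalently (Hochster's formula), $\beta^{-i,2j}(\mathcal{K})=\sum_{J\subseteq[s],|J|=j}\mathrm{rank}\,\widetilde{H}^{j-i-1}(\mathcal{K}_J;\mathbf{k})$, where $\mathcal{K}_J$ is the full subcomplex on $J$ (with $\widetilde H^{-1}(\{\emptyset\})=\mathbf{k}$). Notation: $(p)_k=(p-1)(p^2-1)\cdots(p^k-1)$, $(p)_0=1$, and ${n\brack l}_p=\frac{(p)_n}{(p)_l(p)_{n-l}}$ is the number of $l$-dimensional subspaces of $\mathbb{F}_p^n$. Binomial coefficients $\binom{a}{b}$ with $b>a\ge0$ are $0$. *)

theory Defs
  imports
    Complex_Main
    "HOL-Computational_Algebra.Primes"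
    "HOL-Library.Poly_Mapping"
    "HOL-Library.Function_Algebras"
begin

section \<open>Coefficient rings and ranks\<close>

definition prime_field :: "'k::idom itself \<Rightarrow> bool" where
  "prime_field _ \<longleftrightarrow>
     (\<forall>x::'k. x \<noteq> 0 \<longrightarrow> (\<exists>y. x * y = 1)) \<and>
     (\<forall>P::'k set. 1 \<in> P \<and> (\<forall>x\<in>P. \<forall>y\<in>P. x - y \<in> P \<and> x * y \<in> P) \<and>
        (\<forall>x\<in>P. \<forall>y. x * y = 1 \<longrightarrow> y \<in> P) \<longrightarrow> P = UNIV)"

text \<open>The unique unital ring homomorphism from the integers is an isomorphism.\<close>

definition ring_of_integers :: "'k::idom itself \<Rightarrow> bool" where
  "ring_of_integers _ \<longleftrightarrow> bij (of_int :: int \<Rightarrow> 'k)"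

text \<open>The rank over \<open>'k\<close> of the quotient \<open>Z / B\<close> of submodules \<open>B \<subseteq> Z\<close>: the largest number of
  elements of \<open>Z\<close> whose classes are linearly independent modulo \<open>B\<close>. If \<open>'k\<close> is a field this is
  the dimension of \<open>Z / B\<close>. It is only applied to finitely generated \<open>Z\<close>, where the maximum exists.\<close>

definition quotient_rank ::
    "('k::idom \<Rightarrow> 'm::ab_group_add \<Rightarrow> 'm) \<Rightarrow> 'm set \<Rightarrow> 'm set \<Rightarrow> nat" where
  "quotient_rank scl Z B = (GREATEST r. \<exists>x :: nat \<Rightarrow> 'm. (\<forall>a<r. x a \<in> Z) \<and>
     (\<forall>c :: nat \<Rightarrow> 'k. (\<Sum>a<r. scl (c a) (x a)) \<in> B \<longrightarrow> (\<forall>a<r. c a = 0)))"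

section \<open>The graded polynomial ring on a vertex set\<close>

type_synonym ('v, 'k) mpol = "('v \<Rightarrow>\<^sub>0 nat) \<Rightarrow>\<^sub>0 'k"

definition polys :: "'v set \<Rightarrow> ('v, 'k::comm_ring_1) mpol set" where
  "polys V = {f. \<forall>e \<in> Poly_Mapping.keys f. Poly_Mapping.keys e \<subseteq> V}"

definition const_poly :: "'k \<Rightarrow> ('v, 'k::comm_ring_1) mpol" where
  "const_poly c = Poly_Mapping.single 0 c"

definition var_poly :: "'v \<Rightarrow> ('v, 'k::comm_ring_1) mpol" where
  "var_poly t = Poly_Mapping.single (Poly_Mapping.single t 1) 1"

text \<open>Every variable has degree 2.\<close>

definition monom_deg :: "('v \<Rightarrow>\<^sub>0 nat) \<Rightarrow> nat" where
  "monom_deg e = 2 * (\<Sum>t \<in> Poly_Mapping.keys e. Poly_Mapping.lookup e t)"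

text \<open>\<open>f\<close> is homogeneous of degree \<open>d - g\<close> (so \<open>f = 0\<close> if \<open>d < g\<close>); equivalently, \<open>f\<close> times a
  generator of degree \<open>g\<close> has degree \<open>d\<close>.\<close>

definition homog_shift :: "nat \<Rightarrow> nat \<Rightarrow> ('v, 'k::comm_ring_1) mpol \<Rightarrow> bool" where
  "homog_shift g d f \<longleftrightarrow> (\<forall>e \<in> Poly_Mapping.keys f. monom_deg e + g = d)"

definition ideal_of :: "'v set \<Rightarrow> ('v, 'k::comm_ring_1) mpol set \<Rightarrow> ('v, 'k) mpol set" where
  "ideal_of V G = {\<Sum>g\<in>A. c g * g | A c. finite A \<and> A \<subseteq> G \<and> (\<forall>g\<in>A. c g \<in> polys V)}"

text \<open>The Stanley--Reisner ring of \<open>K\<close> is \<open>polys V\<close> modulo \<open>sr_ideal V K\<close>, and the ground ring is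
  \<open>polys V\<close> modulo \<open>aug_ideal V\<close>.\<close>

definition sr_ideal :: "'v set \<Rightarrow> 'v set set \<Rightarrow> ('v, 'k::comm_ring_1) mpol set" where
  "sr_ideal V K = ideal_of V {\<Prod>t\<in>\<sigma>. var_poly t | \<sigma>. \<sigma> \<subseteq> V \<and> \<sigma> \<notin> K}"

definition aug_ideal :: "'v set \<Rightarrow> ('v, 'k::comm_ring_1) mpol set" where
  "aug_ideal V = ideal_of V (var_poly ` V)"

section \<open>Graded free resolutions and Tor\<close>

text \<open>Data of a complex \<open>\<dots> \<rightarrow> F\<^sub>1 \<rightarrow> F\<^sub>0 \<rightarrow> S / J\<close> of finitely generated graded free modules over
  \<open>S = polys V\<close>. The module \<open>F\<^sub>i\<close> has basis \<open>e\<^sub>i\<^sub>,\<^sub>a\<close> for \<open>a < res_rank F i\<close>, with \<open>e\<^sub>i\<^sub>,\<^sub>a\<close> of degree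
  \<open>res_deg F i a\<close>; \<open>res_mat F i a c\<close> is the coefficient at \<open>e\<^sub>i\<^sub>,\<^sub>a\<close> of the image of \<open>e\<^sub>i\<^sub>+\<^sub>1\<^sub>,\<^sub>c\<close>, and
  \<open>res_aug F a\<close> represents the image of \<open>e\<^sub>0\<^sub>,\<^sub>a\<close> in \<open>S / J\<close>.\<close>

record 'r resolution =
  res_rank :: "nat \<Rightarrow> nat"
  res_deg :: "nat \<Rightarrow> nat \<Rightarrow> nat"
  res_aug :: "nat \<Rightarrow> 'r"
  res_mat :: "nat \<Rightarrow> nat \<Rightarrow> nat \<Rightarrow> 'r"

definition res_module ::
    "'v set \<Rightarrow> ('v, 'k::comm_ring_1) mpol resolution \<Rightarrow> nat \<Rightarrow> (nat \<Rightarrow> ('v, 'k) mpol) set" where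
  "res_module V F i = {x. (\<forall>a < res_rank F i. x a \<in> polys V) \<and> (\<forall>a \<ge> res_rank F i. x a = 0)}"

definition res_diff ::
    "('v, 'k::comm_ring_1) mpol resolution \<Rightarrow> nat \<Rightarrow> (nat \<Rightarrow> ('v, 'k) mpol) \<Rightarrow> nat \<Rightarrow> ('v, 'k) mpol" where
  "res_diff F i x = (\<lambda>a. if a < res_rank F i
     then \<Sum>c < res_rank F (Suc i). x c * res_mat F i a c else 0)"

definition res_eps ::
    "('v, 'k::comm_ring_1) mpol resolution \<Rightarrow> (nat \<Rightarrow> ('v, 'k) mpol) \<Rightarrow> ('v, 'k) mpol" where
  "res_eps F x = (\<Sum>a < res_rank F 0. x a * res_aug F a)"

definition graded_free_resolution ::
    "'v set \<Rightarrow> ('v, 'k::comm_ring_1) mpol set \<Rightarrow> ('v, 'k) mpol resolution \<Rightarrow> bool" where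
  "graded_free_resolution V J F \<longleftrightarrow>
     (\<forall>a < res_rank F 0. res_aug F a \<in> polys V \<and> homog_shift 0 (res_deg F 0 a) (res_aug F a)) \<and>
     (\<forall>i. \<forall>a < res_rank F i. \<forall>c < res_rank F (Suc i). res_mat F i a c \<in> polys V \<and>
        homog_shift (res_deg F i a) (res_deg F (Suc i) c) (res_mat F i a c)) \<and>
     (\<forall>f \<in> polys V. \<exists>x \<in> res_module V F 0. f - res_eps F x \<in> J) \<and>
     (\<forall>x \<in> res_module V F 0.
        res_eps F x \<in> J \<longleftrightarrow> (\<exists>y \<in> res_module V F 1. x = res_diff F 0 y)) \<and>
     (\<forall>i. \<forall>x \<in> res_module V F (Suc i).
        res_diff F i x = 0 \<longleftrightarrow> (\<exists>y \<in> res_module V F (Suc (Suc i)). x = res_diff F (Suc i) y))"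

definition res_strand ::
    "'v set \<Rightarrow> ('v, 'k::comm_ring_1) mpol resolution \<Rightarrow> nat \<Rightarrow> nat \<Rightarrow> (nat \<Rightarrow> ('v, 'k) mpol) set" where
  "res_strand V F i d =
     {x \<in> res_module V F i. \<forall>a < res_rank F i. homog_shift (res_deg F i a) d (x a)}"

text \<open>Cycles and boundaries of \<open>(S / I) \<otimes> F = F / I F\<close> in homological degree \<open>i\<close> and internal degree
  \<open>d\<close>, for a homogeneous ideal \<open>I\<close>, represented by their preimages in the degree \<open>d\<close> part of \<open>F\<^sub>i\<close>.\<close>

definition tensor_cycles ::
    "'v set \<Rightarrow> ('v, 'k::comm_ring_1) mpol set \<Rightarrow> ('v, 'k) mpol resolution \<Rightarrow> nat \<Rightarrow> nat \<Rightarrow>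
      (nat \<Rightarrow> ('v, 'k) mpol) set" where
  "tensor_cycles V I F i d =
     {x \<in> res_strand V F i d. case i of 0 \<Rightarrow> True | Suc h \<Rightarrow> \<forall>a < res_rank F h. res_diff F h x a \<in> I}"

definition tensor_boundaries ::
    "'v set \<Rightarrow> ('v, 'k::comm_ring_1) mpol set \<Rightarrow> ('v, 'k) mpol resolution \<Rightarrow> nat \<Rightarrow> nat \<Rightarrow>
      (nat \<Rightarrow> ('v, 'k) mpol) set" where
  "tensor_boundaries V I F i d =
     {x \<in> res_strand V F i d. \<exists>y \<in> res_strand V F (Suc i) d.
        \<forall>a < res_rank F i. x a - res_diff F i y a \<in> I}"

text \<open>The rank over \<open>'k\<close> of the part of internal degree \<open>d\<close> of \<open>Tor\<^sub>i(S / I, S / J)\<close>, computed from a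
  graded free resolution of \<open>S / J\<close>. As usual, the result does not depend on the choice.\<close>

definition tor_rank ::
    "'v set \<Rightarrow> ('v, 'k::idom) mpol set \<Rightarrow> ('v, 'k) mpol set \<Rightarrow> nat \<Rightarrow> nat \<Rightarrow> nat" where
  "tor_rank V I J i d =
     (let F = SOME F. graded_free_resolution V J F
      in quotient_rank (\<lambda>c x a. const_poly c * x a)
           (tensor_cycles V I F i d) (tensor_boundaries V I F i d))"

text \<open>\<open>bigraded_betti TYPE('k) V K i d\<close> is the Betti number of \<open>K\<close> in bidegree \<open>(-i, d)\<close>.\<close>

definition bigraded_betti :: "'k::idom itself \<Rightarrow> 'v set \<Rightarrow> 'v set set \<Rightarrow> nat \<Rightarrow> nat \<Rightarrow> nat" where
  "bigraded_betti _ V K i d =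
     tor_rank V (sr_ideal V K :: ('v, 'k) mpol set) (aug_ideal V) i d"

section \<open>The complex of lines in a coordinate space\<close>

text \<open>Vectors of length \<open>n\<close> are functions on the naturals vanishing from index \<open>n\<close> on.\<close>

definition vscale :: "'f::field \<Rightarrow> (nat \<Rightarrow> 'f) \<Rightarrow> nat \<Rightarrow> 'f" where
  "vscale c x = (\<lambda>i. c * x i)"

interpretation vec: vector_space "vscale :: 'f::field \<Rightarrow> (nat \<Rightarrow> 'f) \<Rightarrow> nat \<Rightarrow> 'f"
  by unfold_locales (auto simp: vscale_def fun_eq_iff algebra_simps)

definition coord_space :: "nat \<Rightarrow> (nat \<Rightarrow> 'f::field) set" where
  "coord_space n = {x. \<forall>i\<ge>n. x i = 0}"

definition lines :: "nat \<Rightarrow> (nat \<Rightarrow> 'f::field) set set" where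
  "lines n = {L. L \<subseteq> coord_space n \<and> vec.subspace L \<and> vec.dim L = 1}"

definition line_complex :: "nat \<Rightarrow> (nat \<Rightarrow> 'f::field) set set set" where
  "line_complex n =
     {\<sigma>. \<sigma> \<subseteq> lines n \<and> finite \<sigma> \<and> vec.dim (vec.span (\<Union>\<sigma>)) = card \<sigma>}"

definition betti_lines :: "'k::idom itself \<Rightarrow> 'f::field itself \<Rightarrow> nat \<Rightarrow> nat \<Rightarrow> nat \<Rightarrow> nat" where
  "betti_lines k _ n i d =
     bigraded_betti k (lines n :: (nat \<Rightarrow> 'f) set set) (line_complex n) i d"

section \<open>Gaussian binomial coefficients\<close>

definition q_fact :: "nat \<Rightarrow> nat \<Rightarrow> rat" where
  "q_fact p k = (\<Prod>i=1..k. of_nat p ^ i - 1)"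

definition gauss_binom :: "nat \<Rightarrow> nat \<Rightarrow> nat \<Rightarrow> rat" where
  "gauss_binom p n l = q_fact p n / (q_fact p l * q_fact p (n - l))"

end

theory Submission
  imports Defs
begin

text \<open>Computing Tor from the Koszul resolution of the ground ring splits the complex by multidegrees. A
  multidegree that is not squarefree contributes a cone, and a squarefree one with support \<open>J\<close> contributes
  the reduced cochains of the full subcomplex on \<open>J\<close> (Hochster's formula). A full subcomplex of the complex
  of lines is the independence complex of a matroid, so by deletion and contraction its cohomology is free
  and concentrated in the degree given by its rank \<open>r(J)\<close>; the rank of that cohomology is therefore the sum
  of \<open>(-1)^(r(J) - |T|)\<close> over the independent \<open>T \<subseteq> J\<close>.

  Hence the Betti number in bidegree \<open>(-i, 2j)\<close> is a sum over the sets \<open>J\<close> of \<open>j\<close> lines that span a space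
  of dimension \<open>j - i\<close>. Grouping the \<open>J\<close> by their span gives (a), and exchanging the sums over \<open>J\<close> and \<open>T\<close>
  in the total Euler characteristic of all sets of \<open>j\<close> lines gives (b).\<close>

section \<open>Ranks and the cohomology of matroids\<close>

text \<open>\<open>tor_rank\<close> evaluates Tor on a resolution picked by \<open>SOME\<close>, so
  nothing can be computed before any two graded resolutions are known to give the same rank;
  afterwards the Koszul complex is a legitimate choice. A second obstacle is the coefficient ring:
  over the integers, ranks alone do not control extensions or torsion. What is carried through the
  argument is therefore \<open>free_quot\<close>, a finite family of cycles that is a basis modulo
  boundaries, stated on representatives so that no quotient module has to be formed. Freeness
  survives deletion and contraction because the degrees fit: in the long exact sequence of the two
  smaller matroids, wherever a class can occur in the middle term, both neighbouring connecting maps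
  have a zero source or a zero target, so bases of the two ends combine to a basis of the middle.
  The size of the basis is tracked alongside as an alternating count of independent sets; no
  shelling order or Mobius function enters.\<close>

definition free_quot ::
    "('k::comm_ring_1 \<Rightarrow> 'm::ab_group_add \<Rightarrow> 'm) \<Rightarrow> 'm set \<Rightarrow> 'm set \<Rightarrow> nat \<Rightarrow> bool" where
  "free_quot scl Z B N \<longleftrightarrow> (\<exists>x :: nat \<Rightarrow> 'm. (\<forall>a<N. x a \<in> Z) \<and>
     (\<forall>z\<in>Z. \<exists>c. z - (\<Sum>a<N. scl (c a) (x a)) \<in> B) \<and>
     (\<forall>c. (\<Sum>a<N. scl (c a) (x a)) \<in> B \<longrightarrow> (\<forall>a<N. c a = 0)))"

text \<open>Gaussian elimination without division: the pivot \<open>M a0 N\<close> clears column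
  \<open>N\<close> by cross-multiplication, and since a domain has no zero divisors, the
  coefficients found for the smaller system stay non-zero after multiplication by the pivot.\<close>

lemma linear_dependence_idom:
  fixes M :: "'a \<Rightarrow> nat \<Rightarrow> 'k::idom"
  assumes "finite R" "card R > N"
  shows "\<exists>c. (\<exists>a\<in>R. c a \<noteq> 0) \<and> (\<forall>b<N. (\<Sum>a\<in>R. c a * M a b) = 0)"
  using assms
proof (induction N arbitrary: R M)
  case 0
  then have "R \<noteq> {}" by auto
  then show ?case by (intro exI[of _ "\<lambda>_. 1"]) auto
next
  case (Suc N)
  show ?case
  proof (cases "\<forall>a\<in>R. M a N = 0")
    case True
    obtain c where c: "\<exists>a\<in>R. c a \<noteq> 0" "\<forall>b<N. (\<Sum>a\<in>R. c a * M a b) = 0"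
      using Suc.IH[of R M] Suc.prems by auto
    have "(\<Sum>a\<in>R. c a * M a N) = 0" using True by simp
    with c show ?thesis by (metis less_Suc_eq)
  next
    case False
    then obtain a0 where a0: "a0 \<in> R" "M a0 N \<noteq> 0" by blast
    let ?R = "R - {a0}"
    let ?M = "\<lambda>a b. M a0 N * M a b - M a N * M a0 b"
    have "card ?R > N" using Suc.prems a0 by simp
    then obtain c where c: "\<exists>a\<in>?R. c a \<noteq> 0" "\<forall>b<N. (\<Sum>a\<in>?R. c a * ?M a b) = 0"
      using Suc.IH[of ?R ?M] Suc.prems by auto
    \<comment> \<open>The pivot row receives the coefficient that cancels column \<open>N\<close>;
      all other columns reduce to the relation for \<open>?M\<close>.\<close>
    define c' where "c' a = (if a = a0 then - (\<Sum>a\<in>?R. c a * M a N) else M a0 N * c a)" for a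
    have split: "(\<Sum>a\<in>R. c' a * M a b) = (\<Sum>a\<in>?R. c a * ?M a b)" for b
    proof -
      have "(\<Sum>a\<in>R. c' a * M a b) = c' a0 * M a0 b + (\<Sum>a\<in>?R. c' a * M a b)"
        using a0 Suc.prems by (simp add: sum.remove)
      also have "(\<Sum>a\<in>?R. c' a * M a b) = (\<Sum>a\<in>?R. M a0 N * c a * M a b)"
        by (rule sum.cong) (auto simp: c'_def)
      also have "c' a0 * M a0 b = - (\<Sum>a\<in>?R. c a * M a N * M a0 b)"
        by (simp add: c'_def sum_distrib_right)
      finally show ?thesis by (simp add: algebra_simps sum_subtractf)
    qed
    have "\<forall>b<Suc N. (\<Sum>a\<in>R. c' a * M a b) = 0"
      unfolding split using c(2) by (auto simp: less_Suc_eq algebra_simps)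
    moreover have "\<exists>a\<in>R. c' a \<noteq> 0" using c(1) a0 by (auto simp: c'_def)
    ultimately show ?thesis by blast
  qed
qed

text \<open>More than \<open>N\<close> classes, written in the basis, give a matrix with more rows
  than columns, and a relation among its rows is a relation modulo \<open>B\<close>. So
  \<open>N\<close> is the maximum, over a domain as over a field.\<close>

lemma quotient_rank_eqI:
  fixes scl :: "'k::idom \<Rightarrow> 'm::ab_group_add \<Rightarrow> 'm"
  assumes "module scl" and B: "module.subspace scl B" and free: "free_quot scl Z B N"
  shows "quotient_rank scl Z B = N"
proof -
  interpret module scl by fact
  obtain x where x: "\<forall>a<N. x a \<in> Z" "\<forall>z\<in>Z. \<exists>c. z - (\<Sum>a<N. scl (c a) (x a)) \<in> B"
     "\<forall>c. (\<Sum>a<N. scl (c a) (x a)) \<in> B \<longrightarrow> (\<forall>a<N. c a = 0)"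
    using free unfolding free_quot_def by blast
  show ?thesis unfolding quotient_rank_def
  proof (rule Greatest_equality)
    show "\<exists>x. (\<forall>a<N. x a \<in> Z) \<and> (\<forall>c. (\<Sum>a<N. scl (c a) (x a)) \<in> B \<longrightarrow> (\<forall>a<N. c a = 0))"
      using x by blast
  next
    fix r :: nat assume "\<exists>y. (\<forall>a<r. y a \<in> Z) \<and> (\<forall>c. (\<Sum>a<r. scl (c a) (y a)) \<in> B \<longrightarrow> (\<forall>a<r. c a = 0))"
    then obtain y where y: "\<And>a. a < r \<Longrightarrow> y a \<in> Z"
      "\<And>c. (\<Sum>a<r. scl (c a) (y a)) \<in> B \<Longrightarrow> \<forall>a<r. c a = 0" by blast
    have "\<forall>a. \<exists>c. a < r \<longrightarrow> y a - (\<Sum>b<N. scl (c b) (x b)) \<in> B" using y(1) x(2) by blast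
    then obtain M where M: "\<And>a. a < r \<Longrightarrow> y a - (\<Sum>b<N. scl (M a b) (x b)) \<in> B" by metis
    show "r \<le> N"
    proof (rule ccontr)
      assume "\<not> r \<le> N"
      then obtain c where c: "\<exists>a<r. c a \<noteq> 0" "\<forall>b<N. (\<Sum>a<r. c a * M a b) = 0"
        using linear_dependence_idom[of "{..<r}" N M] by auto
      have "(\<Sum>a<r. scl (c a) (y a - (\<Sum>b<N. scl (M a b) (x b)))) \<in> B"
        by (intro subspace_sum[OF B] subspace_scale[OF B]) (auto simp: M)
      also have "(\<Sum>a<r. scl (c a) (y a - (\<Sum>b<N. scl (M a b) (x b)))) =
          (\<Sum>a<r. scl (c a) (y a)) - (\<Sum>b<N. scl (\<Sum>a<r. c a * M a b) (x b))"
        by (simp add: scale_right_diff_distrib sum_subtractf scale_sum_right scale_sum_left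
            sum.swap[of _ "{..<r}"])
      also have "\<dots> = (\<Sum>a<r. scl (c a) (y a))" using c(2) by simp
      finally show False using y(2)[of c] c(1) by blast
    qed
  qed
qed

section \<open>Signed differentials on subsets and splitting off one vertex\<close>

definition ksgn :: "('v \<Rightarrow> nat) \<Rightarrow> 'v \<Rightarrow> 'v set \<Rightarrow> 'k::comm_ring_1" where
  "ksgn ord w S = (-1) ^ card {u\<in>S. ord u < ord w}"

lemma ksgn_sq [simp]: "ksgn ord w S * ksgn ord w S = 1"
  by (simp add: ksgn_def flip: power_mult_distrib)

lemma ksgn_sq_left [simp]: "ksgn ord w S * (ksgn ord w S * x) = x"
  by (metis ksgn_sq mult.assoc mult_1)

lemma ksgn_insert:
  assumes "finite S" "v \<notin> S"
  shows "ksgn ord w (insert v S) = (if ord v < ord w then - ksgn ord w S else ksgn ord w S)"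
proof -
  have "{u \<in> insert v S. ord u < ord w} =
     (if ord v < ord w then insert v {u\<in>S. ord u < ord w} else {u\<in>S. ord u < ord w})" by auto
  then show ?thesis using assms by (simp add: ksgn_def)
qed

text \<open>Exactly one of the two vertices precedes the other, so exactly one of the two signs
  changes once the other vertex has been inserted.\<close>

lemma ksgn_anticomm:
  assumes "finite S" "v \<notin> S" "w \<notin> S" "ord v \<noteq> ord w"
  shows "ksgn ord w (insert v S) * ksgn ord v (insert w S) = - (ksgn ord w S * ksgn ord v S)"
  using assms by (auto simp: ksgn_insert)

text \<open>The coefficient at \<open>S\<close> of the contraction differential on an exterior
  algebra; \<open>ksgn ord w S\<close> is the sign of moving \<open>w\<close> to its place in the
  ordered set \<open>insert w S\<close>. The differential lowers the size of subsets, hence enlarges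
  complements, and so becomes a coboundary on faces.\<close>

definition cob :: "('v \<Rightarrow> nat) \<Rightarrow> 'v set \<Rightarrow> ('v set \<Rightarrow> 'k::comm_ring_1) \<Rightarrow> 'v set \<Rightarrow> 'k" where
  "cob ord A z S = (\<Sum>w\<in>A - S. ksgn ord w S * z (insert w S))"

lemma cob_add: "cob ord A (\<lambda>S. f S + g S) S = cob ord A f S + cob ord A g S"
  by (simp add: cob_def algebra_simps sum.distrib)

lemma cob_diff: "cob ord A (\<lambda>S. f S - g S) S = cob ord A f S - cob ord A g S"
  by (simp add: cob_def algebra_simps sum_subtractf)

lemma cob_uminus: "cob ord A (\<lambda>S. - f S) S = - cob ord A f S"
  by (simp add: cob_def sum_negf)

lemma cob_scale: "cob ord A (\<lambda>S. c * f S) S = c * cob ord A f S"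
  by (simp add: cob_def sum_distrib_left ac_simps)

lemma cob_zero: "cob ord A (\<lambda>_. 0) S = 0"
  by (simp add: cob_def)

lemma cob_sum: "cob ord A (\<lambda>S. \<Sum>a\<in>I. f a S) S = (\<Sum>a\<in>I. cob ord A (f a) S)"
  by (simp add: cob_def sum_distrib_left sum.swap[of _ I])

lemma cob_cong:
  assumes "\<And>T. T \<subseteq> A \<Longrightarrow> f T = g T" "S \<subseteq> A"
  shows "cob ord A f S = cob ord A g S"
  unfolding cob_def using assms by (intro sum.cong refl) auto

text \<open>Splitting off \<open>v\<close> presents the complex on \<open>insert v A\<close> as a mapping cone: writing
  \<open>z = (a, b)\<close> with \<open>a S = z S\<close> and \<open>b S = \<plusminus> z (insert v S)\<close>, the differential becomes
  \<open>(a, b) \<mapsto> (d a + b, - d b)\<close>.\<close>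

definition link_part :: "('v \<Rightarrow> nat) \<Rightarrow> 'v \<Rightarrow> ('v set \<Rightarrow> 'k::comm_ring_1) \<Rightarrow> 'v set \<Rightarrow> 'k" where
  "link_part ord v z S = ksgn ord v S * z (insert v S)"

definition join_parts ::
    "('v \<Rightarrow> nat) \<Rightarrow> 'v \<Rightarrow> ('v set \<Rightarrow> 'k::comm_ring_1) \<Rightarrow> ('v set \<Rightarrow> 'k) \<Rightarrow> 'v set \<Rightarrow> 'k" where
  "join_parts ord v a b S = (if v \<in> S then ksgn ord v (S - {v}) * b (S - {v}) else a S)"

lemma link_part_join [simp]: "v \<notin> S \<Longrightarrow> link_part ord v (join_parts ord v a b) S = b S"
  by (simp add: link_part_def join_parts_def)

lemma join_parts_notin [simp]: "v \<notin> S \<Longrightarrow> join_parts ord v a b S = a S"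
  by (simp add: join_parts_def)

lemma join_parts_insert [simp]:
  "v \<notin> S \<Longrightarrow> join_parts ord v a b (insert v S) = ksgn ord v S * b S"
  by (simp add: join_parts_def)

lemma insert_link_part: "z (insert v S) = ksgn ord v S * link_part ord v z S"
  by (simp add: link_part_def)

lemma cob_insert_notin:
  assumes "finite A" "v \<notin> A" "S \<subseteq> A"
  shows "cob ord (insert v A) z S = cob ord A z S + link_part ord v z S"
proof -
  have "insert v A - S = insert v (A - S)" using assms by auto
  then show ?thesis using assms by (simp add: cob_def link_part_def)
qed

text \<open>The minus sign in the second component of the cone is \<open>ksgn_anticomm\<close>:
  \<open>v\<close> and \<open>w\<close> are removed in the opposite order on the two sides.\<close>

lemma cob_insert_in:
  fixes z :: "'v set \<Rightarrow> 'k::comm_ring_1"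
  assumes "finite A" "v \<notin> A" "inj_on ord (insert v A)" "S \<subseteq> A"
  shows "cob ord (insert v A) z (insert v S) = - (ksgn ord v S * cob ord A (link_part ord v z) S)"
proof -
  have eq: "insert v A - insert v S = A - S" using assms by auto
  have "cob ord (insert v A) z (insert v S) =
      (\<Sum>w\<in>A - S. ksgn ord w (insert v S) * z (insert v (insert w S)))"
    unfolding cob_def eq by (simp add: insert_commute)
  also have "\<dots> = (\<Sum>w\<in>A - S. - (ksgn ord v S * (ksgn ord w S * link_part ord v z (insert w S))))"
  proof (rule sum.cong[OF refl])
    fix w assume w: "w \<in> A - S"
    then have "w \<noteq> v" "ord v \<noteq> ord w" using assms by (auto dest: inj_onD)
    have fin: "finite S" using assms finite_subset by blast
    have "(ksgn ord w (insert v S) :: 'k) = - (ksgn ord w S * ksgn ord v S * ksgn ord v (insert w S))"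
    proof -
      have "(ksgn ord w (insert v S) :: 'k) =
          (ksgn ord w (insert v S) * ksgn ord v (insert w S)) * ksgn ord v (insert w S)"
        by (simp add: mult.assoc)
      also have "\<dots> = - (ksgn ord w S * ksgn ord v S * ksgn ord v (insert w S))"
        by (subst ksgn_anticomm) (use fin w assms \<open>ord v \<noteq> ord w\<close> in auto)
      finally show ?thesis .
    qed
    then show "ksgn ord w (insert v S) * z (insert v (insert w S)) =
        - (ksgn ord v S * (ksgn ord w S * link_part ord v z (insert w S)))"
      by (simp add: link_part_def algebra_simps)
  qed
  also have "\<dots> = - (ksgn ord v S * cob ord A (link_part ord v z) S)"
    by (simp add: cob_def sum_negf sum_distrib_left)
  finally show ?thesis .
qed

text \<open>In cone form, applying \<open>(a, b) \<mapsto> (d a + b, - d b)\<close> twice gives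
  \<open>d d a + d b - d b\<close> and \<open>d d b\<close>, which vanish by induction on the vertex
  set.\<close>

lemma cob_cob:
  assumes "finite A" "inj_on ord A" "S \<subseteq> A"
  shows "cob ord A (cob ord A z) S = 0"
  using assms
proof (induction A arbitrary: S z rule: finite_induct)
  case empty
  then show ?case by (simp add: cob_def)
next
  case (insert v A)
  have inj: "inj_on ord A" using insert.prems by (auto intro: inj_on_subset)
  have link: "link_part ord v (cob ord (insert v A) z) T = - cob ord A (link_part ord v z) T"
    if "T \<subseteq> A" for T
    using insert.hyps insert.prems that by (subst link_part_def) (simp add: cob_insert_in)
  have a: "cob ord A (cob ord (insert v A) z) T = cob ord A (link_part ord v z) T"
    if T: "T \<subseteq> A" for T
  proof -
    have "cob ord A (cob ord (insert v A) z) T =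
        cob ord A (\<lambda>T. cob ord A z T + link_part ord v z T) T"
      using T insert.hyps by (intro cob_cong cob_insert_notin) auto
    then show ?thesis using insert.IH[OF inj T] by (simp add: cob_add)
  qed
  have b: "cob ord A (link_part ord v (cob ord (insert v A) z)) T = 0" if T: "T \<subseteq> A" for T
  proof -
    have "cob ord A (link_part ord v (cob ord (insert v A) z)) T =
        cob ord A (\<lambda>T. - cob ord A (link_part ord v z) T) T"
      using T link by (intro cob_cong) auto
    then show ?thesis using insert.IH[OF inj T] by (simp add: cob_uminus)
  qed
  show ?case
  proof (cases "v \<in> S")
    case False
    then have "S \<subseteq> A" using insert.prems by auto
    then show ?thesis using insert.hyps by (simp add: cob_insert_notin a link)
  next
    case True
    then obtain T where "S = Set.insert v T" "T \<subseteq> A"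
      using insert.prems by (metis Diff_insert_absorb Diff_subset_conv insert_is_Un mk_disjoint_insert)
    then show ?thesis using insert by (simp add: cob_insert_in b)
  qed
qed

text \<open>Cycles and boundaries in degree \<open>i\<close> of the quotient complex spanned by the \<open>S \<subseteq> A\<close> with
  \<open>P (A - S)\<close>; passing to complements, these are the cochains of the complex \<open>P\<close>. The degree is an
  integer so that negative degrees are available as the zero module.\<close>

definition ccyc ::
    "('v \<Rightarrow> nat) \<Rightarrow> 'v set \<Rightarrow> ('v set \<Rightarrow> bool) \<Rightarrow> int \<Rightarrow> ('v set \<Rightarrow> 'k::comm_ring_1) set" where
  "ccyc ord A P i = {z. \<forall>S\<subseteq>A. P (A - S) \<and> int (card S) + 1 = i \<longrightarrow> cob ord A z S = 0}"

definition cbnd ::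
    "('v \<Rightarrow> nat) \<Rightarrow> 'v set \<Rightarrow> ('v set \<Rightarrow> bool) \<Rightarrow> int \<Rightarrow> ('v set \<Rightarrow> 'k::comm_ring_1) set" where
  "cbnd ord A P i = {z. \<exists>y. \<forall>S\<subseteq>A. P (A - S) \<and> int (card S) = i \<longrightarrow> z S = cob ord A y S}"

abbreviation cfree ::
    "'k::comm_ring_1 itself \<Rightarrow> ('v \<Rightarrow> nat) \<Rightarrow> 'v set \<Rightarrow> ('v set \<Rightarrow> bool) \<Rightarrow> int \<Rightarrow> nat \<Rightarrow> bool" where
  "cfree k ord A P i N \<equiv>
     free_quot (\<lambda>(c::'k) z S. c * z S) (ccyc ord A P i) (cbnd ord A P i) N"

lemma cfree_0: "cfree TYPE('k::comm_ring_1) ord A P i 0 \<longleftrightarrow>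
    (ccyc ord A P i :: ('v set \<Rightarrow> 'k) set) \<subseteq> cbnd ord A P i"
  unfolding free_quot_def by auto

lemma cfree_0_iff: "cfree TYPE('k::comm_ring_1) ord A P i 0 \<longleftrightarrow>
    (\<forall>z :: 'v set \<Rightarrow> 'k. (\<forall>S\<subseteq>A. P (A - S) \<and> int (card S) + 1 = i \<longrightarrow> cob ord A z S = 0) \<longrightarrow>
      (\<exists>y. \<forall>S\<subseteq>A. P (A - S) \<and> int (card S) = i \<longrightarrow> z S = cob ord A y S))"
  unfolding cfree_0 unfolding ccyc_def cbnd_def by auto

lemma cfree_no_faces: "(\<And>T. T \<subseteq> A \<Longrightarrow> \<not> P T) \<Longrightarrow> cfree TYPE('k::comm_ring_1) ord A P i 0"
  unfolding cfree_0_iff by (simp add: Diff_subset)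

text \<open>An explicit primitive: the pair \<open>(0, a)\<close> is mapped to
  \<open>(a, - d a)\<close>, and the cycle equation \<open>d a + b = 0\<close> turns the second
  entry into \<open>b\<close>.\<close>

lemma cfree_cone:
  fixes ord :: "'v \<Rightarrow> nat"
  assumes "finite A" "inj_on ord (insert v A)" "v \<notin> A"
    and cone: "\<And>T. T \<subseteq> A \<Longrightarrow> P (insert v T) \<longleftrightarrow> P T"
  shows "cfree TYPE('k::comm_ring_1) ord (insert v A) P i 0"
  unfolding cfree_0_iff
proof (intro allI impI)
  fix z :: "'v set \<Rightarrow> 'k"
  assume cyc: "\<forall>S\<subseteq>insert v A. P (insert v A - S) \<and> int (card S) + 1 = i \<longrightarrow> cob ord (insert v A) z S = 0"
  have "z S = cob ord (insert v A) (join_parts ord v (\<lambda>_. 0) z) S"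
    if S: "S \<subseteq> insert v A" "P (insert v A - S)" "int (card S) = i" for S
  proof (cases "v \<in> S")
    case False
    then have "S \<subseteq> A" using S by auto
    moreover from this have "cob ord A (join_parts ord v (\<lambda>_. 0) z) S = cob ord A (\<lambda>_. 0) S"
      using assms by (intro cob_cong join_parts_notin) auto
    ultimately show ?thesis using assms False by (simp add: cob_insert_notin cob_zero)
  next
    case True
    then obtain T where T: "S = insert v T" "T \<subseteq> A" "v \<notin> T"
      using S by (metis Diff_insert_absorb Diff_subset_conv insert_is_Un mk_disjoint_insert)
    have diff: "insert v A - insert v T = A - T" "insert v A - T = insert v (A - T)"
      using T assms by auto
    \<comment> \<open>The cycle equation is only known on faces containing \<open>v\<close>, whereas
      the value sought belongs to the face \<open>A - T\<close>; the cone property bridges the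
      two.\<close>
    have "P (insert v A - T)" using S cone[of "A - T"] T diff by auto
    moreover have "int (card T) + 1 = i"
      using S T assms finite_subset[of T A] by auto
    ultimately have "cob ord A z T + link_part ord v z T = 0"
      using cyc T assms cob_insert_notin by (metis subset_insertI2)
    then have "cob ord A z T = - link_part ord v z T" by (simp add: add_eq_0_iff2)
    moreover have "cob ord A (link_part ord v (join_parts ord v (\<lambda>_. 0) z)) T = cob ord A z T"
      using assms T by (intro cob_cong link_part_join) auto
    ultimately show ?thesis
      unfolding T(1) using assms T by (simp add: cob_insert_in) (simp add: link_part_def)
  qed
  then show "\<exists>y. \<forall>S\<subseteq>insert v A. P (insert v A - S) \<and> int (card S) = i \<longrightarrow> z S = cob ord (insert v A) y S"
    by blast
qed

lemma sum_lessThan_add: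
  fixes f :: "nat \<Rightarrow> 'a::comm_monoid_add"
  shows "(\<Sum>a<M + N. f a) = (\<Sum>a<M. f a) + (\<Sum>a<N. f (M + a))"
  by (induction N) (auto simp: add.assoc)

lemma sum_fun_apply: "(\<Sum>a\<in>I. f a) x = (\<Sum>a\<in>I. f a x)"
  by (induction I rule: infinite_finite_induct) (auto simp: zero_fun_def)

text \<open>A split short exact piece of the long exact sequence of the cone: contraction in degree
  \<open>i\<close> is the subcomplex, deletion in degree \<open>i - 1\<close> the quotient.
  \<open>lift\<close> makes the obstruction to extending a cycle of the quotient vanish, and
  \<open>inj\<close> prevents the connecting map from killing classes of the subcomplex. Each is
  only demanded when there are classes that it concerns, hence the alternatives
  \<open>N2 = 0\<close> and \<open>N1 = 0\<close>.\<close>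

lemma cfree_mapping_cone:
  fixes ord :: "'v \<Rightarrow> nat"
  assumes A: "finite A" "v \<notin> A" "inj_on ord (insert v A)"
    and down: "\<And>T. T \<subseteq> A \<Longrightarrow> P (insert v T) \<Longrightarrow> P T"
    and contr: "cfree TYPE('k::comm_ring_1) ord A (\<lambda>T. P (insert v T)) i N1"
    and del: "cfree TYPE('k) ord A P (i - 1) N2"
    and lift: "N2 = 0 \<or> cfree TYPE('k) ord A (\<lambda>T. P (insert v T)) (i - 1) 0"
    and inj: "N1 = 0 \<or> cfree TYPE('k) ord A P i 0"
  shows "cfree TYPE('k) ord (insert v A) P i (N1 + N2)"
proof -
  let ?P1 = "\<lambda>T. P (insert v T)"
  let ?d = "cob ord A :: ('v set \<Rightarrow> 'k) \<Rightarrow> _"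
  let ?d' = "cob ord (insert v A) :: ('v set \<Rightarrow> 'k) \<Rightarrow> _"
  have fin: "finite S" if "S \<subseteq> A" for S using that A finite_subset by blast
  have diff: "insert v A - S = insert v (A - S)" "insert v A - insert v S = A - S"
    if "S \<subseteq> A" for S using that A by auto
  have card: "card (insert v S) = card S + 1" if "S \<subseteq> A" for S
    using that A fin[OF that] by (metis Suc_eq_plus1 card_insert_disjoint subsetD)
  have vS: "v \<notin> S" if "S \<subseteq> A" for S using that A by auto
  obtain x where x: "\<And>a. a < N1 \<Longrightarrow> x a \<in> ccyc ord A ?P1 i"
     "\<And>z. z \<in> ccyc ord A ?P1 i \<Longrightarrow> \<exists>c::nat \<Rightarrow> 'k. z - (\<Sum>a<N1. (\<lambda>S. c a * x a S)) \<in> cbnd ord A ?P1 i"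
     "\<And>c. (\<Sum>a<N1. (\<lambda>S. c a * x a S)) \<in> cbnd ord A ?P1 i \<Longrightarrow> \<forall>a<N1. c a = 0"
    using contr unfolding free_quot_def by blast
  obtain y where y: "\<And>a. a < N2 \<Longrightarrow> y a \<in> ccyc ord A P (i - 1)"
     "\<And>z. z \<in> ccyc ord A P (i - 1) \<Longrightarrow> \<exists>c::nat \<Rightarrow> 'k. z - (\<Sum>a<N2. (\<lambda>S. c a * y a S)) \<in> cbnd ord A P (i - 1)"
     "\<And>c. (\<Sum>a<N2. (\<lambda>S. c a * y a S)) \<in> cbnd ord A P (i - 1) \<Longrightarrow> \<forall>a<N2. c a = 0"
    using del unfolding free_quot_def by blast
  \<comment> \<open>A cycle \<open>y a\<close> of the deletion extends to the pair
    \<open>(u a, y a)\<close> as soon as \<open>d (u a) = - y a\<close> holds on the faces of the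
    contraction.\<close>
  have "\<forall>a. \<exists>u. a < N2 \<longrightarrow> (\<forall>S\<subseteq>A. P (insert v (A - S)) \<and> int (card S) = i - 1 \<longrightarrow> - y a S = ?d u S)"
  proof (intro allI)
    fix a
    show "\<exists>u. a < N2 \<longrightarrow> (\<forall>S\<subseteq>A. P (insert v (A - S)) \<and> int (card S) = i - 1 \<longrightarrow> - y a S = ?d u S)"
    proof (cases "a < N2")
      case True
      then have ex: "cfree TYPE('k) ord A ?P1 (i - 1) 0" using lift by auto
      have "\<forall>S\<subseteq>A. ?P1 (A - S) \<and> int (card S) + 1 = i - 1 \<longrightarrow> ?d (\<lambda>S. - y a S) S = 0"
        using y(1)[OF True] down by (auto simp: ccyc_def cob_uminus)
      then show ?thesis using ex unfolding cfree_0_iff by blast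
    qed auto
  qed
  then obtain u where u: "\<And>a S. \<lbrakk>a < N2; S \<subseteq> A; P (insert v (A - S)); int (card S) = i - 1\<rbrakk> \<Longrightarrow> ?d (u a) S = - y a S"
    by metis
  \<comment> \<open>The new basis: the pairs \<open>(x, 0)\<close> from the contraction, then the
    lifted pairs \<open>(u, y)\<close> from the deletion.\<close>
  define X where "X a = (if a < N1 then join_parts ord v (x a) (\<lambda>_. 0)
     else join_parts ord v (u (a - N1)) (y (a - N1)))" for a
  have sumX: "(\<Sum>a<N1 + N2. (\<lambda>S. c a * X a S)) =
     join_parts ord v (\<lambda>S. (\<Sum>a<N1. c a * x a S) + (\<Sum>a<N2. c (N1 + a) * u a S))
       (\<lambda>S. \<Sum>a<N2. c (N1 + a) * y a S)" for c
  proof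
    fix S
    show "(\<Sum>a<N1 + N2. (\<lambda>S. c a * X a S)) S =
     join_parts ord v (\<lambda>S. (\<Sum>a<N1. c a * x a S) + (\<Sum>a<N2. c (N1 + a) * u a S))
       (\<lambda>S. \<Sum>a<N2. c (N1 + a) * y a S) S"
      by (simp add: sum_fun_apply sum_lessThan_add X_def join_parts_def sum_distrib_left ac_simps)
  qed
  have cob_join: "?d' (join_parts ord v a b) S = ?d a S + b S"
      "?d' (join_parts ord v a b) (insert v S) = - (ksgn ord v S * ?d b S)" if S: "S \<subseteq> A" for a b S
  proof -
    have "?d (join_parts ord v a b) S = ?d a S"
      using S A by (intro cob_cong join_parts_notin) auto
    then show "?d' (join_parts ord v a b) S = ?d a S + b S"
      using S A vS by (simp add: cob_insert_notin)
    have "?d (link_part ord v (join_parts ord v a b)) S = ?d b S"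
      using S A by (intro cob_cong link_part_join) auto
    then show "?d' (join_parts ord v a b) (insert v S) = - (ksgn ord v S * ?d b S)"
      using S A by (simp add: cob_insert_in)
  qed
  have split: "S \<subseteq> A \<or> (\<exists>T\<subseteq>A. S = insert v T)" if "S \<subseteq> insert v A" for S
    using that by (metis subset_insert subset_insert_iff insert_Diff)
  have cyc_join: "join_parts ord v a b \<in> ccyc ord (insert v A) P i"
    if a: "\<And>S. \<lbrakk>S \<subseteq> A; P (insert v (A - S)); int (card S) + 1 = i\<rbrakk> \<Longrightarrow> ?d a S + b S = 0"
     and b: "\<And>S. \<lbrakk>S \<subseteq> A; P (A - S); int (card S) + 1 = i - 1\<rbrakk> \<Longrightarrow> ?d b S = 0" for a b
    unfolding ccyc_def
  proof (intro CollectI allI impI)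
    fix S assume S: "S \<subseteq> insert v A" "P (insert v A - S) \<and> int (card S) + 1 = i"
    from split[OF S(1)] show "?d' (join_parts ord v a b) S = 0"
    proof (elim disjE exE conjE)
      assume SA: "S \<subseteq> A"
      then show ?thesis using S a[OF SA] diff by (simp add: cob_join)
    next
      fix T assume T: "T \<subseteq> A" "S = insert v T"
      then show ?thesis using S b[OF T(1)] diff card by (simp add: cob_join)
    qed
  qed
  \<comment> \<open>Being a boundary is read as two equations on \<open>A\<close>, with primitive
    \<open>(\<alpha>, \<beta>)\<close>, so that the hypotheses about the two smaller complexes
    apply.\<close>
  have bnd_iff: "z \<in> cbnd ord (insert v A) P i \<longleftrightarrow> (\<exists>\<alpha> \<beta>.
      (\<forall>S\<subseteq>A. P (insert v (A - S)) \<and> int (card S) = i \<longrightarrow> z S = ?d \<alpha> S + \<beta> S) \<and>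
      (\<forall>S\<subseteq>A. P (A - S) \<and> int (card S) = i - 1 \<longrightarrow> link_part ord v z S = - ?d \<beta> S))"
    (is "_ \<longleftrightarrow> (\<exists>\<alpha> \<beta>. ?R \<alpha> \<beta>)") for z
  proof
    assume "z \<in> cbnd ord (insert v A) P i"
    then obtain w where w: "\<And>S. \<lbrakk>S \<subseteq> insert v A; P (insert v A - S); int (card S) = i\<rbrakk> \<Longrightarrow> z S = ?d' w S"
      unfolding cbnd_def by blast
    have "?R w (link_part ord v w)"
    proof (intro conjI allI impI)
      fix S assume S: "S \<subseteq> A" "P (insert v (A - S)) \<and> int (card S) = i"
      then show "z S = ?d w S + link_part ord v w S"
        using w[of S] A diff by (simp add: cob_insert_notin subset_insertI2)
    next
      fix S assume S: "S \<subseteq> A" "P (A - S) \<and> int (card S) = i - 1"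
      then show "link_part ord v z S = - ?d (link_part ord v w) S"
        using w[of "insert v S"] A diff card subset_insertI2[of S A v]
        by (subst link_part_def) (simp add: cob_insert_in)
    qed
    then show "\<exists>\<alpha> \<beta>. ?R \<alpha> \<beta>" by blast
  next
    assume "\<exists>\<alpha> \<beta>. ?R \<alpha> \<beta>"
    then obtain \<alpha> \<beta> where R: "?R \<alpha> \<beta>" by blast
    show "z \<in> cbnd ord (insert v A) P i" unfolding cbnd_def
    proof (intro CollectI exI[of _ "join_parts ord v \<alpha> \<beta>"] allI impI)
      fix S assume S: "S \<subseteq> insert v A" "P (insert v A - S) \<and> int (card S) = i"
      from split[OF S(1)] show "z S = ?d' (join_parts ord v \<alpha> \<beta>) S"
      proof (elim disjE exE conjE)
        assume "S \<subseteq> A"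
        then show ?thesis using S R diff by (simp add: cob_join)
      next
        fix T assume T: "T \<subseteq> A" "S = insert v T"
        then have "link_part ord v z T = - ?d \<beta> T"
          using R S diff(2)[OF T(1)] card[OF T(1)] by auto
        then show ?thesis unfolding T(2) using T(1)
          by (simp add: cob_join insert_link_part[of z v T ord])
      qed
    qed
  qed
  show ?thesis unfolding free_quot_def
  proof (intro exI[of _ X] conjI allI ballI impI)
    fix a assume a: "a < N1 + N2"
    show "X a \<in> ccyc ord (insert v A) P i"
    proof (cases "a < N1")
      case True
      have "join_parts ord v (x a) (\<lambda>_. 0) \<in> ccyc ord (insert v A) P i"
        by (rule cyc_join) (use x(1)[OF True] in \<open>auto simp: ccyc_def cob_zero\<close>)
      then show ?thesis using True unfolding X_def by simp
    next
      case False
      then have "a - N1 < N2" using a by auto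
      then have "join_parts ord v (u (a - N1)) (y (a - N1)) \<in> ccyc ord (insert v A) P i"
        using y(1)[of "a - N1"] u[of "a - N1"] by (intro cyc_join) (auto simp: ccyc_def)
      then show ?thesis using False unfolding X_def by simp
    qed
  next
    fix z :: "'v set \<Rightarrow> 'k" assume z: "z \<in> ccyc ord (insert v A) P i"
    define b where "b = link_part ord v z"
    have a_cyc: "?d z S + b S = 0" if "S \<subseteq> A" "P (insert v (A - S))" "int (card S) + 1 = i" for S
      using z that A diff cob_insert_notin[of A v S ord z] unfolding ccyc_def b_def by auto
    have b_cyc: "?d b S = 0" if "S \<subseteq> A" "P (A - S)" "int (card S) + 1 = i - 1" for S
    proof -
      have "?d' z (insert v S) = 0"
        using z[unfolded ccyc_def, THEN CollectD, rule_format, of "insert v S"]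
          that diff(2)[of S] card[of S] by (simp add: subset_insertI2)
      then have "ksgn ord v S * (ksgn ord v S * ?d b S) = 0"
        using that A by (simp add: cob_insert_in b_def)
      then show ?thesis by simp
    qed
    have "b \<in> ccyc ord A P (i - 1)" unfolding ccyc_def using b_cyc by auto
    then obtain c2 \<beta> where c2: "\<And>S. \<lbrakk>S \<subseteq> A; P (A - S); int (card S) = i - 1\<rbrakk> \<Longrightarrow>
        b S - (\<Sum>a<N2. c2 a * y a S) = ?d \<beta> S"
      using y(2)[of b] unfolding cbnd_def by (auto simp: sum_fun_apply)
    \<comment> \<open>After subtracting the lifted classes, the second component is
      \<open>d \<beta>\<close>. Subtracting also the image \<open>(- \<beta>, d \<beta>)\<close> of
      \<open>(0, - \<beta>)\<close> clears it and leaves \<open>a'\<close> as first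
      component.\<close>
    define a' where "a' S = z S - (\<Sum>a<N2. c2 a * u a S) + \<beta> S" for S
    have "?d a' S = 0" if S: "S \<subseteq> A" "P (insert v (A - S))" "int (card S) + 1 = i" for S
    proof -
      have "P (A - S)" using S down by blast
      then have \<beta>: "?d \<beta> S = b S - (\<Sum>a<N2. c2 a * y a S)" using c2[of S] S by simp
      have "?d a' S = ?d z S - (\<Sum>a<N2. c2 a * ?d (u a) S) + ?d \<beta> S"
        unfolding a'_def by (simp add: cob_add cob_diff cob_sum cob_scale)
      also have "(\<Sum>a<N2. c2 a * ?d (u a) S) = - (\<Sum>a<N2. c2 a * y a S)"
        using S u by (simp add: sum_negf)
      finally show ?thesis using \<beta> a_cyc[OF S] by simp
    qed
    then have "a' \<in> ccyc ord A ?P1 i" unfolding ccyc_def by auto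
    then obtain c1 \<alpha> where c1: "\<And>S. \<lbrakk>S \<subseteq> A; P (insert v (A - S)); int (card S) = i\<rbrakk> \<Longrightarrow>
        a' S - (\<Sum>a<N1. c1 a * x a S) = ?d \<alpha> S"
      using x(2)[of a'] unfolding cbnd_def by (auto simp: sum_fun_apply)
    define c where "c a = (if a < N1 then c1 a else c2 (a - N1))" for a
    have "z - (\<Sum>a<N1 + N2. (\<lambda>S. c a * X a S)) \<in> cbnd ord (insert v A) P i"
      unfolding bnd_iff
    proof (rule exI[of _ \<alpha>], rule exI[of _ "\<lambda>S. - \<beta> S"], intro conjI allI impI)
      fix S assume S: "S \<subseteq> A" "P (insert v (A - S)) \<and> int (card S) = i"
      show "(z - (\<Sum>a<N1 + N2. (\<lambda>S. c a * X a S))) S = ?d \<alpha> S + - \<beta> S"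
        using S c1[of S] vS unfolding sumX by (simp add: a'_def c_def algebra_simps)
    next
      fix S assume S: "S \<subseteq> A" "P (A - S) \<and> int (card S) = i - 1"
      have "link_part ord v (z - (\<Sum>a<N1 + N2. (\<lambda>S. c a * X a S))) S = b S - (\<Sum>a<N2. c2 a * y a S)"
        unfolding sumX using vS[OF S(1)] by (simp add: link_part_def b_def c_def algebra_simps)
      then show "link_part ord v (z - (\<Sum>a<N1 + N2. (\<lambda>S. c a * X a S))) S = - ?d (\<lambda>S. - \<beta> S) S"
        using c2[of S] S by (simp add: cob_uminus)
    qed
    then show "\<exists>c. z - (\<Sum>a<N1 + N2. (\<lambda>S. c a * X a S)) \<in> cbnd ord (insert v A) P i"
      by (intro exI[of _ c])
  next
    fix c :: "nat \<Rightarrow> 'k" and a assume bnd: "(\<Sum>a<N1 + N2. (\<lambda>S. c a * X a S)) \<in> cbnd ord (insert v A) P i"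
      and a: "a < N1 + N2"
    obtain \<alpha> \<beta> where \<alpha>\<beta>: "\<And>S. \<lbrakk>S\<subseteq>A; P (insert v (A - S)); int (card S) = i\<rbrakk> \<Longrightarrow>
        (\<Sum>a<N1. c a * x a S) + (\<Sum>a<N2. c (N1 + a) * u a S) = ?d \<alpha> S + \<beta> S"
      "\<And>S. \<lbrakk>S\<subseteq>A; P (A - S); int (card S) = i - 1\<rbrakk> \<Longrightarrow>
        (\<Sum>a<N2. c (N1 + a) * y a S) = - ?d \<beta> S"
      using bnd vS unfolding bnd_iff sumX by auto
    have "(\<Sum>a<N2. (\<lambda>S. c (N1 + a) * y a S)) \<in> cbnd ord A P (i - 1)"
      unfolding cbnd_def using \<alpha>\<beta>(2)
      by (intro CollectI exI[of _ "\<lambda>S. - \<beta> S"]) (auto simp: sum_fun_apply cob_uminus)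
    then have c2: "\<forall>a<N2. c (N1 + a) = 0" by (rule y(3))
    have c1: "\<forall>a<N1. c a = 0"
    proof (cases "N1 = 0")
      case False
      then have ex: "cfree TYPE('k) ord A P i 0" using inj by auto
      \<comment> \<open>With the coefficients of the lifted classes gone, \<open>\<beta>\<close> is
        a cycle of the deletion; it is exact by \<open>inj\<close>, and its primitive is absorbed
        into \<open>\<alpha>\<close>.\<close>
      have "\<forall>S\<subseteq>A. P (A - S) \<and> int (card S) + 1 = i \<longrightarrow> ?d \<beta> S = 0"
        using \<alpha>\<beta>(2) c2 by auto
      then obtain \<gamma> where \<gamma>: "\<And>S. \<lbrakk>S \<subseteq> A; P (A - S); int (card S) = i\<rbrakk> \<Longrightarrow> \<beta> S = ?d \<gamma> S"
        using ex unfolding cfree_0_iff by metis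
      have "(\<Sum>a<N1. (\<lambda>S. c a * x a S)) \<in> cbnd ord A ?P1 i"
        unfolding cbnd_def using \<alpha>\<beta>(1) c2 \<gamma> down
        by (intro CollectI exI[of _ "\<lambda>S. \<alpha> S + \<gamma> S"]) (auto simp: sum_fun_apply cob_add)
      then show ?thesis by (rule x(3))
    qed auto
    show "c a = 0" using c1 c2[rule_format, of "a - N1"] a by (cases "a < N1") auto
  qed
qed

text \<open>Everything is restricted to subsets of \<open>A\<close>, so the faces of an ambient
  complex and the contraction \<open>\<lambda>T. P (insert v T)\<close> qualify as they stand. The
  rank is a parameter because it fixes the degree of the cohomology.\<close>

definition matroid_on :: "'v set \<Rightarrow> ('v set \<Rightarrow> bool) \<Rightarrow> nat \<Rightarrow> bool" where
  "matroid_on A P r \<longleftrightarrow> (\<forall>T\<subseteq>A. P T \<longrightarrow> (\<forall>U\<subseteq>T. P U)) \<and>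
     (\<forall>T\<subseteq>A. \<forall>U\<subseteq>A. P T \<and> P U \<and> card T < card U \<longrightarrow> (\<exists>x\<in>U - T. P (insert x T))) \<and>
     (\<exists>T\<subseteq>A. P T \<and> card T = r) \<and> (\<forall>T\<subseteq>A. P T \<longrightarrow> card T \<le> r)"

lemma matroid_on_extend:
  assumes "matroid_on A P r" "finite A" "T \<subseteq> A" "P T"
  shows "\<exists>U. T \<subseteq> U \<and> U \<subseteq> A \<and> P U \<and> card U = r"
  using assms(3,4)
proof (induction "r - card T" arbitrary: T)
  case 0
  then show ?case using assms(1) unfolding matroid_on_def by (metis diff_is_0_eq le_antisym order_refl)
next
  case (Suc k)
  obtain B where B: "B \<subseteq> A" "P B" "card B = r" using assms(1) unfolding matroid_on_def by blast
  then obtain x where x: "x \<in> B - T" "P (insert x T)"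
    using assms(1) Suc.prems Suc.hyps unfolding matroid_on_def
    by (metis less_imp_neq zero_less_Suc zero_less_diff)
  have fin: "finite T" using Suc.prems assms(2) finite_subset by blast
  then have "k = r - card (insert x T)" using Suc.hyps x by simp
  then obtain U where "insert x T \<subseteq> U \<and> U \<subseteq> A \<and> P U \<and> card U = r"
    using Suc.hyps(1)[of "insert x T"] x B Suc.prems by auto
  then show ?case by (intro exI[of _ U]) auto
qed

lemma sum_Pow_insert:
  assumes "finite A" "v \<notin> A"
  shows "(\<Sum>T | T \<subseteq> insert v A \<and> P T. f T) =
    (\<Sum>T | T \<subseteq> A \<and> P T. f T) + (\<Sum>T | T \<subseteq> A \<and> P (insert v T). f (insert v T))"
proof -
  have "{T. T \<subseteq> insert v A \<and> P T} =
      {T. T \<subseteq> A \<and> P T} \<union> insert v ` {T. T \<subseteq> A \<and> P (insert v T)}" (is "?L = ?R")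
  proof
    show "?L \<subseteq> ?R"
    proof
      fix T assume T: "T \<in> ?L"
      show "T \<in> ?R"
      proof (cases "v \<in> T")
        case True
        then have "T = insert v (T - {v})" "T - {v} \<subseteq> A" using T by auto
        then show ?thesis using T by (metis (mono_tags, lifting) CollectD CollectI UnI2 image_eqI)
      qed (use T in auto)
    qed
  qed auto
  moreover have "inj_on (insert v) {T. T \<subseteq> A \<and> P (insert v T)}"
    using assms by (auto intro!: inj_onI dest: insert_ident[THEN iffD1, rotated 2])
  moreover have "sum f ({T. T \<subseteq> A \<and> P T} \<union> insert v ` {T. T \<subseteq> A \<and> P (insert v T)}) =
      sum f {T. T \<subseteq> A \<and> P T} + sum f (insert v ` {T. T \<subseteq> A \<and> P (insert v T)})"
    using assms by (intro sum.union_disjoint) auto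
  ultimately show ?thesis by (simp add: sum.reindex)
qed

text \<open>Deletion and contraction of an element that is neither a loop nor a coloop; a coloop makes the
  complex a cone.\<close>

theorem matroid_cohomology_free:
  fixes ord :: "'v \<Rightarrow> nat"
  assumes "finite A" "inj_on ord A" "matroid_on A P r"
  shows "\<exists>N. int N = (\<Sum>T | T \<subseteq> A \<and> P T. (-1) ^ (r + card T)) \<and>
    (\<forall>i. cfree TYPE('k::comm_ring_1) ord A P i (if i + int r = int (card A) then N else 0))"
  using assms
proof (induction A arbitrary: P r rule: finite_induct)
  case empty
  then have r: "P {}" "r = 0" unfolding matroid_on_def by auto
  have sub: "{T. T \<subseteq> {} \<and> P T} = {{}}" using r by auto
  \<comment> \<open>The only face is the empty one; its class is the reduced cohomology of
    \<open>{{}}\<close> in degree \<open>-1\<close>, which after passing to complements sits in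
    degree 0.\<close>
  have "cfree TYPE('k) ord {} P i (if i = 0 then 1 else 0)" for i
  proof (cases "i = 0")
    case True
    have "cfree TYPE('k) ord {} P 0 1" unfolding free_quot_def
      using r by (intro exI[of _ "\<lambda>_ _. 1"])
        (auto simp: ccyc_def cbnd_def cob_def intro!: exI[of _ "\<lambda>_. z {}" for z])
    then show ?thesis using True by simp
  next
    case False
    then have "cfree TYPE('k) ord {} P i 0" unfolding cfree_0_iff by auto
    with False show ?thesis by simp
  qed
  then show ?case using r unfolding sub by (intro exI[of _ 1]) auto
next
  case (insert v A)
  have mat: "matroid_on (insert v A) P r" by fact
  have injA: "inj_on ord A" using insert.prems by (auto intro: inj_on_subset)
  have down: "P U" if "P T" "T \<subseteq> insert v A" "U \<subseteq> T" for T U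
    using mat[unfolded matroid_on_def, THEN conjunct1] that by simp
  have downv: "P T" if "T \<subseteq> A" "P (insert v T)" for T
    using down[of "insert v T" T] that by auto
  have fin: "finite T" if "T \<subseteq> A" for T using that insert.hyps finite_subset by blast
  have card: "card (insert v T) = Suc (card T)" if "T \<subseteq> A" for T
    using that insert.hyps fin[OF that] by (meson card_insert_disjoint subsetD)
  note split = sum_Pow_insert[OF insert.hyps, of "\<lambda>T. (-1) ^ (r + card T)" P]
  consider (loop) "\<not> P {v}" | (coloop) "P {v}" "\<forall>T\<subseteq>A. P T \<longrightarrow> P (insert v T)"
    | (neither) T0 where "P {v}" "T0 \<subseteq> A" "P T0" "\<not> P (insert v T0)" by blast
  then show ?case
  proof cases
    case loop
    have no: "\<not> P (insert v T)" if "T \<subseteq> A" for T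
      using loop down[of "insert v T" "{v}"] that by auto
    have "matroid_on A P r"
    proof -
      have "T \<subseteq> A" if "T \<subseteq> insert v A" "P T" for T
        using that no[of "T - {v}"] by (metis Diff_subset_conv insert_Diff insert_is_Un subset_insert)
      then show ?thesis using mat unfolding matroid_on_def
        by (smt (verit, best) subset_insertI2)
    qed
    from insert.IH[OF injA this] obtain N where N:
      "int N = (\<Sum>T | T \<subseteq> A \<and> P T. (-1) ^ (r + card T))"
      "\<And>i. cfree TYPE('k) ord A P i (if i + int r = int (card A) then N else 0)" by blast
    \<comment> \<open>For a loop the contraction has no faces at all, and the complex is the
      deletion shifted by one degree; the shift is matched by the growth of the vertex set.\<close>
    have "cfree TYPE('k) ord (insert v A) P i (0 + (if i - 1 + int r = int (card A) then N else 0))" for i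
      by (rule cfree_mapping_cone)
        (use insert.hyps insert.prems no N(2) in \<open>auto intro!: cfree_no_faces\<close>)
    moreover have none: "{T. T \<subseteq> A \<and> P (insert v T)} = {}" using no by auto
    ultimately show ?thesis unfolding split none using N(1) insert.hyps
      by (intro exI[of _ N]) (auto simp: algebra_simps)
  next
    case coloop
    have eq: "P (insert v T) \<longleftrightarrow> P T" if "T \<subseteq> A" for T
      using coloop that down[of "insert v T" T] by auto
    \<comment> \<open>Faces with and without the coloop pair off with opposite signs, in agreement
      with the cone being acyclic.\<close>
    have "(\<Sum>T | T \<subseteq> insert v A \<and> P T. (-1) ^ (r + card T)) = (0::int)"
    proof -
      have "{T. T \<subseteq> A \<and> P (insert v T)} = {T. T \<subseteq> A \<and> P T}" using eq by auto
      then show ?thesis unfolding split by (simp add: card sum_negf cong: sum.cong_simp)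
    qed
    moreover have "cfree TYPE('k) ord (insert v A) P i 0" for i
      by (rule cfree_cone) (use insert.hyps insert.prems eq in auto)
    ultimately show ?thesis by (intro exI[of _ 0]) auto
  next
    case neither
    have del: "matroid_on A P r"
    proof -
      \<comment> \<open>\<open>T0\<close> shows that \<open>v\<close> is no coloop: a maximal face
        over \<open>T0\<close> cannot contain \<open>v\<close>, so the deletion still has rank
        \<open>r\<close>.\<close>
      obtain U where U: "T0 \<subseteq> U" "U \<subseteq> insert v A" "P U" "card U = r"
        using matroid_on_extend[OF mat _ _ neither(3)] neither insert.hyps by auto
      have "v \<notin> U" using down[OF U(3,2), of "insert v T0"] neither U by auto
      then have "U \<subseteq> A" using U by auto
      then show ?thesis using mat U unfolding matroid_on_def
        by (smt (verit, best) subset_insertI2)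
    qed
    obtain B where B: "v \<in> B" "B \<subseteq> insert v A" "P B" "card B = r"
      using matroid_on_extend[OF mat _ _ neither(1)] insert.hyps by auto
    have BA: "B - {v} \<subseteq> A" "insert v (B - {v}) = B" using B by auto
    \<comment> \<open>\<open>v\<close> lies in a basis, so \<open>r\<close> is positive and the
      truncated subtraction in \<open>r - 1\<close> is exact.\<close>
    have r: "r = Suc (card (B - {v}))" using card[OF BA(1)] BA B by simp
    have contr: "matroid_on A (\<lambda>T. P (insert v T)) (r - 1)"
      unfolding matroid_on_def
    proof (intro conjI allI impI)
      fix T U assume "T \<subseteq> A" "P (insert v T)" "U \<subseteq> T"
      then show "P (insert v U)" using down[of "insert v T" "insert v U"] by auto
    next
      fix T U assume TU: "T \<subseteq> A" "U \<subseteq> A" "P (insert v T) \<and> P (insert v U) \<and> card T < card U"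
      then have "\<exists>x\<in>insert v U - insert v T. P (insert x (insert v T))"
        using mat card unfolding matroid_on_def by (metis Suc_mono insert_mono)
      then show "\<exists>x\<in>U - T. P (insert v (insert x T))" by (auto simp: insert_commute)
    next
      show "\<exists>T\<subseteq>A. P (insert v T) \<and> card T = r - 1" using BA B r by (intro exI[of _ "B - {v}"]) auto
    next
      fix T assume "T \<subseteq> A" "P (insert v T)"
      then have "card (insert v T) \<le> r" using mat insert_mono[of T A v] unfolding matroid_on_def by auto
      then show "card T \<le> r - 1" using card[OF \<open>T \<subseteq> A\<close>] by simp
    qed
    obtain N1 where N1: "int N1 = (\<Sum>T | T \<subseteq> A \<and> P (insert v T). (-1) ^ (r - 1 + card T))"
      "\<And>i. cfree TYPE('k) ord A (\<lambda>T. P (insert v T)) i (if i + int (r - 1) = int (card A) then N1 else 0)"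
      using insert.IH[OF injA contr] by blast
    obtain N2 where N2: "int N2 = (\<Sum>T | T \<subseteq> A \<and> P T. (-1) ^ (r + card T))"
      "\<And>i. cfree TYPE('k) ord A P i (if i + int r = int (card A) then N2 else 0)"
      using insert.IH[OF injA del] by blast
    have rr: "int (r - 1) = int r - 1" using r by simp
    \<comment> \<open>For \<open>i = card A + 1 - r\<close> the contraction has its cohomology in
      degree \<open>i\<close> and the deletion in degree \<open>i - 1\<close>, exactly the two
      places that enter the cone in degree \<open>i\<close>; conversely the deletion vanishes in
      degree \<open>i\<close> and the contraction in degree \<open>i - 1\<close>, as
      \<open>lift\<close> and \<open>inj\<close> require.\<close>
    have "cfree TYPE('k) ord (insert v A) P i
       (if i + int r = int (card A) + 1 then N1 + N2 else 0)" for i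
    proof (cases "i + int r = int (card A) + 1")
      case True
      have "cfree TYPE('k) ord (insert v A) P i (N1 + N2)"
        by (rule cfree_mapping_cone)
          (use insert.hyps insert.prems True N1(2)[of i] N1(2)[of "i-1"] N2(2)[of i] N2(2)[of "i-1"] rr downv
           in \<open>auto simp: algebra_simps\<close>)
      then show ?thesis using True by simp
    next
      case False
      have "cfree TYPE('k) ord (insert v A) P i (0 + 0)"
        by (rule cfree_mapping_cone)
          (use insert.hyps insert.prems False N1(2)[of i] N2(2)[of "i-1"] rr downv
           in \<open>auto simp: algebra_simps\<close>)
      then show ?thesis using False by simp
    qed
    moreover have "int (N1 + N2) = (\<Sum>T | T \<subseteq> insert v A \<and> P T. (-1) ^ (r + card T))"
    proof -
      \<comment> \<open>The rank and the size of the face both grow by one, so the sign is that of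
        the contraction.\<close>
      have "(\<Sum>T | T \<subseteq> A \<and> P (insert v T). (-1) ^ (r + card (insert v T))) = int N1"
        unfolding N1(1) using r by (intro sum.cong) (auto simp: card)
      then show ?thesis unfolding split by (simp add: N2(1))
    qed
    ultimately show ?thesis using insert.hyps by (intro exI[of _ "N1 + N2"]) (auto simp: algebra_simps)
  qed
qed

section \<open>Polynomials, homogeneous parts and monomial ideals\<close>

abbreviation "keys \<equiv> Poly_Mapping.keys"
abbreviation "lookup \<equiv> Poly_Mapping.lookup"

section \<open>Degrees and homogeneous components of polynomials\<close>

lemma keys_plus_nat:
  fixes a b :: "'v \<Rightarrow>\<^sub>0 nat"
  shows "keys (a + b) = keys a \<union> keys b"
  by (auto simp: in_keys_iff lookup_add)

lemma monom_deg_superset: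
  assumes "finite U" "keys e \<subseteq> U"
  shows "monom_deg e = 2 * (\<Sum>t\<in>U. lookup e t)"
  unfolding monom_deg_def using assms
  by (intro arg_cong[where f = "(*) 2"] sum.mono_neutral_left) (auto simp: in_keys_iff)

lemma monom_deg_add: "monom_deg (a + b) = monom_deg a + monom_deg b"
proof -
  let ?U = "keys a \<union> keys b"
  show ?thesis
    by (simp add: monom_deg_superset[of ?U] keys_plus_nat lookup_add sum.distrib)
qed

lemma monom_deg_0 [simp]: "monom_deg 0 = 0"
  by (simp add: monom_deg_def)

lemma polys_0 [simp]: "0 \<in> polys V"
  and polys_1 [simp]: "1 \<in> polys V"
  by (auto simp: polys_def)

lemma polys_add: "f \<in> polys V \<Longrightarrow> g \<in> polys V \<Longrightarrow> f + g \<in> polys V"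
  using keys_add[of f g] by (auto simp: polys_def)

lemma polys_uminus: "f \<in> polys V \<Longrightarrow> - f \<in> polys V"
  by (auto simp: polys_def in_keys_iff)

lemma polys_diff: "f \<in> polys V \<Longrightarrow> g \<in> polys V \<Longrightarrow> f - g \<in> polys V"
  using polys_add[of f V "- g"] polys_uminus[of g V] by simp

lemma polys_mult: "f \<in> polys V \<Longrightarrow> g \<in> polys V \<Longrightarrow> f * g \<in> polys V"
  using keys_mult[of f g] by (auto simp: polys_def keys_plus_nat dest!: subsetD)

lemma polys_sum: "(\<And>a. a \<in> I \<Longrightarrow> f a \<in> polys V) \<Longrightarrow> (\<Sum>a\<in>I. f a) \<in> polys V"
  by (induction I rule: infinite_finite_induct) (auto intro: polys_add)

lemma polys_const [simp]: "const_poly c \<in> polys V"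
  by (auto simp: polys_def const_poly_def)

lemma polys_var [simp]: "t \<in> V \<Longrightarrow> var_poly t \<in> polys V"
  by (auto simp: polys_def var_poly_def)

lemma homog_shift_0 [simp]: "homog_shift g d 0"
  by (simp add: homog_shift_def)

lemma homog_shift_add: "homog_shift g d x \<Longrightarrow> homog_shift g d y \<Longrightarrow> homog_shift g d (x + y)"
  using keys_add[of x y] by (auto simp: homog_shift_def)

lemma homog_shift_uminus: "homog_shift g d x \<Longrightarrow> homog_shift g d (- x)"
  by (auto simp: homog_shift_def in_keys_iff)

lemma homog_shift_diff: "homog_shift g d x \<Longrightarrow> homog_shift g d y \<Longrightarrow> homog_shift g d (x - y)"
  using homog_shift_add[of g d x "- y"] homog_shift_uminus[of g d y] by simp

lemma homog_shift_sum: "(\<And>a. a \<in> I \<Longrightarrow> homog_shift g d (f a)) \<Longrightarrow> homog_shift g d (\<Sum>a\<in>I. f a)"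
  by (induction I rule: infinite_finite_induct) (auto intro: homog_shift_add)

lemma homog_shift_mult:
  "homog_shift g d x \<Longrightarrow> homog_shift h g y \<Longrightarrow> homog_shift h d (x * y)"
  using keys_mult[of x y] by (fastforce simp: homog_shift_def monom_deg_add)

definition homog_part :: "nat \<Rightarrow> nat \<Rightarrow> ('v, 'k::comm_ring_1) mpol \<Rightarrow> ('v, 'k) mpol" where
  "homog_part g d f = Poly_Mapping.mapp (\<lambda>e c. c when monom_deg e + g = d) f"

lemma lookup_homog_part:
  "lookup (homog_part g d f) e = (lookup f e when monom_deg e + g = d)"
  by (auto simp: homog_part_def lookup_mapp when_def in_keys_iff)

lemma homog_shift_homog_part: "homog_shift g d (homog_part g d f)"
  by (auto simp: homog_shift_def in_keys_iff lookup_homog_part when_def split: if_splits)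

lemma homog_part_polys: "f \<in> polys V \<Longrightarrow> homog_part g d f \<in> polys V"
  by (auto simp: polys_def in_keys_iff lookup_homog_part)

lemma homog_part_id: "homog_shift g d f \<Longrightarrow> homog_part g d f = f"
  by (intro poly_mapping_eqI) (auto simp: homog_shift_def lookup_homog_part when_def in_keys_iff)

lemma homog_part_add: "homog_part g d (x + y) = homog_part g d x + homog_part g d y"
  by (intro poly_mapping_eqI) (auto simp: lookup_homog_part lookup_add when_add_distrib)

lemma homog_part_diff: "homog_part g d (x - y) = homog_part g d x - homog_part g d y"
  by (intro poly_mapping_eqI) (auto simp: lookup_homog_part lookup_minus when_diff_distrib)

lemma homog_part_0 [simp]: "homog_part g d 0 = 0"
  by (intro poly_mapping_eqI) (auto simp: lookup_homog_part)

lemma homog_part_sum: "homog_part g d (\<Sum>a\<in>I. f a) = (\<Sum>a\<in>I. homog_part g d (f a))"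
  by (induction I rule: infinite_finite_induct) (auto simp: homog_part_add)

text \<open>A homogeneous factor shifts all degrees alike, so the components of \<open>x\<close>
  outside degree \<open>d - g\<close> contribute nothing to the component of the product.\<close>

lemma homog_part_mult:
  assumes "homog_shift h g y"
  shows "homog_part h d (x * y) = homog_part g d x * y"
proof -
  define r where "r = x - homog_part g d x"
  have "homog_part h d (r * y) = 0"
  proof (intro poly_mapping_eqI)
    fix e
    have "lookup (r * y) e = 0" if deg: "monom_deg e + h = d"
    proof (rule ccontr)
      assume "lookup (r * y) e \<noteq> 0"
      then have "e \<in> keys (r * y)" by (simp add: in_keys_iff)
      then obtain a b where ab: "e = a + b" "a \<in> keys r" "b \<in> keys y"
        using keys_mult[of r y] by blast
      then have "monom_deg a + g = d"
        using assms deg by (auto simp: homog_shift_def monom_deg_add)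
      then have "lookup r a = 0"
        by (simp add: r_def lookup_minus lookup_homog_part)
      with ab show False by (simp add: in_keys_iff)
    qed
    then show "lookup (homog_part h d (r * y)) e = lookup 0 e"
      by (auto simp: lookup_homog_part when_def)
  qed
  moreover have "homog_part h d (homog_part g d x * y) = homog_part g d x * y"
    by (intro homog_part_id homog_shift_mult[OF homog_shift_homog_part assms])
  moreover have "x * y = r * y + homog_part g d x * y"
    by (simp add: r_def algebra_simps)
  ultimately show ?thesis by (metis homog_part_add add_0)
qed

section \<open>Ideals, their normal forms and membership tests\<close>

definition poly_ideal :: "'v set \<Rightarrow> ('v, 'k::comm_ring_1) mpol set \<Rightarrow> bool" where
  "poly_ideal V I \<longleftrightarrow> I \<subseteq> polys V \<and> 0 \<in> I \<and> (\<forall>f\<in>I. \<forall>g\<in>I. f + g \<in> I) \<and>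
     (\<forall>f\<in>polys V. \<forall>g\<in>I. f * g \<in> I)"

lemma poly_ideal_sub: "poly_ideal V I \<Longrightarrow> f \<in> I \<Longrightarrow> f \<in> polys V"
  and poly_ideal_0: "poly_ideal V I \<Longrightarrow> 0 \<in> I"
  and poly_ideal_add: "poly_ideal V I \<Longrightarrow> f \<in> I \<Longrightarrow> g \<in> I \<Longrightarrow> f + g \<in> I"
  and poly_ideal_mult: "poly_ideal V I \<Longrightarrow> h \<in> polys V \<Longrightarrow> g \<in> I \<Longrightarrow> h * g \<in> I"
  by (auto simp: poly_ideal_def)

lemma poly_ideal_uminus:
  assumes "poly_ideal V I" "f \<in> I"
  shows "- f \<in> I"
  using poly_ideal_mult[OF assms(1) polys_uminus[OF polys_1] assms(2)] by simp

lemma poly_ideal_diff: "poly_ideal V I \<Longrightarrow> f \<in> I \<Longrightarrow> g \<in> I \<Longrightarrow> f - g \<in> I"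
  using poly_ideal_add[of V I f "- g"] poly_ideal_uminus[of V I g] by simp

lemma poly_ideal_mult_right: "poly_ideal V I \<Longrightarrow> g \<in> I \<Longrightarrow> h \<in> polys V \<Longrightarrow> g * h \<in> I"
  by (metis mult.commute poly_ideal_mult)

lemma poly_ideal_sum: "poly_ideal V I \<Longrightarrow> (\<And>a. a \<in> A \<Longrightarrow> f a \<in> I) \<Longrightarrow> (\<Sum>a\<in>A. f a) \<in> I"
  by (induction A rule: infinite_finite_induct) (auto intro: poly_ideal_add poly_ideal_0)

lemma poly_ideal_ideal_of:
  fixes G :: "('v, 'k::comm_ring_1) mpol set"
  assumes "G \<subseteq> polys V"
  shows "poly_ideal V (ideal_of V G)"
  unfolding poly_ideal_def
proof (intro conjI ballI)
  show "ideal_of V G \<subseteq> polys V"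
    unfolding ideal_of_def using assms by (auto intro!: polys_sum polys_mult)
  show "0 \<in> ideal_of V G"
    unfolding ideal_of_def by (rule CollectI, intro exI[of _ "{}"] exI) auto
next
  fix f g :: "('v, 'k) mpol" assume "f \<in> ideal_of V G" "g \<in> ideal_of V G"
  then obtain A B c d where f: "f = (\<Sum>x\<in>A. c x * x)" "finite A" "A \<subseteq> G" "\<forall>x\<in>A. c x \<in> polys V"
    and g: "g = (\<Sum>x\<in>B. d x * x)" "finite B" "B \<subseteq> G" "\<forall>x\<in>B. d x \<in> polys V"
    unfolding ideal_of_def by blast
  define e where "e x = (if x \<in> A then c x else 0) + (if x \<in> B then d x else 0)" for x
  have "f = (\<Sum>x\<in>A \<union> B. (if x \<in> A then c x else 0) * x)"
    unfolding f using f(2) g(2) by (intro sum.mono_neutral_cong_left) auto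
  moreover have "g = (\<Sum>x\<in>A \<union> B. (if x \<in> B then d x else 0) * x)"
    unfolding g using f(2) g(2) by (intro sum.mono_neutral_cong_left) auto
  ultimately have "f + g = (\<Sum>x\<in>A \<union> B. e x * x)"
    by (simp add: e_def distrib_right sum.distrib)
  moreover have "\<forall>x\<in>A \<union> B. e x \<in> polys V" using f g by (auto simp: e_def intro: polys_add)
  ultimately show "f + g \<in> ideal_of V G"
    unfolding ideal_of_def using f(2,3) g(2,3)
    by (intro CollectI exI[of _ "A \<union> B"] exI[of _ e]) auto
next
  fix h f :: "('v, 'k) mpol" assume h: "h \<in> polys V" and "f \<in> ideal_of V G"
  then obtain A c where f: "f = (\<Sum>x\<in>A. c x * x)" "finite A" "A \<subseteq> G" "\<forall>x\<in>A. c x \<in> polys V"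
    unfolding ideal_of_def by blast
  then have "h * f = (\<Sum>x\<in>A. (h * c x) * x)" by (simp add: sum_distrib_left mult.assoc)
  then show "h * f \<in> ideal_of V G" unfolding ideal_of_def using f h
    by (intro CollectI exI[of _ A] exI[of _ "\<lambda>x. h * c x"]) (auto intro: polys_mult)
qed

lemma ideal_of_generator:
  assumes "g \<in> G" "c \<in> polys V"
  shows "c * g \<in> ideal_of V G"
  unfolding ideal_of_def using assms by (intro CollectI exI[of _ "{g}"] exI[of _ "\<lambda>_. c"]) auto

lemma var_poly_inject [simp]:
  "(var_poly s :: ('v, 'k::comm_ring_1) mpol) = var_poly t \<longleftrightarrow> s = t"
proof
  assume eq: "(var_poly s :: ('v, 'k) mpol) = var_poly t"
  have "keys (var_poly s :: ('v, 'k) mpol) = {Poly_Mapping.single s 1}"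
    "keys (var_poly t :: ('v, 'k) mpol) = {Poly_Mapping.single t 1}"
    by (simp_all add: var_poly_def)
  then have "Poly_Mapping.single s (1::nat) = Poly_Mapping.single t 1"
    using eq by simp
  then show "s = t" by (simp add: poly_mapping_eq_iff fun_eq_iff lookup_single when_def split: if_splits)
qed simp

text \<open>A normal form with one coefficient per variable: this family of coefficients is
  precisely an element of the first Koszul module. Distinct variables give distinct generators, so
  generators can be indexed by \<open>V\<close>.\<close>

lemma aug_ideal_iff:
  assumes "finite V"
  shows "f \<in> aug_ideal V \<longleftrightarrow> (\<exists>c. (\<forall>v\<in>V. c v \<in> polys V) \<and> f = (\<Sum>v\<in>V. c v * var_poly v))"
proof
  assume "f \<in> aug_ideal V"
  then obtain A c where A: "f = (\<Sum>g\<in>A. c g * g)" "finite A" "A \<subseteq> var_poly ` V" "\<forall>g\<in>A. c g \<in> polys V"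
    unfolding aug_ideal_def ideal_of_def by blast
  define c' where "c' v = (if var_poly v \<in> A then c (var_poly v) else 0)" for v
  have "f = (\<Sum>v\<in>{v\<in>V. var_poly v \<in> A}. c (var_poly v) * var_poly v)"
  proof -
    have "A = var_poly ` {v\<in>V. var_poly v \<in> A}" using A(3) by auto
    then have "f = (\<Sum>g\<in>var_poly ` {v\<in>V. var_poly v \<in> A}. c g * g)" using A(1) by simp
    then show ?thesis by (simp add: sum.reindex inj_on_def)
  qed
  also have "\<dots> = (\<Sum>v\<in>V. c' v * var_poly v)"
    using assms by (intro sum.mono_neutral_cong_left) (auto simp: c'_def)
  finally show "\<exists>c. (\<forall>v\<in>V. c v \<in> polys V) \<and> f = (\<Sum>v\<in>V. c v * var_poly v)"
    using A(4) by (intro exI[of _ c']) (auto simp: c'_def)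
next
  have "poly_ideal V (aug_ideal V)" unfolding aug_ideal_def by (rule poly_ideal_ideal_of) auto
  then show "f \<in> aug_ideal V" if "\<exists>c. (\<forall>v\<in>V. c v \<in> polys V) \<and> f = (\<Sum>v\<in>V. c v * var_poly v)"
    using that unfolding aug_ideal_def by (auto intro!: poly_ideal_sum ideal_of_generator)
qed

lemma poly_ideal_aug: "poly_ideal V (aug_ideal V)"
  unfolding aug_ideal_def by (rule poly_ideal_ideal_of) auto

lemma homog_shift_var: "d = g + 2 \<Longrightarrow> homog_shift g d (var_poly t :: ('v, 'k::comm_ring_1) mpol)"
  by (auto simp: homog_shift_def var_poly_def monom_deg_def)

lemma homog_part_aug_ideal:
  assumes "finite V" "f \<in> aug_ideal V"
  shows "homog_part 0 d f \<in> aug_ideal V"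
proof -
  obtain c where c: "\<forall>v\<in>V. c v \<in> polys V" "f = (\<Sum>v\<in>V. c v * var_poly v)"
    using assms by (auto simp: aug_ideal_iff)
  have "homog_part 0 d f = (\<Sum>v\<in>V. homog_part 2 d (c v) * var_poly v)"
    unfolding c(2) homog_part_sum 
    by (intro sum.cong refl homog_part_mult homog_shift_var) simp
  then show ?thesis using c(1) assms(1) unfolding aug_ideal_iff[OF assms(1)]
    by (intro exI[of _ "\<lambda>v. homog_part 2 d (c v)"]) (auto intro: homog_part_polys)
qed

lemma prod_single_1:
  "(\<Prod>t\<in>A. Poly_Mapping.single (f t) (1::'k::comm_ring_1)) = Poly_Mapping.single (\<Sum>t\<in>A. f t) 1"
  by (induction A rule: infinite_finite_induct) (auto simp: mult_single)

definition ind_mon :: "'v set \<Rightarrow> 'v \<Rightarrow>\<^sub>0 nat" where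
  "ind_mon S = (\<Sum>t\<in>S. Poly_Mapping.single t 1)"

lemma lookup_ind_mon: "finite S \<Longrightarrow> lookup (ind_mon S) t = (if t \<in> S then 1 else 0)"
  by (simp add: ind_mon_def lookup_sum lookup_single when_def)

lemma keys_ind_mon: "finite S \<Longrightarrow> keys (ind_mon S) = S"
  by (auto simp: in_keys_iff lookup_ind_mon split: if_splits)

lemma monom_deg_ind_mon: "finite S \<Longrightarrow> monom_deg (ind_mon S) = 2 * card S"
  by (simp add: monom_deg_def keys_ind_mon lookup_ind_mon)

lemma prod_var_poly: "(\<Prod>t\<in>S. var_poly t) = Poly_Mapping.single (ind_mon S) 1"
  by (simp add: var_poly_def prod_single_1 ind_mon_def)

lemma poly_mapping_sum_single:
  "f = (\<Sum>e\<in>keys f. Poly_Mapping.single e (lookup f e))"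
  by (intro poly_mapping_eqI) (auto simp: lookup_sum lookup_single when_def in_keys_iff)

lemma sr_ideal_gens: "{\<Prod>t\<in>\<sigma>. var_poly t | \<sigma>. \<sigma> \<subseteq> V \<and> \<sigma> \<notin> K} \<subseteq> polys V"
proof -
  have "(\<Prod>t\<in>\<sigma>. var_poly t) \<in> polys V" if "\<sigma> \<subseteq> V" for \<sigma>
    using that by (induction \<sigma> rule: infinite_finite_induct) (auto intro: polys_mult)
  then show ?thesis by auto
qed

lemma poly_ideal_sr: "poly_ideal V (sr_ideal V K)"
  unfolding sr_ideal_def by (rule poly_ideal_ideal_of) (rule sr_ideal_gens)

text \<open>A monomial in the ideal is divisible by a non-face, so its support is a non-face because
  faces are closed under subsets; conversely the support itself supplies the generator. Membership
  is thereby tested one exponent at a time, which is what lets the tensored complex split by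
  multidegrees.\<close>

lemma sr_ideal_iff:
  fixes f :: "('v, 'k::comm_ring_1) mpol"
  assumes V: "finite V" and down: "\<And>S T. S \<in> K \<Longrightarrow> T \<subseteq> S \<Longrightarrow> T \<in> K"
  shows "f \<in> sr_ideal V K \<longleftrightarrow>
    (\<forall>e\<in>keys f. keys e \<subseteq> V \<and> keys e \<notin> K)"
proof
  assume f: "f \<in> sr_ideal V K"
  then have "f \<in> polys V" using poly_ideal_sub[OF poly_ideal_sr] by blast
  moreover have "keys e \<notin> K" if e: "e \<in> keys f" for e
  proof -
    obtain A c where A: "f = (\<Sum>g\<in>A. c g * g)" "A \<subseteq> {\<Prod>t\<in>\<sigma>. var_poly t | \<sigma>. \<sigma> \<subseteq> V \<and> \<sigma> \<notin> K}"
      using f unfolding sr_ideal_def ideal_of_def by blast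
    have "\<exists>g\<in>A. e \<in> keys (c g * g)"
    proof (rule ccontr)
      assume "\<not> ?thesis"
      then have "lookup f e = 0"
        unfolding A(1) lookup_sum by (intro sum.neutral) (auto simp: in_keys_iff)
      with e show False by (simp add: in_keys_iff)
    qed
    then obtain g where "g \<in> A" and eg: "e \<in> keys (c g * g)" by blast
    then obtain \<sigma> where g: "g = Poly_Mapping.single (ind_mon \<sigma>) 1" and \<sigma>: "\<sigma> \<subseteq> V" "\<sigma> \<notin> K"
      using A(2) by (auto simp: prod_var_poly)
    then obtain a where "e = a + ind_mon \<sigma>"
      using keys_mult[of "c g" g] eg by auto
    then have "\<sigma> \<subseteq> keys e"
      using \<sigma> V finite_subset[of \<sigma> V] by (auto simp: keys_plus_nat keys_ind_mon)
    then show ?thesis using down \<sigma> by blast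
  qed
  ultimately show "\<forall>e\<in>keys f. keys e \<subseteq> V \<and> keys e \<notin> K"
    by (auto simp: polys_def)
next
  assume f: "\<forall>e\<in>keys f. keys e \<subseteq> V \<and> keys e \<notin> K"
  have "Poly_Mapping.single e (lookup f e) \<in> sr_ideal V K" if e: "e \<in> keys f" for e
  proof -
    let ?S = "keys e"
    let ?c = "Poly_Mapping.single (e - ind_mon ?S) (lookup f e)"
    have "e - ind_mon ?S + ind_mon ?S = e"
      by (intro poly_mapping_eqI) (auto simp: lookup_add lookup_minus lookup_ind_mon in_keys_iff)
    then have "Poly_Mapping.single e (lookup f e) = ?c * (\<Prod>t\<in>?S. var_poly t)"
      by (simp add: prod_var_poly mult_single)
    moreover have "?c \<in> polys V"
    proof -
      have "keys (e - ind_mon ?S) \<subseteq> ?S"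
        by (auto simp: in_keys_iff lookup_minus)
      then show ?thesis using f e by (auto simp: polys_def)
    qed
    moreover have "?c * (\<Prod>t\<in>?S. var_poly t) \<in> sr_ideal V K"
      unfolding sr_ideal_def using f e calculation(2) by (intro ideal_of_generator) auto
    ultimately show ?thesis by simp
  qed
  then show "f \<in> sr_ideal V K"
    by (subst poly_mapping_sum_single) (rule poly_ideal_sum[OF poly_ideal_sr])
qed

section \<open>Independence of the resolution\<close>

text \<open>Maps of free modules are stored as the images of basis vectors. Differentials, lifts,
  homotopies and the augmentation all take this form, so their compositions reduce to
  \<open>lin_map_comp\<close>.\<close>

definition lin_map :: "nat \<Rightarrow> (nat \<Rightarrow> nat \<Rightarrow> 'r::comm_ring_1) \<Rightarrow> (nat \<Rightarrow> 'r) \<Rightarrow> nat \<Rightarrow> 'r" where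
  "lin_map r M x = (\<lambda>a. \<Sum>c<r. x c * M c a)"

definition unit_vec :: "nat \<Rightarrow> nat \<Rightarrow> 'r::comm_ring_1" where
  "unit_vec c = (\<lambda>a. if a = c then 1 else 0)"

lemma lin_map_add: "lin_map r M (x + y) = lin_map r M x + lin_map r M y"
  by (auto simp: lin_map_def distrib_right sum.distrib)

lemma lin_map_diff: "lin_map r M (x - y) = lin_map r M x - lin_map r M y"
  by (auto simp: lin_map_def left_diff_distrib sum_subtractf)

lemma lin_map_0 [simp]: "lin_map r M 0 = 0"
  by (auto simp: lin_map_def)

lemma lin_map_scale: "lin_map r M (\<lambda>a. k * x a) = (\<lambda>a. k * lin_map r M x a)"
  by (auto simp: lin_map_def sum_distrib_left mult.assoc)

lemma lin_map_sum: "lin_map r M (\<Sum>a\<in>I. f a) = (\<Sum>a\<in>I. lin_map r M (f a))"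
proof
  fix a
  show "lin_map r M (\<Sum>a\<in>I. f a) a = (\<Sum>a\<in>I. lin_map r M (f a)) a"
    by (simp add: lin_map_def sum_fun_apply sum_distrib_right sum.swap[of _ I])
qed

lemma lin_map_diff_columns:
  "lin_map r (\<lambda>c. M c - N c) x = lin_map r M x - lin_map r N x"
  by (auto simp: lin_map_def right_diff_distrib sum_subtractf)

lemma lin_map_add_columns:
  "lin_map r (\<lambda>c. M c + N c) x = lin_map r M x + lin_map r N x"
  by (auto simp: lin_map_def distrib_left sum.distrib)

lemma lin_map_comp: "lin_map r M (lin_map s N x) = lin_map s (\<lambda>c. lin_map r M (N c)) x"
proof
  fix a
  have "(\<Sum>c<r. (\<Sum>b<s. x b * N b c) * M c a) = (\<Sum>c<r. \<Sum>b<s. x b * (N b c * M c a))"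
    by (simp add: sum_distrib_right mult.assoc)
  also have "\<dots> = (\<Sum>b<s. x b * (\<Sum>c<r. N b c * M c a))"
    by (subst sum.swap) (simp add: sum_distrib_left)
  finally show "lin_map r M (lin_map s N x) a = lin_map s (\<lambda>c. lin_map r M (N c)) x a"
    by (simp add: lin_map_def)
qed

lemma lin_map_cong: "(\<And>c. c < r \<Longrightarrow> M c = N c) \<Longrightarrow> lin_map r M x = lin_map r N x"
  by (auto simp: lin_map_def)

lemma lin_map_unit_vec: "c < r \<Longrightarrow> lin_map r M (unit_vec c) = M c"
  by (auto simp: lin_map_def unit_vec_def if_distrib[of "\<lambda>x. x * _"] cong: if_cong)

lemma lin_map_unit_columns: "(\<And>a. a \<ge> r \<Longrightarrow> x a = 0) \<Longrightarrow> lin_map r unit_vec x = x"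
  by (auto simp: lin_map_def unit_vec_def fun_eq_iff if_distrib[of "\<lambda>x. _ * x"] not_less cong: if_cong)

section \<open>Graded strands of a resolution\<close>

definition res_col :: "('v, 'k::comm_ring_1) mpol resolution \<Rightarrow> nat \<Rightarrow> nat \<Rightarrow> nat \<Rightarrow> ('v, 'k) mpol" where
  "res_col F i c = (\<lambda>a. if a < res_rank F i then res_mat F i a c else 0)"

lemma res_diff_lin_map: "res_diff F i = lin_map (res_rank F (Suc i)) (res_col F i)"
  by (auto simp: res_diff_def lin_map_def res_col_def fun_eq_iff)

lemma res_eps_lin_map: "res_eps F x = lin_map (res_rank F 0) (\<lambda>c _. res_aug F c) x 0"
  by (simp add: res_eps_def lin_map_def)

lemma res_eps_diff: "res_eps F (x - y) = res_eps F x - res_eps F y"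
  by (simp add: res_eps_def left_diff_distrib sum_subtractf)

lemma res_eps_unit_vec: "c < res_rank F 0 \<Longrightarrow> res_eps F (unit_vec c) = res_aug F c"
  by (simp add: res_eps_lin_map lin_map_unit_vec)

lemma res_eps_lin_map_comp: "res_eps F (lin_map r M x) = (\<Sum>c<r. x c * res_eps F (M c))"
  by (simp add: res_eps_lin_map lin_map_comp) (simp add: lin_map_def)

lemma res_strand_iff: "x \<in> res_strand V F i d \<longleftrightarrow>
    (\<forall>a<res_rank F i. x a \<in> polys V \<and> homog_shift (res_deg F i a) d (x a)) \<and> (\<forall>a\<ge>res_rank F i. x a = 0)"
  by (auto simp: res_strand_def res_module_def)

lemma res_strand_module: "x \<in> res_strand V F i d \<Longrightarrow> x \<in> res_module V F i"
  by (simp add: res_strand_def)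

lemma res_strand_0 [simp]: "0 \<in> res_strand V F i d"
  by (auto simp: res_strand_iff)

lemma res_strand_add: "x \<in> res_strand V F i d \<Longrightarrow> y \<in> res_strand V F i d \<Longrightarrow> x + y \<in> res_strand V F i d"
  by (auto simp: res_strand_iff intro: polys_add homog_shift_add)

lemma res_strand_diff: "x \<in> res_strand V F i d \<Longrightarrow> y \<in> res_strand V F i d \<Longrightarrow> x - y \<in> res_strand V F i d"
  by (auto simp: res_strand_iff intro: polys_diff homog_shift_diff)

lemma homog_shift_const: "homog_shift d d (const_poly c)"
  by (auto simp: homog_shift_def const_poly_def)

lemma res_strand_scale:
  "x \<in> res_strand V F i d \<Longrightarrow> (\<lambda>a. const_poly c * x a) \<in> res_strand V F i d"
  by (auto simp: res_strand_iff intro: polys_mult homog_shift_mult[OF homog_shift_const])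

lemma homog_shift_1: "homog_shift d d 1"
  by (auto simp: homog_shift_def)

lemma res_strand_unit_vec:
  "c < res_rank F i \<Longrightarrow> unit_vec c \<in> res_strand V F i (res_deg F i c)"
  by (auto simp: res_strand_iff unit_vec_def homog_shift_1)

lemma lin_map_strand:
  assumes "x \<in> res_strand V G i d"
    and "\<And>c. c < res_rank G i \<Longrightarrow> M c \<in> res_strand V F j (res_deg G i c)"
  shows "lin_map (res_rank G i) M x \<in> res_strand V F j d"
  using assms unfolding res_strand_iff lin_map_def
  by (auto intro!: polys_sum polys_mult homog_shift_sum homog_shift_mult sum.neutral)

lemma lin_map_module:
  assumes "x \<in> res_module V G i"
    and "\<And>c. c < res_rank G i \<Longrightarrow> M c \<in> res_module V F j"
  shows "lin_map (res_rank G i) M x \<in> res_module V F j"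
  using assms unfolding res_module_def lin_map_def
  by (auto intro!: polys_sum polys_mult sum.neutral)

text \<open>The definition of a resolution asserts exactness without reference to degrees.
  Homogeneity of \<open>J\<close> allows every solution of a lifting problem to be replaced by its
  component of the right degree.\<close>

locale graded_resolution =
  fixes V :: "'v set" and J :: "('v, 'k::comm_ring_1) mpol set" and F :: "('v, 'k) mpol resolution"
  assumes resolution: "graded_free_resolution V J F"
    and ideal: "poly_ideal V J"
    and homog: "f \<in> J \<Longrightarrow> homog_part 0 d f \<in> J"
begin

lemmas resolution_unfolded = resolution[unfolded graded_free_resolution_def]
lemmas aug_props = resolution_unfolded[THEN conjunct1, rule_format]
lemmas mat_props = resolution_unfolded[THEN conjunct2, THEN conjunct1, rule_format]
lemmas eps_surj = resolution_unfolded[THEN conjunct2, THEN conjunct2, THEN conjunct1, rule_format]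
lemmas exact_0 =
  resolution_unfolded[THEN conjunct2, THEN conjunct2, THEN conjunct2, THEN conjunct1, rule_format]
lemmas exact_Suc =
  resolution_unfolded[THEN conjunct2, THEN conjunct2, THEN conjunct2, THEN conjunct2, rule_format]

lemma col_strand: "c < res_rank F (Suc i) \<Longrightarrow> res_col F i c \<in> res_strand V F i (res_deg F (Suc i) c)"
  using mat_props by (auto simp: res_strand_iff res_col_def)

lemma diff_strand: "x \<in> res_strand V F (Suc i) d \<Longrightarrow> res_diff F i x \<in> res_strand V F i d"
  unfolding res_diff_lin_map by (rule lin_map_strand) (auto intro: col_strand)

lemma diff_module: "x \<in> res_module V F (Suc i) \<Longrightarrow> res_diff F i x \<in> res_module V F i"
  unfolding res_diff_lin_map by (rule lin_map_module) (auto intro: res_strand_module[OF col_strand])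

lemma diff_diff: "x \<in> res_module V F (Suc (Suc i)) \<Longrightarrow> res_diff F i (res_diff F (Suc i) x) = 0"
  using exact_Suc[OF diff_module[of x "Suc i"]] by blast

lemma eps_diff: "x \<in> res_module V F 1 \<Longrightarrow> res_eps F (res_diff F 0 x) \<in> J"
  using exact_0[OF diff_module[of x 0]] by auto

definition strand_part :: "nat \<Rightarrow> nat \<Rightarrow> (nat \<Rightarrow> ('v, 'k) mpol) \<Rightarrow> nat \<Rightarrow> ('v, 'k) mpol" where
  "strand_part i d x = (\<lambda>a. homog_part (res_deg F i a) d (x a))"

lemma strand_part_strand: "x \<in> res_module V F i \<Longrightarrow> strand_part i d x \<in> res_strand V F i d"
  by (auto simp: res_strand_iff res_module_def strand_part_def homog_part_polys homog_shift_homog_part)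

lemma strand_part_id: "x \<in> res_strand V F i d \<Longrightarrow> strand_part i d x = x"
  unfolding res_strand_iff strand_part_def
proof
  fix a
  assume x: "(\<forall>a<res_rank F i. x a \<in> polys V \<and> homog_shift (res_deg F i a) d (x a)) \<and> (\<forall>a\<ge>res_rank F i. x a = 0)"
  show "homog_part (res_deg F i a) d (x a) = x a"
    using x by (cases "a < res_rank F i") (auto simp: homog_part_id)
qed

lemma diff_strand_part: "res_diff F i (strand_part (Suc i) d x) = strand_part i d (res_diff F i x)"
proof
  fix a
  show "res_diff F i (strand_part (Suc i) d x) a = strand_part i d (res_diff F i x) a"
    using mat_props[of a i] unfolding res_diff_def strand_part_def
    by (auto simp: homog_part_sum intro!: sum.cong homog_part_mult[symmetric])
qed

lemma eps_strand_part: "res_eps F (strand_part 0 d x) = homog_part 0 d (res_eps F x)"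
  using aug_props unfolding res_eps_def strand_part_def homog_part_sum
  by (auto intro!: sum.cong homog_part_mult[symmetric])

lemma eps_surj_strand:
  assumes "f \<in> polys V" "homog_shift 0 d f"
  shows "\<exists>x\<in>res_strand V F 0 d. f - res_eps F x \<in> J"
proof -
  obtain x where x: "x \<in> res_module V F 0" "f - res_eps F x \<in> J"
    using eps_surj assms by blast
  have "f - res_eps F (strand_part 0 d x) = homog_part 0 d (f - res_eps F x)"
    using homog_part_id[OF assms(2)] by (simp add: homog_part_diff eps_strand_part)
  then show ?thesis using homog[OF x(2), of d] strand_part_strand[OF x(1), of d] by metis
qed

text \<open>In degree 0 the kernel is that of the augmentation modulo \<open>J\<close>. Merging both
  cases lets inductions over the resolution treat all degrees alike.\<close>

definition aug_cycle :: "nat \<Rightarrow> (nat \<Rightarrow> ('v, 'k) mpol) \<Rightarrow> bool" where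
  "aug_cycle i x \<longleftrightarrow> (case i of 0 \<Rightarrow> res_eps F x \<in> J | Suc h \<Rightarrow> res_diff F h x = 0)"

text \<open>Taking components commutes with the differential and fixes \<open>x\<close>, so the
  component of any preimage is again a preimage.\<close>

lemma strand_exact:
  assumes "x \<in> res_strand V F i d" "aug_cycle i x"
  shows "\<exists>y\<in>res_strand V F (Suc i) d. x = res_diff F i y"
proof -
  have "x \<in> res_module V F i" using assms res_strand_module by blast
  then obtain y where y: "y \<in> res_module V F (Suc i)" "x = res_diff F i y"
    using assms(2) exact_0 exact_Suc unfolding aug_cycle_def by (cases i) auto
  have "x = res_diff F i (strand_part (Suc i) d y)"
    using strand_part_id[OF assms(1)] y(2) by (simp add: diff_strand_part)
  then show ?thesis using strand_part_strand[OF y(1)] by blast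
qed

lemma col_eq_diff: "c < res_rank F (Suc i) \<Longrightarrow> res_col F i c = res_diff F i (unit_vec c)"
  by (simp add: res_diff_lin_map lin_map_unit_vec)

lemma diff_col: "c < res_rank F (Suc (Suc i)) \<Longrightarrow> res_diff F i (res_col F (Suc i) c) = 0"
  by (simp add: col_eq_diff diff_diff res_strand_module[OF res_strand_unit_vec])

lemma eps_col: "c < res_rank F (Suc 0) \<Longrightarrow> res_eps F (res_col F 0 c) \<in> J"
  using eps_diff[OF res_strand_module[OF res_strand_unit_vec[of c F 1 V]]] by (simp add: col_eq_diff)

end

text \<open>A lift of the identity of \<open>S / J\<close> to a degree-preserving chain map \<open>G \<rightarrow> F\<close>; \<open>\<Phi> i c\<close> is the
  image of the basis vector \<open>c\<close> in degree \<open>i\<close>.\<close>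

definition chain_lift ::
    "'v set \<Rightarrow> ('v, 'k::comm_ring_1) mpol set \<Rightarrow> ('v, 'k) mpol resolution \<Rightarrow> ('v, 'k) mpol resolution \<Rightarrow>
      (nat \<Rightarrow> nat \<Rightarrow> nat \<Rightarrow> ('v, 'k) mpol) \<Rightarrow> bool" where
  "chain_lift V J G F \<Phi> \<longleftrightarrow>
     (\<forall>i. \<forall>c<res_rank G i. \<Phi> i c \<in> res_strand V F i (res_deg G i c)) \<and>
     (\<forall>c<res_rank G 0. res_aug G c - res_eps F (\<Phi> 0 c) \<in> J) \<and>
     (\<forall>i. \<forall>c<res_rank G (Suc i). res_diff F i (\<Phi> (Suc i) c) = lin_map (res_rank G i) (\<Phi> i) (res_col G i c))"

lemma chain_lift_diff:
  assumes "chain_lift V J G F \<Phi>"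
  shows "res_diff F i (lin_map (res_rank G (Suc i)) (\<Phi> (Suc i)) x) =
     lin_map (res_rank G i) (\<Phi> i) (res_diff G i x)"
  unfolding res_diff_lin_map lin_map_comp
  using assms unfolding chain_lift_def res_diff_lin_map by (intro lin_map_cong) auto

lemma eps_lin_map_cong:
  fixes F G :: "('v, 'k::comm_ring_1) mpol resolution"
  assumes "poly_ideal V J" "x \<in> res_strand V G 0 d"
    and "\<And>b. b < res_rank G 0 \<Longrightarrow> res_aug G b - res_eps F (\<phi> b) \<in> J"
  shows "res_eps G x - res_eps F (lin_map (res_rank G 0) \<phi> x) \<in> J"
proof -
  have "(\<Sum>b<res_rank G 0. x b * (res_aug G b - res_eps F (\<phi> b))) \<in> J"
    using assms by (intro poly_ideal_sum[OF assms(1)] poly_ideal_mult[OF assms(1)]) (auto simp: res_strand_iff)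
  also have "(\<Sum>b<res_rank G 0. x b * (res_aug G b - res_eps F (\<phi> b))) =
      res_eps G x - res_eps F (lin_map (res_rank G 0) \<phi> x)"
    by (simp add: res_eps_lin_map_comp right_diff_distrib sum_subtractf) (simp add: res_eps_def)
  finally show ?thesis .
qed

text \<open>The comparison theorem of homological algebra, with degrees: a map out of a free module
  is lifted basis vector by basis vector along an exact complex.\<close>

lemma chain_lift_exists:
  fixes F G :: "('v, 'k::comm_ring_1) mpol resolution"
  assumes "graded_resolution V J F" "graded_resolution V J G"
  shows "\<exists>\<Phi>. chain_lift V J G F \<Phi>"
proof -
  interpret F: graded_resolution V J F by fact
  interpret G: graded_resolution V J G by fact
  \<comment> \<open>The invariant contains the solvability of the next step: the columns of
    \<open>G\<close>, carried over by \<open>\<phi>\<close>, are cycles of \<open>F\<close>. The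
    chain map equation relates two consecutive stages and is kept apart in \<open>Q\<close>, as
    dependent choice demands.\<close>
  define P where "P i \<phi> \<longleftrightarrow> (\<forall>c<res_rank G i. \<phi> c \<in> res_strand V F i (res_deg G i c)) \<and>
     (i = 0 \<longrightarrow> (\<forall>c<res_rank G 0. res_aug G c - res_eps F (\<phi> c) \<in> J)) \<and>
     (\<forall>c<res_rank G (Suc i). F.aug_cycle i (lin_map (res_rank G i) \<phi> (res_col G i c)))" for i \<phi>
  define Q where "Q i \<phi> \<psi> \<longleftrightarrow>
     (\<forall>c<res_rank G (Suc i). res_diff F i (\<psi> c) = lin_map (res_rank G i) \<phi> (res_col G i c))"
    for i and \<phi> \<psi> :: "nat \<Rightarrow> nat \<Rightarrow> ('v, 'k) mpol"
  have "\<exists>\<phi>. P 0 \<phi>"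
  proof -
    have "\<forall>c. \<exists>x. c < res_rank G 0 \<longrightarrow> x \<in> res_strand V F 0 (res_deg G 0 c) \<and> res_aug G c - res_eps F x \<in> J"
      using F.eps_surj_strand G.aug_props by blast
    then obtain \<phi> where \<phi>: "\<And>c. c < res_rank G 0 \<Longrightarrow>
        \<phi> c \<in> res_strand V F 0 (res_deg G 0 c) \<and> res_aug G c - res_eps F (\<phi> c) \<in> J" by metis
    have "res_eps F (lin_map (res_rank G 0) \<phi> (res_col G 0 c)) \<in> J" if c: "c < res_rank G (Suc 0)" for c
      using poly_ideal_diff[OF F.ideal G.eps_col[OF c] eps_lin_map_cong[OF F.ideal G.col_strand[OF c]]] \<phi> by force
    then show ?thesis using \<phi> by (intro exI[of _ \<phi>]) (auto simp: P_def F.aug_cycle_def)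
  qed
  moreover have "\<exists>\<psi>. P (Suc i) \<psi> \<and> Q i \<phi> \<psi>" if P: "P i \<phi>" for i \<phi>
  proof -
    have "\<forall>c. \<exists>y. c < res_rank G (Suc i) \<longrightarrow> y \<in> res_strand V F (Suc i) (res_deg G (Suc i) c) \<and>
        lin_map (res_rank G i) \<phi> (res_col G i c) = res_diff F i y"
    proof (intro allI)
      fix c
      show "\<exists>y. c < res_rank G (Suc i) \<longrightarrow> y \<in> res_strand V F (Suc i) (res_deg G (Suc i) c) \<and>
        lin_map (res_rank G i) \<phi> (res_col G i c) = res_diff F i y"
      proof (cases "c < res_rank G (Suc i)")
        case True
        have "lin_map (res_rank G i) \<phi> (res_col G i c) \<in> res_strand V F i (res_deg G (Suc i) c)"
          using P by (intro lin_map_strand[OF G.col_strand[OF True]]) (auto simp: P_def)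
        then show ?thesis using F.strand_exact P True unfolding P_def by blast
      qed auto
    qed
    then obtain \<psi> where \<psi>: "\<And>c. c < res_rank G (Suc i) \<Longrightarrow> \<psi> c \<in> res_strand V F (Suc i) (res_deg G (Suc i) c) \<and>
        lin_map (res_rank G i) \<phi> (res_col G i c) = res_diff F i (\<psi> c)" by metis
    have "res_diff F i (lin_map (res_rank G (Suc i)) \<psi> (res_col G (Suc i) c)) = 0"
      if c: "c < res_rank G (Suc (Suc i))" for c
    proof -
      have "res_diff F i (lin_map (res_rank G (Suc i)) \<psi> (res_col G (Suc i) c)) =
          lin_map (res_rank G (Suc i)) (\<lambda>b. lin_map (res_rank G i) \<phi> (res_col G i b)) (res_col G (Suc i) c)"
        unfolding res_diff_lin_map lin_map_comp
        using \<psi> by (intro lin_map_cong) (simp add: res_diff_lin_map)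
      also have "\<dots> = lin_map (res_rank G i) \<phi> (res_diff G i (res_col G (Suc i) c))"
        by (simp add: res_diff_lin_map lin_map_comp)
      finally show ?thesis using G.diff_col[OF c] by simp
    qed
    then show ?thesis using \<psi> by (intro exI[of _ \<psi>]) (auto simp: P_def Q_def F.aug_cycle_def)
  qed
  ultimately obtain \<Phi> where "\<And>i. P i (\<Phi> i)" "\<And>i. Q i (\<Phi> i) (\<Phi> (Suc i))"
    using dependent_nat_choice[of P Q] by metis
  then show ?thesis unfolding chain_lift_def P_def Q_def by (intro exI[of _ \<Phi>]) blast
qed

lemma chain_lift_comp:
  fixes F G :: "('v, 'k::comm_ring_1) mpol resolution"
  assumes "graded_resolution V J F" "graded_resolution V J G" "chain_lift V J F G \<Phi>" "chain_lift V J G F \<Psi>"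
  shows "chain_lift V J F F (\<lambda>i c. lin_map (res_rank G i) (\<Psi> i) (\<Phi> i c))"
proof -
  interpret F: graded_resolution V J F by fact
  interpret G: graded_resolution V J G by fact
  show ?thesis unfolding chain_lift_def
  proof (intro conjI allI impI)
    fix i c assume "c < res_rank F i"
    then show "lin_map (res_rank G i) (\<Psi> i) (\<Phi> i c) \<in> res_strand V F i (res_deg F i c)"
      using assms(3,4) unfolding chain_lift_def by (intro lin_map_strand) auto
  next
    fix c assume c: "c < res_rank F 0"
    then have \<Phi>: "\<Phi> 0 c \<in> res_strand V G 0 (res_deg F 0 c)" "res_aug F c - res_eps G (\<Phi> 0 c) \<in> J"
      using assms(3) unfolding chain_lift_def by auto
    have "res_eps G (\<Phi> 0 c) - res_eps F (lin_map (res_rank G 0) (\<Psi> 0) (\<Phi> 0 c)) \<in> J"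
      using assms(4) unfolding chain_lift_def by (intro eps_lin_map_cong[OF F.ideal \<Phi>(1)]) blast
    then show "res_aug F c - res_eps F (lin_map (res_rank G 0) (\<Psi> 0) (\<Phi> 0 c)) \<in> J"
      using poly_ideal_add[OF F.ideal \<Phi>(2)] by force
  next
    fix i c assume c: "c < res_rank F (Suc i)"
    show "res_diff F i (lin_map (res_rank G (Suc i)) (\<Psi> (Suc i)) (\<Phi> (Suc i) c)) =
      lin_map (res_rank F i) (\<lambda>c. lin_map (res_rank G i) (\<Psi> i) (\<Phi> i c)) (res_col F i c)"
      using assms(3) c unfolding chain_lift_diff[OF assms(4)] lin_map_comp[symmetric] chain_lift_def by simp
  qed
qed

text \<open>Uniqueness of lifts up to homotopy, against the identity. What remains of
  \<open>id - \<Phi>\<close> after subtracting the part \<open>h d\<close> already constructed is a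
  cycle, and exactness writes it as \<open>d\<close> of the next stage of \<open>h\<close>.\<close>

lemma chain_lift_homotopy:
  fixes F :: "('v, 'k::comm_ring_1) mpol resolution"
  assumes "graded_resolution V J F" and \<Phi>: "chain_lift V J F F \<Phi>"
  shows "\<exists>h. (\<forall>i. \<forall>c<res_rank F i. h i c \<in> res_strand V F (Suc i) (res_deg F i c)) \<and>
    (\<forall>c<res_rank F 0. unit_vec c - \<Phi> 0 c = res_diff F 0 (h 0 c)) \<and>
    (\<forall>i. \<forall>c<res_rank F (Suc i). unit_vec c - \<Phi> (Suc i) c =
      res_diff F (Suc i) (h (Suc i) c) + lin_map (res_rank F i) (h i) (res_col F i c))"
proof -
  interpret F: graded_resolution V J F by fact
  have \<Phi>1: "\<Phi> i c \<in> res_strand V F i (res_deg F i c)" if "c < res_rank F i" for i c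
    using \<Phi> that unfolding chain_lift_def by blast
  have \<Phi>2: "res_aug F c - res_eps F (\<Phi> 0 c) \<in> J" if "c < res_rank F 0" for c
    using \<Phi> that unfolding chain_lift_def by blast
  have \<Phi>3: "res_diff F i (\<Phi> (Suc i) c) = lin_map (res_rank F i) (\<Phi> i) (res_col F i c)"
    if "c < res_rank F (Suc i)" for i c
    using \<Phi> that unfolding chain_lift_def by blast
  define err where "err i h c = unit_vec c - \<Phi> (Suc i) c - lin_map (res_rank F i) h (res_col F i c)" for i h c
  define P where "P i h \<longleftrightarrow> (\<forall>c<res_rank F i. h c \<in> res_strand V F (Suc i) (res_deg F i c)) \<and>
     (i = 0 \<longrightarrow> (\<forall>c<res_rank F 0. unit_vec c - \<Phi> 0 c = res_diff F 0 (h c))) \<and>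
     (\<forall>c<res_rank F (Suc i). res_diff F i (err i h c) = 0)" for i h
  define Q where "Q i h h' \<longleftrightarrow> (\<forall>c<res_rank F (Suc i). err i h c = res_diff F (Suc i) (h' c))"
    for i and h h' :: "nat \<Rightarrow> nat \<Rightarrow> ('v, 'k) mpol"
  have col_module: "res_col F i c \<in> res_module V F i" if "c < res_rank F (Suc i)" for i c
    using F.col_strand[OF that] res_strand_module by blast
  \<comment> \<open>The cycle condition is reduced to the previous stage: there
    \<open>id - \<Phi> - d h\<close> is zero at the start and later equals \<open>h d\<close>, which
    vanishes on columns because \<open>d d = 0\<close>.\<close>
  have diff_err: "res_diff F i (err i h c) =
     lin_map (res_rank F i) (\<lambda>b. unit_vec b - \<Phi> i b - res_diff F i (h b)) (res_col F i c)"
    if c: "c < res_rank F (Suc i)" for i h c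
  proof -
    have "lin_map (res_rank F i) unit_vec (res_col F i c) = res_col F i c"
      by (intro lin_map_unit_columns) (auto simp: res_col_def)
    moreover have "res_diff F i (lin_map (res_rank F i) h (res_col F i c)) =
       lin_map (res_rank F i) (\<lambda>b. res_diff F i (h b)) (res_col F i c)"
      by (simp add: res_diff_lin_map lin_map_comp)
    moreover have "res_diff F i (err i h c) = res_diff F i (unit_vec c) - res_diff F i (\<Phi> (Suc i) c) -
        res_diff F i (lin_map (res_rank F i) h (res_col F i c))"
      by (simp add: err_def res_diff_lin_map lin_map_diff)
    ultimately show ?thesis using \<Phi>3[OF c] F.col_eq_diff[OF c]
      by (simp add: lin_map_diff_columns)
  qed
  have "\<exists>h. P 0 h"
  proof -
    have "\<exists>y. c < res_rank F 0 \<longrightarrow> y \<in> res_strand V F (Suc 0) (res_deg F 0 c) \<and>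
        unit_vec c - \<Phi> 0 c = res_diff F 0 y" for c
    proof (cases "c < res_rank F 0")
      case True
      then have "unit_vec c - \<Phi> 0 c \<in> res_strand V F 0 (res_deg F 0 c)"
        using \<Phi>1 by (intro res_strand_diff res_strand_unit_vec)
      moreover have "F.aug_cycle 0 (unit_vec c - \<Phi> 0 c)"
        using \<Phi>2 True by (simp add: F.aug_cycle_def res_eps_diff res_eps_unit_vec)
      ultimately show ?thesis using F.strand_exact by blast
    qed auto
    then obtain h where h: "\<And>c. c < res_rank F 0 \<Longrightarrow> h c \<in> res_strand V F (Suc 0) (res_deg F 0 c) \<and>
        unit_vec c - \<Phi> 0 c = res_diff F 0 (h c)" by metis
    have "res_diff F 0 (err 0 h c) = 0" if c: "c < res_rank F (Suc 0)" for c
      unfolding diff_err[OF c]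
      using h lin_map_cong[of "res_rank F 0" "\<lambda>b. unit_vec b - \<Phi> 0 b - res_diff F 0 (h b)" "\<lambda>_. 0"]
      by (simp add: lin_map_def zero_fun_def)
    then show ?thesis using h by (intro exI[of _ h]) (auto simp: P_def)
  qed
  moreover have "\<exists>h'. P (Suc i) h' \<and> Q i h h'" if P: "P i h" for i h
  proof -
    have "\<exists>y. c < res_rank F (Suc i) \<longrightarrow> y \<in> res_strand V F (Suc (Suc i)) (res_deg F (Suc i) c) \<and>
        err i h c = res_diff F (Suc i) y" for c
    proof (cases "c < res_rank F (Suc i)")
      case True
      then have "err i h c \<in> res_strand V F (Suc i) (res_deg F (Suc i) c)"
        using \<Phi>1 P F.col_strand[OF True] unfolding err_def P_def
        by (intro res_strand_diff res_strand_unit_vec lin_map_strand) auto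
      moreover have "F.aug_cycle (Suc i) (err i h c)"
        using P True by (simp add: F.aug_cycle_def P_def)
      ultimately show ?thesis using F.strand_exact by blast
    qed auto
    then obtain h' where h': "\<And>c. c < res_rank F (Suc i) \<Longrightarrow>
       h' c \<in> res_strand V F (Suc (Suc i)) (res_deg F (Suc i) c) \<and> err i h c = res_diff F (Suc i) (h' c)" by metis
    have "res_diff F (Suc i) (err (Suc i) h' c) = 0" if c: "c < res_rank F (Suc (Suc i))" for c
    proof -
      have "unit_vec b - \<Phi> (Suc i) b - res_diff F (Suc i) (h' b) = lin_map (res_rank F i) h (res_col F i b)"
        if "b < res_rank F (Suc i)" for b
      proof -
        have "res_diff F (Suc i) (h' b) = unit_vec b - \<Phi> (Suc i) b - lin_map (res_rank F i) h (res_col F i b)"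
          using h'[OF that] by (simp add: err_def)
        then show ?thesis by simp
      qed
      then have "res_diff F (Suc i) (err (Suc i) h' c) =
         lin_map (res_rank F (Suc i)) (\<lambda>b. lin_map (res_rank F i) h (res_col F i b)) (res_col F (Suc i) c)"
        unfolding diff_err[OF c] by (intro lin_map_cong) auto
      also have "\<dots> = lin_map (res_rank F i) h (res_diff F i (res_col F (Suc i) c))"
        by (simp add: res_diff_lin_map lin_map_comp)
      finally show ?thesis using F.diff_col[OF c] by simp
    qed
    then show ?thesis using h' by (intro exI[of _ h']) (auto simp: P_def Q_def)
  qed
  ultimately obtain h where h: "\<And>i. P i (h i)" "\<And>i. Q i (h i) (h (Suc i))"
    using dependent_nat_choice[of P Q] by metis
  show ?thesis
  proof (intro exI[of _ h] conjI allI impI)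
    fix i c assume "c < res_rank F (Suc i)"
    then show "unit_vec c - \<Phi> (Suc i) c =
      res_diff F (Suc i) (h (Suc i) c) + lin_map (res_rank F i) (h i) (res_col F i c)"
      using h(2)[of i] unfolding Q_def err_def by (simp add: diff_eq_eq)
  qed (use h(1) in \<open>auto simp: P_def\<close>)
qed

section \<open>Invariance of Tor under the choice of resolution\<close>

lemma tensor_boundaries_subspace:
  assumes I: "poly_ideal V I"
  shows "0 \<in> tensor_boundaries V I F i d"
    "x \<in> tensor_boundaries V I F i d \<Longrightarrow> y \<in> tensor_boundaries V I F i d \<Longrightarrow> x + y \<in> tensor_boundaries V I F i d"
    "x \<in> tensor_boundaries V I F i d \<Longrightarrow> (\<lambda>a. const_poly c * x a) \<in> tensor_boundaries V I F i d"
proof -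
  show "0 \<in> tensor_boundaries V I F i d"
    unfolding tensor_boundaries_def using poly_ideal_0[OF I]
    by (auto intro!: bexI[of _ 0] simp: res_diff_lin_map)
next
  assume "x \<in> tensor_boundaries V I F i d" "y \<in> tensor_boundaries V I F i d"
  then obtain u w where "x \<in> res_strand V F i d" "y \<in> res_strand V F i d"
    "u \<in> res_strand V F (Suc i) d" "w \<in> res_strand V F (Suc i) d"
    and xu: "\<forall>a<res_rank F i. x a - res_diff F i u a \<in> I" "\<forall>a<res_rank F i. y a - res_diff F i w a \<in> I"
    unfolding tensor_boundaries_def by blast
  moreover have "\<forall>a<res_rank F i. (x + y) a - res_diff F i (u + w) a \<in> I"
  proof (intro allI impI)
    fix a assume "a < res_rank F i"
    then have "(x a - res_diff F i u a) + (y a - res_diff F i w a) \<in> I"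
      using xu poly_ideal_add[OF I] by blast
    then show "(x + y) a - res_diff F i (u + w) a \<in> I"
      by (simp add: res_diff_lin_map lin_map_add algebra_simps)
  qed
  ultimately show "x + y \<in> tensor_boundaries V I F i d"
    unfolding tensor_boundaries_def by (auto intro!: res_strand_add bexI[of _ "u + w"])
next
  assume "x \<in> tensor_boundaries V I F i d"
  then obtain u where "x \<in> res_strand V F i d" "u \<in> res_strand V F (Suc i) d"
    and xu: "\<forall>a<res_rank F i. x a - res_diff F i u a \<in> I"
    unfolding tensor_boundaries_def by blast
  moreover have "\<forall>a<res_rank F i. const_poly c * x a - res_diff F i (\<lambda>a. const_poly c * u a) a \<in> I"
    using xu poly_ideal_mult[OF I polys_const, of _ c]
    by (simp add: res_diff_lin_map lin_map_scale flip: right_diff_distrib)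
  ultimately show "(\<lambda>a. const_poly c * x a) \<in> tensor_boundaries V I F i d"
    unfolding tensor_boundaries_def
    by (auto intro!: res_strand_scale bexI[of _ "\<lambda>a. const_poly c * u a"])
qed

lemma tensor_cycles_subspace:
  assumes I: "poly_ideal V I"
  shows "0 \<in> tensor_cycles V I F i d"
    "x \<in> tensor_cycles V I F i d \<Longrightarrow> y \<in> tensor_cycles V I F i d \<Longrightarrow> x + y \<in> tensor_cycles V I F i d"
    "x \<in> tensor_cycles V I F i d \<Longrightarrow> (\<lambda>a. const_poly c * x a) \<in> tensor_cycles V I F i d"
  unfolding tensor_cycles_def
  using poly_ideal_0[OF I] poly_ideal_add[OF I] poly_ideal_mult[OF I polys_const]
  by (cases i; auto simp: res_diff_lin_map lin_map_add lin_map_scale intro: res_strand_add res_strand_scale)+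

lemma module_const_poly:
  "module (\<lambda>(c::'k::comm_ring_1) (x::nat \<Rightarrow> ('v, 'k) mpol) a. const_poly c * x a)"
proof
  fix a b :: 'k and x y :: "nat \<Rightarrow> ('v, 'k) mpol"
  show "(\<lambda>i. const_poly a * (x + y) i) = (\<lambda>i. const_poly a * x i) + (\<lambda>i. const_poly a * y i)"
    by (auto simp: fun_eq_iff distrib_left)
  show "(\<lambda>i. const_poly (a + b) * x i) = (\<lambda>i. const_poly a * x i) + (\<lambda>i. const_poly b * x i)"
    by (auto simp: fun_eq_iff const_poly_def single_add distrib_right)
  show "(\<lambda>i. const_poly a * (const_poly b * x i)) = (\<lambda>i. const_poly (a * b) * x i)"
    by (auto simp: fun_eq_iff const_poly_def mult_single mult.assoc[symmetric])
  show "(\<lambda>i. const_poly 1 * x i) = x"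
    by (auto simp: fun_eq_iff const_poly_def)
qed

lemma tensor_boundaries_module_subspace:
  assumes "poly_ideal V (I :: ('v, 'k::comm_ring_1) mpol set)"
  shows "module.subspace (\<lambda>(c::'k) x a. const_poly c * x a) (tensor_boundaries V I F i d)"
proof -
  interpret module "\<lambda>(c::'k) (x::nat \<Rightarrow> ('v, 'k) mpol) a. const_poly c * x a"
    by (rule module_const_poly)
  show ?thesis by (intro subspaceI tensor_boundaries_subspace[OF assms])
qed

text \<open>Chain maps in both directions whose composite is homotopic to the identity transport families
  of cycles that are independent modulo boundaries.\<close>

lemma independent_cycles_transfer:
  fixes F G :: "('v, 'k::comm_ring_1) mpol resolution"
  assumes F: "graded_resolution V J F" and G: "graded_resolution V J G" and I: "poly_ideal V I"
    and ex: "\<exists>x. (\<forall>a<r. x a \<in> tensor_cycles V I F i d) \<and>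
      (\<forall>c. (\<Sum>a<r. (\<lambda>b. const_poly (c a) * x a b)) \<in> tensor_boundaries V I F i d \<longrightarrow> (\<forall>a<r. c a = 0))"
  shows "\<exists>x. (\<forall>a<r. x a \<in> tensor_cycles V I G i d) \<and>
      (\<forall>c. (\<Sum>a<r. (\<lambda>b. const_poly (c a) * x a b)) \<in> tensor_boundaries V I G i d \<longrightarrow> (\<forall>a<r. c a = 0))"
proof -
  obtain \<Phi> \<Psi> where \<Phi>: "chain_lift V J F G \<Phi>" and \<Psi>: "chain_lift V J G F \<Psi>"
    using chain_lift_exists[OF F G] chain_lift_exists[OF G F] by blast
  obtain h where h: "\<And>i c. c<res_rank F i \<Longrightarrow> h i c \<in> res_strand V F (Suc i) (res_deg F i c)"
    "\<And>c. c<res_rank F 0 \<Longrightarrow> unit_vec c - lin_map (res_rank G 0) (\<Psi> 0) (\<Phi> 0 c) = res_diff F 0 (h 0 c)"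
    "\<And>i c. c<res_rank F (Suc i) \<Longrightarrow> unit_vec c - lin_map (res_rank G (Suc i)) (\<Psi> (Suc i)) (\<Phi> (Suc i) c) =
      res_diff F (Suc i) (h (Suc i) c) + lin_map (res_rank F i) (h i) (res_col F i c)"
    using chain_lift_homotopy[OF F chain_lift_comp[OF F G \<Phi> \<Psi>]] by blast
  define f where "f = lin_map (res_rank F i) (\<Phi> i)"
  \<comment> \<open>Maps with polynomial entries send vectors over \<open>I\<close> to vectors over
    \<open>I\<close>; this is why lifts and homotopies descend to the tensor product with
    \<open>S / I\<close>.\<close>
  have lin_I: "lin_map r M u a \<in> I" if "\<And>c. c < r \<Longrightarrow> u c \<in> I" "\<And>c. c < r \<Longrightarrow> M c a \<in> polys V"
    for r and M :: "nat \<Rightarrow> nat \<Rightarrow> ('v, 'k) mpol" and u a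
    unfolding lin_map_def using that by (intro poly_ideal_sum[OF I] poly_ideal_mult_right[OF I]) auto
  have entry: "x a \<in> polys V" if "x \<in> res_strand V H i d" for x H i d a
    using that unfolding res_strand_iff by (cases "a < res_rank H i") auto
  have \<Phi>s: "\<Phi> i c \<in> res_strand V G i (res_deg F i c)" if "c < res_rank F i" for i c
    using \<Phi> that unfolding chain_lift_def by blast
  have \<Psi>s: "\<Psi> i c \<in> res_strand V F i (res_deg G i c)" if "c < res_rank G i" for i c
    using \<Psi> that unfolding chain_lift_def by blast
  have f_strand: "f x \<in> res_strand V G i d" if "x \<in> res_strand V F i d" for x
    unfolding f_def using that \<Phi>s by (rule lin_map_strand)
  have f_cycle: "f x \<in> tensor_cycles V I G i d" if x: "x \<in> tensor_cycles V I F i d" for x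
  proof (cases i)
    case 0
    then show ?thesis using x f_strand unfolding tensor_cycles_def by simp
  next
    case (Suc k)
    have "res_diff G k (f x) a \<in> I" for a
      using x entry[OF \<Phi>s] unfolding f_def Suc chain_lift_diff[OF \<Phi>]
      by (intro lin_I) (auto simp: tensor_cycles_def Suc)
    then show ?thesis using x f_strand unfolding tensor_cycles_def by (simp add: Suc)
  qed
  \<comment> \<open>Injectivity on homology: the return map \<open>\<Psi>\<close> turns
    \<open>f x\<close> into a boundary, and \<open>x - \<Psi> (f x)\<close> equals
    \<open>d (h x) + h (d x)\<close> (only \<open>d (h x)\<close> in degree 0), where
    \<open>h (d x)\<close> has entries in \<open>I\<close> because \<open>x\<close> is a cycle
    modulo \<open>I\<close>.\<close>
  have f_bnd: "x \<in> tensor_boundaries V I F i d"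
    if x: "x \<in> tensor_cycles V I F i d" and fx: "f x \<in> tensor_boundaries V I G i d" for x
  proof -
    have xs: "x \<in> res_strand V F i d" using x unfolding tensor_cycles_def by simp
    obtain y where y: "y \<in> res_strand V G (Suc i) d" "\<forall>a<res_rank G i. f x a - res_diff G i y a \<in> I"
      using fx unfolding tensor_boundaries_def by blast
    define z where "z = lin_map (res_rank G (Suc i)) (\<Psi> (Suc i)) y"
    have zs: "z \<in> res_strand V F (Suc i) d"
      unfolding z_def using y(1) \<Psi>s by (rule lin_map_strand)
    have hs: "lin_map (res_rank F i) (h i) x \<in> res_strand V F (Suc i) d"
      using xs h(1) by (rule lin_map_strand)
    have 1: "(lin_map (res_rank G i) (\<Psi> i) (f x) - res_diff F i z) a \<in> I" for a
    proof -
      have "lin_map (res_rank G i) (\<Psi> i) (f x - res_diff G i y) a \<in> I"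
        using y(2) entry[OF \<Psi>s] by (intro lin_I) auto
      then show ?thesis by (simp add: z_def lin_map_diff chain_lift_diff[OF \<Psi>])
    qed
    have 2: "(x - lin_map (res_rank G i) (\<Psi> i) (f x) - res_diff F i (lin_map (res_rank F i) (h i) x)) a \<in> I" for a
    proof -
      have "lin_map (res_rank F i) unit_vec x = x"
        using xs by (intro lin_map_unit_columns) (auto simp: res_strand_iff)
      then have eq: "x - lin_map (res_rank G i) (\<Psi> i) (f x) =
         lin_map (res_rank F i) (\<lambda>c. unit_vec c - lin_map (res_rank G i) (\<Psi> i) (\<Phi> i c)) x"
        by (simp add: f_def lin_map_comp lin_map_diff_columns)
      show ?thesis
      proof (cases i)
        case 0
        have "x - lin_map (res_rank G i) (\<Psi> i) (f x) = lin_map (res_rank F 0) (\<lambda>c. res_diff F 0 (h 0 c)) x"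
          unfolding eq unfolding 0 using h(2) by (intro lin_map_cong) auto
        then show ?thesis using poly_ideal_0[OF I] by (simp add: 0 res_diff_lin_map lin_map_comp)
      next
        case (Suc k)
        have "x - lin_map (res_rank G i) (\<Psi> i) (f x) = lin_map (res_rank F (Suc k))
           (\<lambda>c. res_diff F (Suc k) (h (Suc k) c) + lin_map (res_rank F k) (h k) (res_col F k c)) x"
          unfolding eq unfolding Suc using h(3) by (intro lin_map_cong) auto
        also have "\<dots> = res_diff F i (lin_map (res_rank F i) (h i) x) +
            lin_map (res_rank F k) (h k) (res_diff F k x)"
          by (simp add: Suc lin_map_add_columns res_diff_lin_map lin_map_comp)
        finally have "x - lin_map (res_rank G i) (\<Psi> i) (f x) - res_diff F i (lin_map (res_rank F i) (h i) x) =
           lin_map (res_rank F k) (h k) (res_diff F k x)" by simp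
        moreover have "lin_map (res_rank F k) (h k) (res_diff F k x) a \<in> I"
          using x entry[OF h(1)] by (intro lin_I) (auto simp: tensor_cycles_def Suc)
        ultimately show ?thesis by simp
      qed
    qed
    have "x a - res_diff F i (z + lin_map (res_rank F i) (h i) x) a \<in> I" for a
      using poly_ideal_add[OF I 1[of a] 2[of a]]
      by (simp add: res_diff_lin_map lin_map_add algebra_simps)
    then show ?thesis unfolding tensor_boundaries_def
      using xs res_strand_add[OF zs hs] by blast
  qed
  obtain x where x: "\<forall>a<r. x a \<in> tensor_cycles V I F i d"
    "\<And>c. (\<Sum>a<r. (\<lambda>b. const_poly (c a) * x a b)) \<in> tensor_boundaries V I F i d \<Longrightarrow> \<forall>a<r. c a = 0"
    using ex by blast
  show ?thesis
  proof (intro exI[of _ "\<lambda>a. f (x a)"] conjI allI impI)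
    fix c a assume bnd: "(\<Sum>a<r. (\<lambda>b. const_poly (c a) * f (x a) b)) \<in> tensor_boundaries V I G i d" and "a < r"
    have "(\<Sum>a<r. (\<lambda>b. const_poly (c a) * f (x a) b)) = f (\<Sum>a<r. (\<lambda>b. const_poly (c a) * x a b))"
      by (simp add: f_def lin_map_sum lin_map_scale)
    moreover have "(\<Sum>a<r. (\<lambda>b. const_poly (c a) * x a b)) \<in> tensor_cycles V I F i d"
    proof -
      have "(\<Sum>a\<in>A. (\<lambda>b. const_poly (c a) * x a b)) \<in> tensor_cycles V I F i d" if "A \<subseteq> {..<r}" for A
        using that x(1)
        by (induction A rule: infinite_finite_induct) (auto intro!: tensor_cycles_subspace[OF I])
      then show ?thesis by blast
    qed
    ultimately have "(\<Sum>a<r. (\<lambda>b. const_poly (c a) * x a b)) \<in> tensor_boundaries V I F i d"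
      using bnd f_bnd by simp
    then show "c a = 0" using x(2) \<open>a < r\<close> by blast
  qed (use x(1) f_cycle in blast)
qed

text \<open>The transfer in both directions shows that the two maxima range over the same set of
  numbers, so they agree before either is known to exist.\<close>

theorem tor_rank_eq:
  fixes J :: "('v, 'k::idom) mpol set"
  assumes F: "graded_free_resolution V J F" and I: "poly_ideal V I"
    and J: "poly_ideal V J" "\<And>f d. f \<in> J \<Longrightarrow> homog_part 0 d f \<in> J"
  shows "tor_rank V I J i d = quotient_rank (\<lambda>c x a. const_poly c * x a)
           (tensor_cycles V I F i d) (tensor_boundaries V I F i d)"
proof -
  define G where "G = (SOME F. graded_free_resolution V J F)"
  have "graded_free_resolution V J G" unfolding G_def using F by (rule someI)
  then have FG: "graded_resolution V J F" "graded_resolution V J G"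
    using F J by unfold_locales auto
  show ?thesis unfolding tor_rank_def Let_def G_def[symmetric] quotient_rank_def
    by (intro arg_cong[where f = Greatest] ext iffI;
        erule independent_cycles_transfer[OF FG I] independent_cycles_transfer[OF FG(2,1) I])
qed

section \<open>The Koszul resolution\<close>

text \<open>Exponents subtract with truncation, hence the guard: without \<open>w\<close> in its
  support, the monomial \<open>b\<close> is no multiple of the variable.\<close>

lemma lookup_var_mult:
  fixes f :: "('a, 'b::comm_ring_1) mpol"
  shows
  "lookup (var_poly w * f) b =
     (if w \<in> keys b then lookup f (b - Poly_Mapping.single w 1) else 0)"
proof -
  have 1: "(\<Sum>q. lookup f q when b = Poly_Mapping.single w 1 + q) =
      (if w \<in> keys b then lookup f (b - Poly_Mapping.single w 1) else 0)"
  proof (cases "w \<in> keys b")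
    case True
    have "b = Poly_Mapping.single w 1 + q \<longleftrightarrow> q = b - Poly_Mapping.single w 1" for q
    proof
      assume "q = b - Poly_Mapping.single w 1"
      then show "b = Poly_Mapping.single w 1 + q" using True
        by (intro poly_mapping_eqI) (auto simp: lookup_add lookup_minus lookup_single when_def in_keys_iff)
    qed simp
    then show ?thesis using True by simp
  next
    case False
    then have "b \<noteq> Poly_Mapping.single w 1 + q" for q
      by (auto simp: keys_plus_nat)
    then show ?thesis using False by simp
  qed
  have "lookup (var_poly w * f) b = (\<Sum>l. (if l = Poly_Mapping.single w (1::nat) then
      (\<Sum>q. lookup f q when b = Poly_Mapping.single w 1 + q) else 0))"
  proof -
    have "lookup (var_poly w :: ('a, 'b) mpol) l *
        (\<Sum>q. lookup f q when b = l + q) = (if l = Poly_Mapping.single w 1 then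
      (\<Sum>q. lookup f q when b = Poly_Mapping.single w 1 + q) else 0)" for l
      by (auto simp: var_poly_def lookup_single when_def)
    then show ?thesis unfolding lookup_mult by (simp only:)
  qed
  also have "\<dots> = (\<Sum>q. lookup f q when b = Poly_Mapping.single w 1 + q)"
    using Sum_any_when_equal[of "\<lambda>_. (\<Sum>q. lookup f q when b = Poly_Mapping.single w 1 + q)"]
    by (simp add: when_def)
  finally show ?thesis using 1 by simp
qed

lemma lookup_ksgn_mult:
  "lookup ((ksgn ord w S :: ('v, 'k::comm_ring_1) mpol) * f) b =
     ksgn ord w S * lookup f b"
  by (cases "even (card {u\<in>S. ord u < ord w})") (auto simp: ksgn_def)

lemma cob_cong_insert:
  "(\<And>w. w \<in> A - S \<Longrightarrow> f (insert w S) = g (insert w S)) \<Longrightarrow> cob ord A f S = cob ord A g S"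
  unfolding cob_def by (intro sum.cong) auto

text \<open>Cycles are functions on all subsets, although only the values on sets of size
  \<open>i\<close> are tested. Coefficients of Koszul elements are controlled only there, and this
  allows the remaining values to be exchanged.\<close>

lemma ccyc_cong:
  assumes "finite A" "\<And>S. S \<subseteq> A \<Longrightarrow> int (card S) = i \<Longrightarrow> f S = g S"
  shows "f \<in> ccyc ord A P i \<longleftrightarrow> g \<in> ccyc ord A P i"
proof -
  have "cob ord A f S = cob ord A g S" if "S \<subseteq> A" "int (card S) + 1 = i" for S
    using that assms finite_subset[of S A] by (intro cob_cong_insert assms(2)) auto
  then show ?thesis unfolding ccyc_def by auto
qed

lemma cbnd_cong:
  assumes "\<And>S. S \<subseteq> A \<Longrightarrow> int (card S) = i \<Longrightarrow> f S = g S"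
  shows "f \<in> cbnd ord A P i \<longleftrightarrow> g \<in> cbnd ord A P i"
  unfolding cbnd_def using assms by auto

locale koszul =
  fixes V :: "'v set" and ord :: "'v \<Rightarrow> nat"
  assumes fin_V: "finite V" and inj_ord: "inj_on ord V"
begin

definition subs :: "nat \<Rightarrow> 'v set set" where
  "subs i = {S. S \<subseteq> V \<and> card S = i}"

text \<open>Resolutions number their bases, while the Koszul basis consists of subsets.
  \<open>en\<close> and \<open>idx\<close> translate; \<open>idx\<close> recovers the homological
  degree from the size of the set.\<close>

definition en :: "nat \<Rightarrow> nat \<Rightarrow> 'v set" where
  "en i = (SOME f. bij_betw f {..<card (subs i)} (subs i))"

definition idx :: "'v set \<Rightarrow> nat" where
  "idx S = inv_into {..<card (subs (card S))} (en (card S)) S"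

lemma finite_subs: "finite (subs i)"
  unfolding subs_def using fin_V by simp

lemma bij_en: "bij_betw (en i) {..<card (subs i)} (subs i)"
  unfolding en_def using ex_bij_betw_nat_finite[OF finite_subs, of i]
  by (intro someI_ex[of "\<lambda>f. bij_betw f {..<card (subs i)} (subs i)"]) (simp add: lessThan_atLeast0)

lemma en_props: "a < card (subs i) \<Longrightarrow> en i a \<subseteq> V" "a < card (subs i) \<Longrightarrow> card (en i a) = i"
  using bij_betwE[OF bij_en[of i]] by (auto simp: subs_def)

lemma idx_en: "a < card (subs i) \<Longrightarrow> idx (en i a) = a"
  using bij_betw_inv_into_left[OF bij_en[of i], of a] en_props[of a i] by (simp add: idx_def)

lemma en_idx: "S \<subseteq> V \<Longrightarrow> en (card S) (idx S) = S"
  using bij_betw_inv_into_right[OF bij_en[of "card S"], of S] by (simp add: idx_def subs_def)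

lemma idx_less: "S \<subseteq> V \<Longrightarrow> card S = i \<Longrightarrow> idx S < card (subs i)"
  using bij_betw_apply[OF bij_betw_inv_into[OF bij_en[of i]], of S] by (auto simp: idx_def subs_def)

lemma en_eq_iff: "S \<subseteq> V \<Longrightarrow> card S = i \<Longrightarrow> c < card (subs i) \<Longrightarrow> S = en i c \<longleftrightarrow> c = idx S"
  by (metis idx_en en_idx)

lemma fin_sub: "S \<subseteq> V \<Longrightarrow> finite S"
  using fin_V finite_subset by blast

text \<open>At most one \<open>w\<close> meets the condition in a matrix entry, so the entry is a
  signed variable or zero; the sum avoids naming that vertex. A subset of size \<open>i\<close> has
  degree \<open>2 * i\<close> because each of its vertices carries degree 2.\<close>

definition koszul_res :: "('v, 'k::comm_ring_1) mpol resolution" where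
  "koszul_res = \<lparr>res_rank = (\<lambda>i. card (subs i)), res_deg = (\<lambda>i a. 2 * i), res_aug = (\<lambda>_. 1),
     res_mat = (\<lambda>i a c. \<Sum>w\<in>V - en i a.
       if insert w (en i a) = en (Suc i) c then ksgn ord w (en i a) * var_poly w else 0)\<rparr>"

lemma koszul_simps [simp]: "res_rank koszul_res i = card (subs i)" "res_deg koszul_res i a = 2 * i"
  "res_aug koszul_res a = 1"
  by (simp_all add: koszul_res_def)

abbreviation "koszul_module \<equiv> res_module V koszul_res"
abbreviation "koszul_strand \<equiv> res_strand V koszul_res"

lemma polys_ksgn [simp]: "ksgn ord w S \<in> polys V'"
  by (cases "even (card {u\<in>S. ord u < ord w})") (auto simp: ksgn_def intro: polys_uminus)

lemma homog_shift_ksgn: "homog_shift g g (ksgn ord w S)"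
  by (cases "even (card {u\<in>S. ord u < ord w})") (auto simp: ksgn_def intro: homog_shift_1 homog_shift_uminus)

lemma koszul_diff:
  assumes "S \<subseteq> V"
  shows "res_diff koszul_res (card S) x (idx S) =
     (\<Sum>w\<in>V - S. ksgn ord w S * (var_poly w * x (idx (insert w S))))"
proof -
  let ?i = "card S"
  have "res_diff koszul_res ?i x (idx S) = (\<Sum>c<card (subs (Suc ?i)). \<Sum>w\<in>V - S.
     if insert w S = en (Suc ?i) c then x c * (ksgn ord w S * var_poly w) else 0)"
    using assms by (auto simp: res_diff_def idx_less koszul_res_def en_idx sum_distrib_left intro!: sum.cong)
  also have "\<dots> = (\<Sum>w\<in>V - S. \<Sum>c<card (subs (Suc ?i)).
     if insert w S = en (Suc ?i) c then x c * (ksgn ord w S * var_poly w) else 0)"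
    by (rule sum.swap)
  also have "\<dots> = (\<Sum>w\<in>V - S. ksgn ord w S * (var_poly w * x (idx (insert w S))))"
  proof (rule sum.cong[OF refl])
    fix w assume w: "w \<in> V - S"
    have c: "card (insert w S) = Suc ?i" using w fin_sub[OF assms] by simp
    have "(\<Sum>c<card (subs (Suc ?i)). if insert w S = en (Suc ?i) c then x c * (ksgn ord w S * var_poly w) else 0) =
       (\<Sum>c<card (subs (Suc ?i)). if c = idx (insert w S) then x c * (ksgn ord w S * var_poly w) else 0)"
      using en_eq_iff[OF _ c] w assms by (intro sum.cong) auto
    also have "\<dots> = x (idx (insert w S)) * (ksgn ord w S * var_poly w)"
      using idx_less[OF _ c] w assms by simp
    finally show "(\<Sum>c<card (subs (Suc ?i)). if insert w S = en (Suc ?i) c then x c * (ksgn ord w S * var_poly w) else 0) =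
       ksgn ord w S * (var_poly w * x (idx (insert w S)))" by (simp add: ac_simps)
  qed
  finally show ?thesis .
qed

text \<open>The coefficient of the basis vector of \<open>S\<close> in multidegree \<open>e\<close>.\<close>

definition mcoef :: "(nat \<Rightarrow> ('v, 'k::comm_ring_1) mpol) \<Rightarrow> ('v \<Rightarrow>\<^sub>0 nat) \<Rightarrow> 'v set \<Rightarrow> 'k" where
  "mcoef x e S = lookup (x (idx S)) (e - ind_mon S)"

lemma ind_mon_diff_add:
  "finite S \<Longrightarrow> S \<subseteq> keys e \<Longrightarrow> e - ind_mon S + ind_mon S = e"
  by (intro poly_mapping_eqI) (auto simp: lookup_add lookup_minus lookup_ind_mon in_keys_iff subset_iff)

lemma mcoef_diff: "mcoef (x - y) e S = mcoef x e S - mcoef y e S"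
  by (simp add: mcoef_def lookup_minus)

lemma lookup_const_mult: "lookup (const_poly c * f) e = c * lookup f e"
  by (simp add: const_poly_def mult_map_scale_conv_mult[symmetric] Poly_Mapping.map.rep_eq when_def)

lemma mcoef_sum: "mcoef (\<Sum>t\<in>T. (\<lambda>a. const_poly (c t) * u t a)) e S = (\<Sum>t\<in>T. c t * mcoef (u t) e S)"
  by (simp add: mcoef_def sum_fun_apply lookup_sum lookup_const_mult)

text \<open>The differential preserves multidegrees: the variable \<open>w\<close> gained by the
  coefficient is the one lost by the basis vector of \<open>insert w S\<close>. A vertex outside
  \<open>keys e\<close> cannot divide the monomial, so only the simplex on \<open>keys e\<close>
  remains.\<close>

lemma koszul_diff_coef:
  fixes x :: "nat \<Rightarrow> ('v, 'k::comm_ring_1) mpol"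
  assumes "keys e \<subseteq> V" "S \<subseteq> keys e"
  shows "mcoef (res_diff koszul_res (card S) x) e S = cob ord (keys e) (mcoef x e) S"
proof -
  have SV: "S \<subseteq> V" and fS: "finite S" using assms fin_sub by auto
  let ?b = "e - ind_mon S"
  have b: "w \<in> keys ?b \<longleftrightarrow> w \<in> keys e" if "w \<notin> S" for w
    using that fS by (simp add: in_keys_iff lookup_minus lookup_ind_mon)
  have b': "?b - Poly_Mapping.single w 1 = e - ind_mon (insert w S)" if "w \<notin> S" for w
    using that fS by (intro poly_mapping_eqI) (auto simp: lookup_minus lookup_ind_mon lookup_single when_def)
  have "mcoef (res_diff koszul_res (card S) x) e S =
      (\<Sum>w\<in>V - S. ksgn ord w S * (if w \<in> keys e then mcoef x e (insert w S) else 0))"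
    unfolding mcoef_def koszul_diff[OF SV] lookup_sum
    by (intro sum.cong) (auto simp: lookup_ksgn_mult lookup_var_mult b b'[unfolded One_nat_def])
  also have "\<dots> = cob ord (keys e) (mcoef x e) S"
    unfolding cob_def using assms fin_V by (intro sum.mono_neutral_cong_right) auto
  finally show ?thesis .
qed

text \<open>The inverse of \<open>mcoef\<close>: coefficients prescribed in the multidegrees of
  \<open>E\<close> are put together to one element. The restriction
  \<open>en i a \<subseteq> keys e\<close> keeps the subtraction of exponents exact.\<close>

definition asm :: "nat \<Rightarrow> ('v \<Rightarrow>\<^sub>0 nat) set \<Rightarrow> (('v \<Rightarrow>\<^sub>0 nat) \<Rightarrow> 'v set \<Rightarrow> 'k) \<Rightarrow> nat \<Rightarrow> ('v, 'k::comm_ring_1) mpol" where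
  "asm i E z a = (if a < card (subs i) then
     \<Sum>e | e \<in> E \<and> en i a \<subseteq> keys e. Poly_Mapping.single (e - ind_mon (en i a)) (z e (en i a)) else 0)"

lemma lookup_asm:
  assumes "finite E" "a < card (subs i)"
  shows "lookup (asm i E z a) b =
    (if b + ind_mon (en i a) \<in> E then z (b + ind_mon (en i a)) (en i a) else 0)"
proof -
  let ?S = "en i a"
  have fS: "finite ?S" using en_props assms fin_sub by blast
  have eq: "e - ind_mon ?S = b \<longleftrightarrow> e = b + ind_mon ?S" if "?S \<subseteq> keys e" for e
    using ind_mon_diff_add[OF fS that] by auto
  have "lookup (asm i E z a) b =
      (\<Sum>e | e \<in> E \<and> ?S \<subseteq> keys e. if e = b + ind_mon ?S then z e ?S else 0)"
    using assms(2) by (auto simp: asm_def lookup_sum lookup_single when_def eq intro!: sum.cong)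
  also have "\<dots> = (if b + ind_mon ?S \<in> E then z (b + ind_mon ?S) ?S else 0)"
    using assms(1) fS by (simp add: keys_plus_nat keys_ind_mon)
  finally show ?thesis .
qed

lemma mcoef_asm:
  assumes "finite E" "S \<subseteq> keys e" "keys e \<subseteq> V" "card S = i"
  shows "mcoef (asm i E z) e S = (if e \<in> E then z e S else 0)"
proof -
  have SV: "S \<subseteq> V" "finite S" using assms fin_sub by auto
  then show ?thesis using assms idx_less[of S i] en_idx[of S] ind_mon_diff_add[of S e]
    by (simp add: mcoef_def lookup_asm)
qed

lemma asm_module:
  assumes "finite E" "\<And>e. e \<in> E \<Longrightarrow> keys e \<subseteq> V"
  shows "asm i E z \<in> koszul_module i"
proof -
  have "asm i E z a \<in> polys V" if a: "a < card (subs i)" for a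
    unfolding polys_def
  proof (intro CollectI ballI)
    fix b assume "b \<in> keys (asm i E z a)"
    then have "b + ind_mon (en i a) \<in> E"
      by (simp add: in_keys_iff lookup_asm[OF assms(1) a] split: if_splits)
    then show "keys b \<subseteq> V"
      using assms(2)[of "b + ind_mon (en i a)"] by (simp add: keys_plus_nat)
  qed
  then show ?thesis by (simp add: res_module_def) (simp add: asm_def)
qed

lemma lookup_eq_mcoef:
  fixes x :: "nat \<Rightarrow> ('v, 'k::comm_ring_1) mpol"
  assumes "a < card (subs i)"
  shows "lookup (x a) b = mcoef x (b + ind_mon (en i a)) (en i a)"
  using assms by (simp add: mcoef_def idx_en)

lemma module_eq_0_iff:
  fixes x :: "nat \<Rightarrow> ('v, 'k::comm_ring_1) mpol"
  assumes "x \<in> koszul_module i"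
  shows "x = 0 \<longleftrightarrow> (\<forall>e S. keys e \<subseteq> V \<and> S \<subseteq> keys e \<and> card S = i \<longrightarrow> mcoef x e S = 0)"
proof
  assume 0: "\<forall>e S. keys e \<subseteq> V \<and> S \<subseteq> keys e \<and> card S = i \<longrightarrow> mcoef x e S = 0"
  have mod: "\<And>a. a < card (subs i) \<Longrightarrow> x a \<in> polys V" "\<And>a. a \<ge> card (subs i) \<Longrightarrow> x a = 0"
    using assms by (simp_all add: res_module_def)
  have "x a = 0" for a
  proof (cases "a < card (subs i)")
    case False
    then show ?thesis using mod by simp
  next
    case a: True
    show ?thesis
    proof (rule poly_mapping_eqI)
      fix b
      show "lookup (x a) b = lookup 0 b"
      proof (cases "keys b \<subseteq> V")
        case False
        then have "b \<notin> keys (x a)" using mod(1)[OF a] by (auto simp: polys_def)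
        then show ?thesis by (simp add: in_keys_iff)
      next
        case True
        have "mcoef x (b + ind_mon (en i a)) (en i a) = 0"
          using True en_props[OF a] fin_sub[OF en_props(1)[OF a]]
          by (intro 0[rule_format]) (simp add: keys_plus_nat keys_ind_mon)
        then show ?thesis by (simp add: lookup_eq_mcoef[OF a])
      qed
    qed
  qed
  then show "x = 0" by (simp add: fun_eq_iff)
qed (simp add: mcoef_def)

section \<open>Exactness of the Koszul complex\<close>

lemma koszul_mat:
  assumes "a < card (subs i)" "c < card (subs (Suc i))"
  shows "(res_mat koszul_res i a c :: ('v, 'k::comm_ring_1) mpol) \<in> polys V"
    "homog_shift (2 * i) (2 * Suc i) (res_mat koszul_res i a c :: ('v, 'k) mpol)"
proof -
  have eq: "(res_mat koszul_res i a c :: ('v, 'k) mpol) = (\<Sum>w\<in>V - en i a.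
     if insert w (en i a) = en (Suc i) c then ksgn ord w (en i a) * var_poly w else 0)"
    by (simp add: koszul_res_def)
  show "(res_mat koszul_res i a c :: ('v, 'k) mpol) \<in> polys V"
    unfolding eq by (rule polys_sum) (simp add: polys_mult)
  have "homog_shift (2 * i) (2 * Suc i) (ksgn ord w S * var_poly w :: ('v, 'k) mpol)" for w S
    by (rule homog_shift_mult[OF homog_shift_ksgn homog_shift_var]) simp
  then show "homog_shift (2 * i) (2 * Suc i) (res_mat koszul_res i a c :: ('v, 'k) mpol)"
    unfolding eq by (intro homog_shift_sum) (simp del: mult_Suc_right)
qed

lemma koszul_diff_module:
  assumes x: "x \<in> koszul_module (Suc i)"
  shows "res_diff koszul_res i x \<in> koszul_module i"
proof -
  have "(\<Sum>c<card (subs (Suc i)). x c * res_mat koszul_res i a c) \<in> polys V" if "a < card (subs i)" for a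
    using x that koszul_mat(1)[OF that] unfolding res_module_def by (intro polys_sum polys_mult) simp_all
  then show ?thesis unfolding res_module_def res_diff_def by simp
qed

lemma koszul_diff_diff:
  fixes x :: "nat \<Rightarrow> ('v, 'k::comm_ring_1) mpol"
  assumes "x \<in> koszul_module (Suc (Suc i))"
  shows "res_diff koszul_res i (res_diff koszul_res (Suc i) x) = 0"
proof -
  have "mcoef (res_diff koszul_res i (res_diff koszul_res (Suc i) x)) e S = 0"
    if e: "keys e \<subseteq> V" "S \<subseteq> keys e" "card S = i" for e S
  proof -
    have "mcoef (res_diff koszul_res i (res_diff koszul_res (Suc i) x)) e S =
       cob ord (keys e) (mcoef (res_diff koszul_res (Suc i) x) e) S"
      using koszul_diff_coef[OF e(1,2), of "res_diff koszul_res (Suc i) x"] e(3) by simp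
    also have "\<dots> = cob ord (keys e) (cob ord (keys e) (mcoef x e)) S"
    proof (rule cob_cong_insert)
      fix w assume w: "w \<in> keys e - S"
      then have "card (insert w S) = Suc i" using e fin_sub[of S] by auto
      then show "mcoef (res_diff koszul_res (Suc i) x) e (insert w S) =
         cob ord (keys e) (mcoef x e) (insert w S)"
        using koszul_diff_coef[OF e(1), of "insert w S" x] w e by auto
    qed
    also have "\<dots> = 0" using e inj_ord by (intro cob_cob) (auto intro: inj_on_subset)
    finally show ?thesis .
  qed
  then show ?thesis
    using module_eq_0_iff[OF koszul_diff_module[OF koszul_diff_module[OF assms]]] by blast
qed

text \<open>In a multidegree with non-empty support the complex is that of a full simplex, a cone
  over any of its vertices; the multidegree 0 has no subset of positive size. The primitives of the
  single multidegrees are then assembled by \<open>asm\<close>.\<close>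

lemma koszul_exact:
  fixes x :: "nat \<Rightarrow> ('v, 'k::comm_ring_1) mpol"
  assumes x: "x \<in> koszul_module (Suc i)" and dx: "res_diff koszul_res i x = 0"
  shows "\<exists>y\<in>koszul_module (Suc (Suc i)). x = res_diff koszul_res (Suc i) y"
proof -
  have "\<exists>y. keys e \<subseteq> V \<longrightarrow>
     (\<forall>S\<subseteq>keys e. card S = Suc i \<longrightarrow> mcoef x e S = cob ord (keys e) y S)" for e
  proof (cases "keys e \<subseteq> V \<and> keys e \<noteq> {}")
    case True
    then obtain v where v: "v \<in> keys e" by blast
    define A where "A = keys e - {v}"
    have A: "keys e = insert v A" "v \<notin> A" "finite A" using v by (auto simp: A_def)
    have "inj_on ord (keys e)" using True inj_ord inj_on_subset by blast
    then have "inj_on ord (insert v A)" unfolding A(1) .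
    then have "cfree TYPE('k) ord (keys e) (\<lambda>_. True) (int (Suc i)) 0"
      unfolding A(1) using A by (intro cfree_cone) auto
    moreover have "cob ord (keys e) (mcoef x e) S = 0"
      if S: "S \<subseteq> keys e" "int (card S) + 1 = int (Suc i)" for S
    proof -
      have "card S = i" using S by simp
      then show ?thesis
        using koszul_diff_coef[of e S x] True S dx by (simp add: mcoef_def)
    qed
    ultimately have "\<exists>y. \<forall>S\<subseteq>keys e. True \<and> int (card S) = int (Suc i) \<longrightarrow>
       mcoef x e S = cob ord (keys e) y S"
      unfolding cfree_0_iff by blast
    then show ?thesis by auto
  qed auto
  then have "\<forall>e. \<exists>y. keys e \<subseteq> V \<longrightarrow>
     (\<forall>S\<subseteq>keys e. card S = Suc i \<longrightarrow> mcoef x e S = cob ord (keys e) y S)" ..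
  from choice[OF this] obtain z where
    z: "\<And>e S. \<lbrakk>keys e \<subseteq> V; S \<subseteq> keys e; card S = Suc i\<rbrakk> \<Longrightarrow>
     mcoef x e S = cob ord (keys e) (z e) S" by auto
  \<comment> \<open>The multidegrees that occur in \<open>x\<close>. There are finitely many, so
    their primitives form a polynomial vector; in all others \<open>x\<close> vanishes and needs
    none.\<close>
  define E where "E = (\<Union>a<card (subs (Suc i)). (\<lambda>b. b + ind_mon (en (Suc i) a)) ` keys (x a))"
  have fE: "finite E" unfolding E_def by auto
  have EV: "keys e \<subseteq> V" if eE: "e \<in> E" for e
  proof -
    obtain a b where ab: "a < card (subs (Suc i))" "b \<in> keys (x a)"
      "e = b + ind_mon (en (Suc i) a)" using eE by (auto simp: E_def)
    then have "keys b \<subseteq> V" using x unfolding res_module_def polys_def by auto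
    then show ?thesis
      using ab en_props(1)[OF ab(1)] fin_sub by (simp add: keys_plus_nat keys_ind_mon)
  qed
  have xE: "mcoef x e S = 0" if "e \<notin> E" "keys e \<subseteq> V" "S \<subseteq> keys e" "card S = Suc i" for e S
  proof (rule ccontr)
    assume "mcoef x e S \<noteq> 0"
    then have "e - ind_mon S \<in> keys (x (idx S))" by (simp add: mcoef_def in_keys_iff)
    moreover have SV: "S \<subseteq> V" using that by auto
    moreover have "en (Suc i) (idx S) = S" using en_idx[OF SV] that by simp
    moreover have "e - ind_mon S + ind_mon S = e" using that fin_sub[OF SV] by (intro ind_mon_diff_add)
    ultimately have "e \<in> E" unfolding E_def using idx_less[OF SV that(4)]
      by (intro UN_I[of "idx S"] image_eqI[of _ _ "e - ind_mon S"]) auto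
    then show False using that by simp
  qed
  define y where "y = asm (Suc (Suc i)) E z"
  have y: "y \<in> koszul_module (Suc (Suc i))"
    unfolding y_def using fE EV by (rule asm_module)
  have "x - res_diff koszul_res (Suc i) y \<in> koszul_module (Suc i)"
    using x koszul_diff_module[OF y] by (auto simp: res_module_def intro: polys_diff)
  moreover have "mcoef (x - res_diff koszul_res (Suc i) y) e S = 0"
    if e: "keys e \<subseteq> V" "S \<subseteq> keys e" "card S = Suc i" for e S
  proof -
    have "mcoef (res_diff koszul_res (Suc i) y) e S = cob ord (keys e) (mcoef y e) S"
      using koszul_diff_coef[OF e(1,2), of y] e(3) by simp
    also have "\<dots> = cob ord (keys e) (if e \<in> E then z e else (\<lambda>_. 0)) S"
    proof (rule cob_cong_insert)
      fix w assume w: "w \<in> keys e - S"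
      then have "card (insert w S) = Suc (Suc i)" using e fin_sub[of S] by auto
      then show "mcoef y e (insert w S) = (if e \<in> E then z e else (\<lambda>_. 0)) (insert w S)"
        unfolding y_def using w e by (subst mcoef_asm[OF fE]) auto
    qed
    finally show ?thesis using z[OF e] xE[OF _ e] by (auto simp: mcoef_diff cob_zero)
  qed
  ultimately have "x - res_diff koszul_res (Suc i) y = 0" using module_eq_0_iff by blast
  then show ?thesis using y by (intro bexI[of _ y]) auto
qed

lemma subs_0: "subs 0 = {{}}"
  using fin_sub by (auto simp: subs_def)

lemma idx_empty: "idx {} = 0"
  using idx_less[of "{}" 0] by (simp add: subs_0)

lemma koszul_eps: "res_eps koszul_res x = x 0"
  by (simp add: res_eps_def subs_0)

lemma koszul_diff_0: "res_diff koszul_res 0 y 0 = (\<Sum>w\<in>V. y (idx {w}) * var_poly w)"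
  using koszul_diff[of "{}" y] by (simp add: idx_empty ksgn_def mult.commute)

lemma koszul_exact_0:
  fixes x :: "nat \<Rightarrow> ('v, 'k::comm_ring_1) mpol"
  assumes x: "x \<in> koszul_module 0"
  shows "res_eps koszul_res x \<in> aug_ideal V \<longleftrightarrow> (\<exists>y\<in>koszul_module 1. x = res_diff koszul_res 0 y)"
proof
  assume "res_eps koszul_res x \<in> aug_ideal V"
  then obtain c where c: "\<And>v. v \<in> V \<Longrightarrow> c v \<in> polys V" "x 0 = (\<Sum>v\<in>V. c v * var_poly v)"
    by (auto simp: koszul_eps aug_ideal_iff[OF fin_V])
  define y where "y a = (if a < card (subs 1) then c (the_elem (en 1 a)) else 0)" for a
  have "c (the_elem (en 1 a)) \<in> polys V" if a: "a < card (subs 1)" for a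
  proof -
    obtain v where "en 1 a = {v}" using en_props(2)[OF a] card_1_singletonE by blast
    then show ?thesis using c(1) en_props(1)[OF a] by simp
  qed
  then have y: "y \<in> koszul_module 1"
    unfolding res_module_def y_def by simp
  have "y (idx {w}) = c w" if "w \<in> V" for w
    using that idx_less[of "{w}" 1] en_idx[of "{w}"] by (simp add: y_def)
  then have "x 0 = res_diff koszul_res 0 y 0" by (simp add: koszul_diff_0 c(2))
  moreover have "x a = res_diff koszul_res 0 y a" if "a \<noteq> 0" for a
    using that x by (auto simp: res_module_def res_diff_def subs_0)
  ultimately have "x = res_diff koszul_res 0 y" by (intro ext) metis
  then show "\<exists>y\<in>koszul_module 1. x = res_diff koszul_res 0 y" using y by blast
next
  assume "\<exists>y\<in>koszul_module 1. x = res_diff koszul_res 0 y"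
  then obtain y where y: "y \<in> koszul_module 1" "x = res_diff koszul_res 0 y" by blast
  have "y (idx {w}) \<in> polys V" if "w \<in> V" for w
    using y(1) that idx_less[of "{w}" 1] by (auto simp: res_module_def)
  then show "res_eps koszul_res x \<in> aug_ideal V"
    unfolding koszul_eps aug_ideal_iff[OF fin_V] y(2) koszul_diff_0
    by (intro exI[of _ "\<lambda>w. y (idx {w})"]) auto
qed

theorem koszul_resolution:
  "graded_free_resolution V (aug_ideal V) (koszul_res :: ('v, 'k::comm_ring_1) mpol resolution)"
  unfolding graded_free_resolution_def
proof (intro conjI allI impI ballI)
  fix f :: "('v, 'k) mpol" assume f: "f \<in> polys V"
  define x where "x a = (if a = (0::nat) then f else 0)" for a
  have "x \<in> koszul_module 0" using f by (auto simp: res_module_def subs_0 x_def)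
  moreover have "f - res_eps koszul_res x \<in> aug_ideal V"
    using poly_ideal_0[OF poly_ideal_aug] by (simp add: koszul_eps x_def)
  ultimately show "\<exists>x\<in>koszul_module 0. f - res_eps koszul_res x \<in> aug_ideal V" by blast
next
  fix i and x :: "nat \<Rightarrow> ('v, 'k) mpol" assume "x \<in> koszul_module (Suc i)"
  then show "res_diff koszul_res i x = 0 \<longleftrightarrow>
      (\<exists>y\<in>koszul_module (Suc (Suc i)). x = res_diff koszul_res (Suc i) y)"
    using koszul_exact koszul_diff_diff by blast
next
  fix x :: "nat \<Rightarrow> ('v, 'k) mpol" assume "x \<in> koszul_module 0"
  then show "res_eps koszul_res x \<in> aug_ideal V \<longleftrightarrow>
      (\<exists>y\<in>koszul_module 1. x = res_diff koszul_res 0 y)" by (rule koszul_exact_0)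
next
  fix i a c assume "a < res_rank (koszul_res :: ('v, 'k) mpol resolution) i"
    "c < res_rank (koszul_res :: ('v, 'k) mpol resolution) (Suc i)"
  then have ac: "a < card (subs i)" "c < card (subs (Suc i))" by simp_all
  show "(res_mat koszul_res i a c :: ('v, 'k) mpol) \<in> polys V"
    "homog_shift (res_deg (koszul_res :: ('v, 'k) mpol resolution) i a)
       (res_deg (koszul_res :: ('v, 'k) mpol resolution) (Suc i) c) (res_mat koszul_res i a c :: ('v, 'k) mpol)"
    using koszul_mat[OF ac] by (simp_all only: koszul_simps)
qed (simp_all add: subs_0 homog_shift_1)

end

section \<open>Hochster's formula\<close>

lemma res_strand_sum:
  assumes "\<And>t. t \<in> T \<Longrightarrow> f t \<in> res_strand V F i d"
  shows "(\<Sum>t\<in>T. f t) \<in> res_strand V F i d"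
  using assms
proof (induction T rule: infinite_finite_induct)
  case (insert t T)
  then show ?case unfolding sum.insert[OF insert.hyps] by (intro res_strand_add) blast+
qed simp_all

lemma finite_monomials_of_degree:
  assumes "finite V"
  shows "finite {e :: 'v \<Rightarrow>\<^sub>0 nat. keys e \<subseteq> V \<and> monom_deg e = d}" (is "finite ?E")
proof -
  have sub: "lookup ` ?E \<subseteq> {f. \<forall>x. (x \<in> V \<longrightarrow> f x \<in> {..d}) \<and> (x \<notin> V \<longrightarrow> f x = 0)}"
  proof (intro subsetI CollectI allI, elim imageE CollectE conjE)
    fix f x and e :: "'v \<Rightarrow>\<^sub>0 nat"
    assume f: "f = lookup e" and e: "keys e \<subseteq> V" "monom_deg e = d"
    have "x \<in> V \<Longrightarrow> lookup e x \<le> (\<Sum>t\<in>V. lookup e t)"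
      using assms by (intro member_le_sum) auto
    moreover have "x \<notin> V \<Longrightarrow> lookup e x = 0"
      using e(1) by (meson in_keys_iff subsetD)
    ultimately show "(x \<in> V \<longrightarrow> f x \<in> {..d}) \<and> (x \<notin> V \<longrightarrow> f x = 0)"
      using e(2) monom_deg_superset[OF assms e(1)] unfolding f by (cases "x \<in> V") auto
  qed
  have "finite {f :: 'v \<Rightarrow> nat. \<forall>x. (x \<in> V \<longrightarrow> f x \<in> {..d}) \<and> (x \<notin> V \<longrightarrow> f x = 0)}"
    by (rule finite_set_of_finite_funs[OF assms]) simp
  from finite_subset[OF sub this] have "finite (lookup ` ?E)" .
  moreover have "inj_on lookup ?E"
    by (intro inj_onI) (rule poly_mapping_eq_iff[THEN iffD2])
  ultimately show ?thesis by (rule finite_imageD)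
qed

text \<open>In multidegree \<open>e\<close> the Koszul complex with coefficients in the Stanley--Reisner ring is spanned by
  the \<open>S \<subseteq> keys e\<close> for which the support of the complementary monomial is a face.\<close>

definition mult_faces :: "'v set set \<Rightarrow> ('v \<Rightarrow>\<^sub>0 nat) \<Rightarrow> 'v set \<Rightarrow> bool" where
  "mult_faces K e T \<longleftrightarrow> T \<union> {v. lookup e v \<ge> 2} \<in> K"

text \<open>Dividing by the squarefree monomial of \<open>S\<close> lowers each exponent by at most
  one, so a vertex of exponent at least 2 never leaves the support.\<close>

lemma mult_faces_diff:
  assumes "finite S" "S \<subseteq> keys e"
  shows "mult_faces K e (keys e - S) \<longleftrightarrow> keys (e - ind_mon S) \<in> K"
proof -
  have "keys (e - ind_mon S) = (keys e - S) \<union> {v. lookup e v \<ge> 2}"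
  proof (intro set_eqI)
    fix v
    show "v \<in> keys (e - ind_mon S) \<longleftrightarrow>
        v \<in> (keys e - S) \<union> {v. lookup e v \<ge> 2}"
      using assms(1) by (cases "v \<in> S") (auto simp: in_keys_iff lookup_minus lookup_ind_mon)
  qed
  then show ?thesis unfolding mult_faces_def by (simp only:)
qed

context koszul
begin

definition degs :: "nat \<Rightarrow> ('v \<Rightarrow>\<^sub>0 nat) set" where
  "degs d = {e. keys e \<subseteq> V \<and> monom_deg e = d}"

lemma finite_degs: "finite (degs d)"
  unfolding degs_def using fin_V by (rule finite_monomials_of_degree)

lemma degs_keys: "e \<in> degs d \<Longrightarrow> keys e \<subseteq> V"
  by (simp add: degs_def)

lemma monom_deg_minus:
  assumes "finite S" "S \<subseteq> keys e"
  shows "monom_deg (e - ind_mon S) + 2 * card S = monom_deg e"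
  using monom_deg_add[of "e - ind_mon S" "ind_mon S"] ind_mon_diff_add[OF assms] assms
  by (simp add: monom_deg_ind_mon)

lemma mcoef_other_degree:
  fixes x :: "nat \<Rightarrow> ('v, 'k::comm_ring_1) mpol"
  assumes x: "x \<in> koszul_strand i d" and e: "keys e \<subseteq> V" "S \<subseteq> keys e"
    and "card S = i" "monom_deg e \<noteq> d"
  shows "mcoef x e S = 0"
proof (rule ccontr)
  assume "mcoef x e S \<noteq> 0"
  have SV: "S \<subseteq> V" using e by blast
  then have "homog_shift (2 * i) d (x (idx S))"
    using x idx_less[OF SV assms(4)] by (simp add: res_strand_iff)
  then have "monom_deg (e - ind_mon S) + 2 * i = d"
    using \<open>mcoef x e S \<noteq> 0\<close> by (simp add: homog_shift_def mcoef_def in_keys_iff)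
  then show False using monom_deg_minus[OF fin_sub[OF SV] e(2)] assms by simp
qed

lemma asm_strand:
  assumes "E \<subseteq> degs d"
  shows "asm i E z \<in> koszul_strand i d"
proof -
  have fE: "finite E" using assms finite_degs finite_subset by blast
  have "asm i E z \<in> koszul_module i"
    using fE assms degs_keys by (intro asm_module) auto
  moreover have "homog_shift (2 * i) d (asm i E z a)" if a: "a < card (subs i)" for a
    unfolding homog_shift_def
  proof
    fix b assume "b \<in> keys (asm i E z a)"
    then have "b + ind_mon (en i a) \<in> E"
      by (simp add: in_keys_iff lookup_asm[OF fE a] split: if_splits)
    then show "monom_deg b + 2 * i = d"
      using assms en_props[OF a] fin_sub[OF en_props(1)[OF a]]
      by (auto simp: degs_def monom_deg_add monom_deg_ind_mon)
  qed
  ultimately show ?thesis by (simp add: res_strand_def)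
qed

end

locale koszul_complex = koszul V ord for V :: "'v set" and ord +
  fixes K :: "'v set set"
  assumes down: "S \<in> K \<Longrightarrow> T \<subseteq> S \<Longrightarrow> T \<in> K"
begin

abbreviation SR :: "('v, 'k::comm_ring_1) mpol set" where
  "SR \<equiv> sr_ideal V K"

lemma SR_iff: "f \<in> SR \<longleftrightarrow>
    (\<forall>e\<in>keys f. keys e \<subseteq> V \<and> keys e \<notin> K)"
  using fin_V down by (rule sr_ideal_iff)

text \<open>The coefficient of \<open>S\<close> in multidegree \<open>e\<close> sits at the monomial
  \<open>e - ind_mon S\<close>, which dies in the Stanley-Reisner ring unless its support is a face.
  Modulo the ideal only the coefficients selected by \<open>mult_faces\<close> survive.\<close>

lemma in_SR_iff:
  fixes x :: "nat \<Rightarrow> ('v, 'k::comm_ring_1) mpol"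
  assumes x: "x \<in> koszul_strand i d"
  shows "(\<forall>a<card (subs i). x a \<in> SR) \<longleftrightarrow>
     (\<forall>e\<in>degs d. \<forall>S\<subseteq>keys e. mult_faces K e (keys e - S) \<and> card S = i \<longrightarrow> mcoef x e S = 0)"
    (is "?L \<longleftrightarrow> ?R")
proof
  assume L: ?L
  show ?R
  proof (intro ballI allI impI, elim conjE)
    fix e S assume e: "e \<in> degs d" and S: "S \<subseteq> keys e" "card S = i"
      and face: "mult_faces K e (keys e - S)"
    have SV: "S \<subseteq> V" using S degs_keys[OF e] by blast
    have "x (idx S) \<in> SR" using L idx_less[OF SV S(2)] by blast
    moreover have "keys (e - ind_mon S) \<in> K"
      using face mult_faces_diff[OF fin_sub[OF SV] S(1)] by blast
    ultimately have "e - ind_mon S \<notin> keys (x (idx S))"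
      using SR_iff[of "x (idx S)"] by blast
    then show "mcoef x e S = 0" by (simp add: mcoef_def in_keys_iff)
  qed
next
  assume R: ?R
  show ?L
  proof (intro allI impI)
    fix a assume a: "a < card (subs i)"
    define S where "S = en i a"
    have S: "S \<subseteq> V" "card S = i" "finite S" using en_props[OF a] fin_sub by (auto simp: S_def)
    have xa: "x a \<in> polys V" "homog_shift (2 * i) d (x a)"
      using x a by (simp_all add: res_strand_iff)
    have "keys b \<notin> K" if b: "b \<in> keys (x a)" for b
    proof
      assume "keys b \<in> K"
      define e where "e = b + ind_mon S"
      have "keys b \<subseteq> V" "monom_deg b + 2 * i = d"
        using b xa unfolding polys_def homog_shift_def by blast+
      then have e: "e \<in> degs d" "S \<subseteq> keys e" "e - ind_mon S = b"
        using S by (simp_all add: degs_def e_def keys_plus_nat keys_ind_mon monom_deg_add monom_deg_ind_mon)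
      have "mcoef x e S = 0"
        using R[rule_format, OF e(1,2)] S(2) mult_faces_diff[OF S(3) e(2), of K] e(3)
          \<open>keys b \<in> K\<close> by simp
      moreover have "mcoef x e S = lookup (x a) b"
        using lookup_eq_mcoef[OF a, of x b] by (simp add: e_def S_def)
      ultimately show False using b by (simp add: in_keys_iff)
    qed
    then show "x a \<in> SR"
      using SR_iff[of "x a"] xa(1) unfolding polys_def by blast
  qed
qed

lemma koszul_diff_strand:
  assumes "x \<in> res_strand V (koszul_res :: ('v, 'k::comm_ring_1) mpol resolution) (Suc i) d"
  shows "res_diff koszul_res i x \<in> koszul_strand i d"
proof -
  interpret graded_resolution V "aug_ideal V" "koszul_res :: ('v, 'k) mpol resolution"
    by unfold_locales (use koszul_resolution poly_ideal_aug homog_part_aug_ideal[OF fin_V] in auto)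
  show ?thesis using assms by (rule diff_strand)
qed

lemma tensor_cycles_iff:
  fixes x :: "nat \<Rightarrow> ('v, 'k::comm_ring_1) mpol"
  assumes x: "x \<in> koszul_strand i d"
  shows "x \<in> tensor_cycles V SR koszul_res i d \<longleftrightarrow>
    (\<forall>e\<in>degs d. mcoef x e \<in> ccyc ord (keys e) (mult_faces K e) (int i))"
proof (cases i)
  case 0
  then show ?thesis using x by (auto simp: tensor_cycles_def ccyc_def)
next
  case (Suc h)
  have dx: "res_diff koszul_res h x \<in> koszul_strand h d"
    using x unfolding Suc by (rule koszul_diff_strand)
  have "x \<in> tensor_cycles V SR koszul_res i d \<longleftrightarrow> (\<forall>a<card (subs h). res_diff koszul_res h x a \<in> SR)"
    using x by (simp add: tensor_cycles_def Suc)
  also have "\<dots> \<longleftrightarrow> (\<forall>e\<in>degs d. \<forall>S\<subseteq>keys e.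
      mult_faces K e (keys e - S) \<and> card S = h \<longrightarrow> cob ord (keys e) (mcoef x e) S = 0)"
    unfolding in_SR_iff[OF dx] using koszul_diff_coef[OF degs_keys] by metis
  also have "\<dots> \<longleftrightarrow> (\<forall>e\<in>degs d. mcoef x e \<in> ccyc ord (keys e) (mult_faces K e) (int i))"
    by (simp add: ccyc_def Suc)
  finally show ?thesis .
qed

text \<open>Primitives may be chosen separately in each multidegree, because only finitely many
  multidegrees have the given degree and \<open>asm\<close> joins the choices.\<close>

lemma tensor_boundaries_iff:
  fixes x :: "nat \<Rightarrow> ('v, 'k::comm_ring_1) mpol"
  assumes x: "x \<in> koszul_strand i d"
  shows "x \<in> tensor_boundaries V SR koszul_res i d \<longleftrightarrow>
    (\<forall>e\<in>degs d. mcoef x e \<in> cbnd ord (keys e) (mult_faces K e) (int i))"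
proof -
  have key: "(\<forall>a<card (subs i). x a - res_diff koszul_res i y a \<in> SR) \<longleftrightarrow>
     (\<forall>e\<in>degs d. \<forall>S\<subseteq>keys e. mult_faces K e (keys e - S) \<and> card S = i \<longrightarrow>
       mcoef x e S = cob ord (keys e) (mcoef y e) S)"
    if y: "y \<in> koszul_strand (Suc i) d" for y
  proof -
    have "x - res_diff koszul_res i y \<in> koszul_strand i d"
      using x koszul_diff_strand[OF y] by (rule res_strand_diff)
    from in_SR_iff[OF this] show ?thesis
      using koszul_diff_coef[OF degs_keys, where x = y] by (auto simp: mcoef_diff)
  qed
  show ?thesis
  proof
    assume "x \<in> tensor_boundaries V SR koszul_res i d"
    then obtain y where y: "y \<in> koszul_strand (Suc i) d"
      "\<forall>a<card (subs i). x a - res_diff koszul_res i y a \<in> SR"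
      unfolding tensor_boundaries_def by auto
    then show "\<forall>e\<in>degs d. mcoef x e \<in> cbnd ord (keys e) (mult_faces K e) (int i)"
      unfolding key[OF y(1)] cbnd_def by (auto intro!: exI[of _ "mcoef y e" for e])
  next
    assume "\<forall>e\<in>degs d. mcoef x e \<in> cbnd ord (keys e) (mult_faces K e) (int i)"
    then have "\<forall>e. \<exists>z. e \<in> degs d \<longrightarrow> (\<forall>S\<subseteq>keys e.
       mult_faces K e (keys e - S) \<and> int (card S) = int i \<longrightarrow> mcoef x e S = cob ord (keys e) z S)"
      unfolding cbnd_def by blast
    from choice[OF this] obtain z where z: "\<And>e S. \<lbrakk>e \<in> degs d; S \<subseteq> keys e;
       mult_faces K e (keys e - S); card S = i\<rbrakk> \<Longrightarrow> mcoef x e S = cob ord (keys e) (z e) S"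
      by auto
    define y where "y = asm (Suc i) (degs d) z"
    have y: "y \<in> koszul_strand (Suc i) d" unfolding y_def by (rule asm_strand) simp
    have "mcoef x e S = cob ord (keys e) (mcoef y e) S"
      if e: "e \<in> degs d" and S: "S \<subseteq> keys e" "mult_faces K e (keys e - S)" "card S = i" for e S
    proof -
      have "cob ord (keys e) (z e) S = cob ord (keys e) (mcoef y e) S"
      proof (rule cob_cong_insert)
        fix w assume w: "w \<in> keys e - S"
        have "finite S" using S(1) degs_keys[OF e] fin_sub by blast
        then have "card (insert w S) = Suc i" using w S(3) by simp
        then show "z e (insert w S) = mcoef y e (insert w S)"
          unfolding y_def using w S e degs_keys[OF e] by (subst mcoef_asm[OF finite_degs]) auto
      qed
      then show ?thesis using z[OF e S] by simp
    qed
    then have "\<forall>a<card (subs i). x a - res_diff koszul_res i y a \<in> SR" unfolding key[OF y] by blast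
    then show "x \<in> tensor_boundaries V SR koszul_res i d"
      unfolding tensor_boundaries_def using x y by auto
  qed
qed

text \<open>A direct sum decomposition on the level of bases. The basis is naturally indexed by
  pairs of a multidegree and a position; \<open>g\<close> numbers these pairs because
  \<open>free_quot\<close> expects an initial segment of the naturals.\<close>

theorem tensor_free_quot:
  assumes free: "\<And>e. e \<in> degs d \<Longrightarrow>
      cfree TYPE('k::comm_ring_1) ord (keys e) (mult_faces K e) (int i) (N e)"
  shows "free_quot (\<lambda>(c::'k) x a. const_poly c * x a)
     (tensor_cycles V SR koszul_res i d) (tensor_boundaries V SR koszul_res i d) (\<Sum>e\<in>degs d. N e)"
proof -
  let ?cyc = "\<lambda>e. ccyc ord (keys e) (mult_faces K e) (int i) :: ('v set \<Rightarrow> 'k) set"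
  let ?bnd = "\<lambda>e. cbnd ord (keys e) (mult_faces K e) (int i) :: ('v set \<Rightarrow> 'k) set"
  define R where "R e X \<longleftrightarrow> (\<forall>a<N e. X a \<in> ?cyc e) \<and>
     (\<forall>z\<in>?cyc e. \<exists>c. z - (\<Sum>a<N e. (\<lambda>S. c a * X a S)) \<in> ?bnd e) \<and>
     (\<forall>c. (\<Sum>a<N e. (\<lambda>S. c a * X a S)) \<in> ?bnd e \<longrightarrow> (\<forall>a<N e. c a = 0))" for e X
  have "\<forall>e. \<exists>X. e \<in> degs d \<longrightarrow> R e X"
    using free unfolding free_quot_def R_def by simp
  from choice[OF this] obtain X where X: "\<And>e. e \<in> degs d \<Longrightarrow> R e (X e)" by blast
  note X1 = X[unfolded R_def, THEN conjunct1, rule_format]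
  note X2 = X[unfolded R_def, THEN conjunct2, THEN conjunct1, rule_format]
  note X3 = X[unfolded R_def, THEN conjunct2, THEN conjunct2, rule_format]
  define P where "P = Sigma (degs d) (\<lambda>e. {..<N e})"
  have fP: "finite P" and cP: "card P = (\<Sum>e\<in>degs d. N e)"
    unfolding P_def using finite_degs by auto
  obtain g where g: "bij_betw g {..<card P} P"
    using ex_bij_betw_nat_finite[OF fP] by (auto simp: lessThan_atLeast0)
  have gP: "fst (g t) \<in> degs d" "snd (g t) < N (fst (g t))" if "t < card P" for t
  proof -
    have "g t \<in> P" using bij_betwE[OF g] that by simp
    then show "fst (g t) \<in> degs d" "snd (g t) < N (fst (g t))" by (auto simp: P_def)
  qed
  \<comment> \<open>Each basis cycle is concentrated in the one multidegree that its index
    names.\<close>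
  define u where "u t = asm i (degs d) (\<lambda>e. if e = fst (g t) then X e (snd (g t)) else (\<lambda>_. 0))" for t
  have u_str: "u t \<in> koszul_strand i d" for t
    unfolding u_def by (rule asm_strand) simp
  have u_coef: "mcoef (u t) e S = (if e = fst (g t) then X e (snd (g t)) S else 0)"
    if "e \<in> degs d" "S \<subseteq> keys e" "card S = i" for t e S
    unfolding u_def using that degs_keys[OF that(1)] by (subst mcoef_asm[OF finite_degs]) auto
  let ?comb = "\<lambda>c. (\<Sum>t<card P. (\<lambda>a. const_poly (c t) * u t a))"
  have comb_str: "?comb c \<in> koszul_strand i d" for c :: "nat \<Rightarrow> 'k"
  proof -
    have "(\<lambda>a. const_poly (c t) * u t a) \<in> koszul_strand i d" for t
      by (rule res_strand_scale[OF u_str])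
    then show ?thesis by (rule res_strand_sum)
  qed
  define ginv where "ginv = inv_into {..<card P} g"
  have comb_coef: "mcoef (?comb c) e S = (\<Sum>a<N e. (\<lambda>S. c (ginv (e, a)) * X e a S)) S"
    if e: "e \<in> degs d" "S \<subseteq> keys e" "card S = i" for c e S
  proof -
    have "mcoef (?comb c) e S = (\<Sum>t<card P. c (ginv (g t)) * (if e = fst (g t) then X e (snd (g t)) S else 0))"
      using g by (auto simp: mcoef_sum u_coef[OF e] ginv_def bij_betw_inv_into_left intro!: sum.cong)
    also have "\<dots> = (\<Sum>p\<in>P. c (ginv p) * (if e = fst p then X e (snd p) S else 0))"
      by (rule sum.reindex_bij_betw[OF g])
    also have "\<dots> = (\<Sum>e'\<in>degs d. \<Sum>a<N e'. c (ginv (e', a)) * (if e = e' then X e a S else 0))"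
      unfolding P_def using finite_degs by (subst sum.Sigma) (auto simp: case_prod_beta)
    also have "\<dots> = (\<Sum>e'\<in>degs d. if e' = e then (\<Sum>a<N e. c (ginv (e, a)) * X e a S) else 0)"
      by (intro sum.cong) auto
    also have "\<dots> = (\<Sum>a<N e. c (ginv (e, a)) * X e a S)"
      using e finite_degs by simp
    finally show ?thesis by (simp add: sum_fun_apply)
  qed
  have fin_keys: "finite (keys e)" for e :: "'v \<Rightarrow>\<^sub>0 nat" by simp
  show ?thesis unfolding free_quot_def cP[symmetric]
  proof (intro exI[of _ u] conjI allI ballI impI)
    fix t assume t: "t < card P"
    show "u t \<in> tensor_cycles V SR koszul_res i d"
      unfolding tensor_cycles_iff[OF u_str]
    proof
      fix e assume e: "e \<in> degs d"
      have "mcoef (u t) e \<in> ?cyc e \<longleftrightarrow> (if e = fst (g t) then X e (snd (g t)) else (\<lambda>_. 0)) \<in> ?cyc e"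
        using u_coef[OF e] by (intro ccyc_cong) auto
      then show "mcoef (u t) e \<in> ?cyc e"
        using X1[OF gP[OF t]] by (auto simp: ccyc_def cob_zero)
    qed
  next
    fix x :: "nat \<Rightarrow> ('v, 'k) mpol" assume x: "x \<in> tensor_cycles V SR koszul_res i d"
    then have xs: "x \<in> koszul_strand i d" by (simp add: tensor_cycles_def)
    have "\<forall>e. \<exists>c. e \<in> degs d \<longrightarrow> mcoef x e - (\<Sum>a<N e. (\<lambda>S. c a * X e a S)) \<in> ?bnd e"
      using x X2 unfolding tensor_cycles_iff[OF xs] by blast
    from choice[OF this] obtain c where c: "\<And>e. e \<in> degs d \<Longrightarrow>
      mcoef x e - (\<Sum>a<N e. (\<lambda>S. c e a * X e a S)) \<in> ?bnd e" by blast
    define c' where "c' t = c (fst (g t)) (snd (g t))" for t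
    have c': "c' (ginv (e, a)) = c e a" if "e \<in> degs d" "a < N e" for e a
      using that bij_betw_inv_into_right[OF g, of "(e, a)"] by (simp add: c'_def ginv_def P_def)
    have str: "x - ?comb c' \<in> koszul_strand i d"
      using xs comb_str by (rule res_strand_diff)
    have "x - ?comb c' \<in> tensor_boundaries V SR koszul_res i d"
      unfolding tensor_boundaries_iff[OF str]
    proof
      fix e assume e: "e \<in> degs d"
      have "mcoef (x - ?comb c') e \<in> ?bnd e \<longleftrightarrow> mcoef x e - (\<Sum>a<N e. (\<lambda>S. c e a * X e a S)) \<in> ?bnd e"
        using comb_coef[OF e] c'[OF e] by (intro cbnd_cong) (auto simp: mcoef_diff sum_fun_apply)
      then show "mcoef (x - ?comb c') e \<in> ?bnd e" using c[OF e] by simp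
    qed
    then show "\<exists>c. x - ?comb c \<in> tensor_boundaries V SR koszul_res i d" by blast
  next
    fix c :: "nat \<Rightarrow> 'k" and t
    assume b: "?comb c \<in> tensor_boundaries V SR koszul_res i d" and t: "t < card P"
    define e where "e = fst (g t)"
    have e: "e \<in> degs d" "snd (g t) < N e" using gP[OF t] by (auto simp: e_def)
    have "mcoef (?comb c) e \<in> ?bnd e \<longleftrightarrow> (\<Sum>a<N e. (\<lambda>S. c (ginv (e, a)) * X e a S)) \<in> ?bnd e"
      using comb_coef[OF e(1)] by (intro cbnd_cong) auto
    then have "(\<Sum>a<N e. (\<lambda>S. c (ginv (e, a)) * X e a S)) \<in> ?bnd e"
      using b e(1) unfolding tensor_boundaries_iff[OF comb_str] by blast
    then have "c (ginv (e, snd (g t))) = 0" using X3[OF e(1), of "\<lambda>a. c (ginv (e, a))"] e(2) by blast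
    then show "c t = 0" using bij_betw_inv_into_left[OF g, of t] t by (simp add: e_def ginv_def)
  qed
qed

end

text \<open>Hochster's formula for matroids: only squarefree multidegrees contribute, since for the others
  the complex is a cone.\<close>

theorem bigraded_betti_matroid:
  fixes V :: "'v set"
  assumes V: "finite V" and matroid: "\<And>J. J \<subseteq> V \<Longrightarrow> matroid_on J (\<lambda>T. T \<in> K) (rk J)"
    and down: "\<And>S T. S \<in> K \<Longrightarrow> T \<subseteq> S \<Longrightarrow> T \<in> K"
  shows "int (bigraded_betti TYPE('k::idom) V K i (2 * j)) =
     (\<Sum>J | J \<subseteq> V \<and> card J = j \<and> rk J + i = j. \<Sum>T | T \<subseteq> J \<and> T \<in> K. (-1) ^ (rk J + card T))"
proof -
  obtain ord :: "'v \<Rightarrow> nat" where "inj_on ord V"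
    using finite_imp_inj_to_nat_seg[OF V] by blast
  then interpret koszul_complex V ord K
    using V down by unfold_locales auto
  define R where "R J N \<longleftrightarrow> int N = (\<Sum>T | T \<subseteq> J \<and> T \<in> K. (-1) ^ (rk J + card T)) \<and>
    (\<forall>i. cfree TYPE('k) ord J (\<lambda>T. T \<in> K) i (if i + int (rk J) = int (card J) then N else 0))" for J N
  have "\<exists>N. R J N" if J: "J \<subseteq> V" for J
    unfolding R_def using matroid_cohomology_free[OF fin_sub[OF J] inj_on_subset[OF inj_ord J] matroid[OF J]] .
  then have "\<forall>J. \<exists>N. J \<subseteq> V \<longrightarrow> R J N" by simp
  from choice[OF this] obtain M where RM: "\<And>J. J \<subseteq> V \<Longrightarrow> R J (M J)" by blast
  note M = RM[unfolded R_def, THEN conjunct1] RM[unfolded R_def, THEN conjunct2, rule_format]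
  \<comment> \<open>The cohomology of the full subcomplex on \<open>keys e\<close> lives in the
    degree \<open>card (keys e) - rk (keys e)\<close>; the condition says that this degree is
    \<open>i\<close>, written additively to avoid truncation.\<close>
  define N where "N e = (if (\<forall>v. lookup e v < 2) \<and>
      i + rk (keys e) = card (keys e) then M (keys e) else 0)"
    for e :: "'v \<Rightarrow>\<^sub>0 nat"
  have free: "cfree TYPE('k) ord (keys e) (mult_faces K e) (int i) (N e)" if e: "e \<in> degs (2 * j)" for e
  proof (cases "\<forall>v. lookup e v < 2")
    case True
    then have "{v. lookup e v \<ge> 2} = {}" by (auto simp: not_le)
    then have "mult_faces K e = (\<lambda>T. T \<in> K)" by (intro ext) (simp add: mult_faces_def)
    moreover have "(if int i + int (rk (keys e)) = int (card (keys e))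
        then M (keys e) else 0) = N e"
      using True by (simp add: N_def flip: of_nat_add)
    ultimately show ?thesis using M(2)[OF degs_keys[OF e], of "int i"] by simp
  next
    case False
    then obtain v where v: "lookup e v \<ge> 2" by (auto simp: not_less)
    define A where "A = keys e - {v}"
    have A: "keys e = insert v A" "v \<notin> A" "finite A"
      using v by (auto simp: A_def in_keys_iff)
    have inj: "inj_on ord (insert v A)" using inj_on_subset[OF inj_ord degs_keys[OF e]] unfolding A(1) .
    \<comment> \<open>\<open>v\<close> already belongs to the set that \<open>mult_faces\<close>
      adjoins to every \<open>T\<close>.\<close>
    have cone: "mult_faces K e (insert v T) \<longleftrightarrow> mult_faces K e T" for T
      using v by (simp add: mult_faces_def insert_absorb)
    have "cfree TYPE('k) ord (insert v A) (mult_faces K e) (int i) 0"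
      using A(3) inj A(2) cone by (rule cfree_cone)
    moreover have "N e = 0" unfolding N_def by (rule if_not_P) (use False in blast)
    ultimately show ?thesis unfolding A(1) by simp
  qed
  have "bigraded_betti TYPE('k) V K i (2 * j) =
     tor_rank V (SR :: ('v, 'k) mpol set) (aug_ideal V) i (2 * j)"
    by (simp add: bigraded_betti_def)
  also have "\<dots> = quotient_rank (\<lambda>(c::'k) x a. const_poly c * x a)
     (tensor_cycles V SR koszul_res i (2 * j)) (tensor_boundaries V SR koszul_res i (2 * j))"
    by (rule tor_rank_eq[OF koszul_resolution poly_ideal_sr poly_ideal_aug homog_part_aug_ideal[OF V]])
  also have "\<dots> = (\<Sum>e\<in>degs (2 * j). N e)"
    by (rule quotient_rank_eqI[OF module_const_poly tensor_boundaries_module_subspace[OF poly_ideal_sr]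
          tensor_free_quot[OF free]])
  also have "\<dots> = (\<Sum>e | e \<in> degs (2 * j) \<and> (\<forall>v. lookup e v < 2). N e)"
    using finite_degs by (intro sum.mono_neutral_right) (auto simp: N_def)
  \<comment> \<open>Squarefree exponents correspond to their supports, and the factor 2 in the
    degree turns internal degree \<open>2 * j\<close> into size \<open>j\<close>.\<close>
  also have "\<dots> = (\<Sum>J | J \<subseteq> V \<and> card J = j. if rk J + i = j then M J else 0)"
  proof (rule sum.reindex_bij_witness[where j = keys and i = ind_mon])
    fix e assume e: "e \<in> {e. e \<in> degs (2 * j) \<and> (\<forall>v. lookup e v < 2)}"
    show ind: "ind_mon (keys e) = e"
    proof (rule poly_mapping_eqI)
      fix v
      have "lookup e v < 2" using e by blast
      then show "lookup (ind_mon (keys e)) v = lookup e v"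
        by (cases "v \<in> keys e") (auto simp: lookup_ind_mon in_keys_iff)
    qed
    have "monom_deg e = 2 * card (keys e)"
      by (subst ind[symmetric]) (simp add: monom_deg_ind_mon)
    then have c: "card (keys e) = j" using e by (simp add: degs_def)
    then show "keys e \<in> {J. J \<subseteq> V \<and> card J = j}" using e degs_keys by blast
    show "(if rk (keys e) + i = j then M (keys e) else 0) = N e"
      using e c by (simp add: N_def add.commute)
  next
    fix J assume J: "J \<in> {J. J \<subseteq> V \<and> card J = j}"
    then have fJ: "finite J" using fin_sub by blast
    show "keys (ind_mon J) = J" using fJ by (rule keys_ind_mon)
    show "ind_mon J \<in> {e. e \<in> degs (2 * j) \<and> (\<forall>v. lookup e v < 2)}"
      using J fJ by (simp add: degs_def keys_ind_mon monom_deg_ind_mon lookup_ind_mon)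
  qed
  also have "\<dots> = (\<Sum>J | J \<subseteq> V \<and> card J = j \<and> rk J + i = j. M J)"
    using V by (intro sum.mono_neutral_cong_right) auto
  finally show ?thesis using M(1) by (auto intro!: sum.cong)
qed

section \<open>Lines in a vector space over a finite field\<close>

type_synonym 'f vecs = "(nat \<Rightarrow> 'f) set"

definition lines_in :: "('f::field) vecs \<Rightarrow> 'f vecs set" where
  "lines_in W = {L. L \<subseteq> W \<and> vec.subspace L \<and> vec.dim L = 1}"

lemma lines_eq_lines_in: "lines n = lines_in (coord_space n)"
  by (simp add: lines_def lines_in_def)

text \<open>One chosen spanning vector per line turns questions about sets of lines into linear
  algebra of vectors; the choice is injective since a line is recovered as a span.\<close>

definition gen :: "('f::field) vecs \<Rightarrow> nat \<Rightarrow> 'f" where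
  "gen L = (SOME v. v \<in> L \<and> v \<noteq> 0)"

lemma line_eq_span:
  assumes L: "vec.subspace L" "vec.dim L = 1" and v: "v \<in> L" "v \<noteq> 0"
  shows "vec.span {v} = L"
proof -
  obtain B where B: "B \<subseteq> L" "vec.independent B" "L \<subseteq> vec.span B" "card B = 1"
    using vec.basis_exists[of L] L(2) by metis
  obtain b where b: "B = {b}" using B(4) card_1_singletonE by blast
  have Lb: "L = vec.span {b}" using B b L(1) vec.span_subspace by blast
  then obtain c where c: "v = vscale c b" using v(1) by (auto simp: vec.span_singleton)
  have "c \<noteq> 0" using v(2) c by auto
  then have "b = vscale (inverse c) v" using c by simp
  then have "b \<in> vec.span {v}" by (auto simp: vec.span_singleton)
  then have "L \<subseteq> vec.span {v}" unfolding Lb by (intro vec.span_minimal) auto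
  moreover have "vec.span {v} \<subseteq> L" using v(1) L(1) by (intro vec.span_minimal) auto
  ultimately show ?thesis by blast
qed

lemma line_gen:
  assumes "vec.subspace L" "vec.dim L = 1"
  shows "gen L \<in> L" "gen L \<noteq> 0" "vec.span {gen L} = L"
proof -
  have "\<exists>v. v \<in> L \<and> v \<noteq> 0"
  proof (rule ccontr)
    assume "\<not> ?thesis"
    then have "vec.dim L \<le> card ({} :: (nat \<Rightarrow> 'a) set)" by (intro vec.dim_le_card) auto
    then show False using assms(2) by simp
  qed
  then have "gen L \<in> L \<and> gen L \<noteq> 0" unfolding gen_def by (rule someI_ex)
  then show "gen L \<in> L" "gen L \<noteq> 0" "vec.span {gen L} = L" using line_eq_span assms by auto
qed

lemma lines_in_gen:
  assumes "L \<in> lines_in W"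
  shows "gen L \<in> L" "gen L \<noteq> 0" "vec.span {gen L} = L" "gen L \<in> W"
  using assms line_gen[of L] by (auto simp: lines_in_def)

lemma inj_on_gen: "inj_on gen (lines_in W)"
  by (rule inj_onI) (metis lines_in_gen(3))

lemma span_Union_lines:
  assumes "J \<subseteq> lines_in W"
  shows "vec.span (\<Union>J) = vec.span (gen ` J)"
proof
  have "\<Union>J \<subseteq> vec.span (gen ` J)"
  proof
    fix x assume "x \<in> \<Union>J"
    then obtain L where L: "L \<in> J" "x \<in> L" by blast
    then have "x \<in> vec.span {gen L}" using assms lines_in_gen(3) by blast
    then show "x \<in> vec.span (gen ` J)" using vec.span_mono[of "{gen L}" "gen ` J"] L by blast
  qed
  then show "vec.span (\<Union>J) \<subseteq> vec.span (gen ` J)" by (rule vec.span_minimal) simp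
  have "gen ` J \<subseteq> \<Union>J" using assms lines_in_gen(1) by blast
  then show "vec.span (gen ` J) \<subseteq> vec.span (\<Union>J)" by (rule vec.span_mono)
qed

lemma line_in_span_iff:
  assumes "L \<in> lines_in W"
  shows "L \<subseteq> vec.span X \<longleftrightarrow> gen L \<in> vec.span X"
proof
  assume "gen L \<in> vec.span X"
  then have "vec.span {gen L} \<subseteq> vec.span X" by (intro vec.span_minimal) auto
  then show "L \<subseteq> vec.span X" using lines_in_gen(3)[OF assms] by simp
qed (use lines_in_gen(1)[OF assms] in blast)

text \<open>The part of \<open>line_complex\<close> that does not mention the ambient space, so that
  a single predicate serves all subspaces.\<close>

definition indep_lines :: "('f::field) vecs set \<Rightarrow> bool" where
  "indep_lines \<sigma> \<longleftrightarrow> finite \<sigma> \<and> vec.dim (vec.span (\<Union>\<sigma>)) = card \<sigma>"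

lemma line_complex_eq: "line_complex n = {\<sigma>. \<sigma> \<subseteq> lines_in (coord_space n) \<and> indep_lines \<sigma>}"
  by (auto simp: line_complex_def lines_eq_lines_in indep_lines_def)

lemma independent_if_dim_eq_card:
  assumes "finite B" "vec.dim (B :: ('f::field) vecs) = card B"
  shows "vec.independent B"
proof
  assume "vec.dependent B"
  then obtain b where b: "b \<in> B" "b \<in> vec.span (B - {b})" unfolding vec.dependent_def by blast
  then have "B \<subseteq> vec.span (B - {b})"
    by (metis DiffI singletonD subsetI vec.span_base)
  then have "vec.dim B \<le> card (B - {b})" using assms by (intro vec.dim_le_card) auto
  then show False using assms card_Diff1_less[OF assms(1) b(1)] by simp
qed

lemma indep_lines_iff:
  assumes "\<sigma> \<subseteq> lines_in W"
  shows "indep_lines \<sigma> \<longleftrightarrow> finite \<sigma> \<and> vec.independent (gen ` \<sigma>)"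
proof -
  have c: "card (gen ` \<sigma>) = card \<sigma>" using inj_on_subset[OF inj_on_gen assms] by (rule card_image)
  have "vec.dim (vec.span (\<Union>\<sigma>)) = vec.dim (gen ` \<sigma>)" unfolding span_Union_lines[OF assms] by simp
  then show ?thesis unfolding indep_lines_def
    using c independent_if_dim_eq_card[of "gen ` \<sigma>"] vec.dim_eq_card_independent[of "gen ` \<sigma>"] by auto
qed

text \<open>The step that makes independent sets countable: the possible extensions are the lines
  outside the span, and their number depends only on the size of \<open>\<sigma>\<close>.\<close>

lemma indep_lines_insert_iff:
  assumes "\<sigma> \<subseteq> lines_in W" "L \<in> lines_in W" "indep_lines \<sigma>"
  shows "L \<notin> \<sigma> \<and> indep_lines (insert L \<sigma>) \<longleftrightarrow> L \<notin> lines_in (vec.span (\<Union>\<sigma>))"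
proof -
  have ins: "insert L \<sigma> \<subseteq> lines_in W" using assms by blast
  have \<sigma>: "finite \<sigma>" "vec.independent (gen ` \<sigma>)" using assms(1,3) by (auto simp: indep_lines_iff)
  have "L \<in> lines_in (vec.span (\<Union>\<sigma>)) \<longleftrightarrow> gen L \<in> vec.span (gen ` \<sigma>)"
    using assms(2) line_in_span_iff[OF assms(2)] span_Union_lines[OF assms(1)] by (auto simp: lines_in_def)
  moreover have "L \<in> \<sigma> \<longleftrightarrow> gen L \<in> gen ` \<sigma>"
    using inj_on_image_mem_iff[OF inj_on_gen assms(2,1)] by simp
  moreover have "gen L \<in> gen ` \<sigma> \<Longrightarrow> gen L \<in> vec.span (gen ` \<sigma>)" by (rule vec.span_base)
  ultimately show ?thesis
    unfolding indep_lines_iff[OF ins] using \<sigma> by (auto simp: vec.independent_insert)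
qed

lemma indep_lines_subset:
  assumes "\<sigma> \<subseteq> lines_in W" "indep_lines \<sigma>" "\<tau> \<subseteq> \<sigma>"
  shows "indep_lines \<tau>"
proof -
  have "\<tau> \<subseteq> lines_in W" using assms by blast
  moreover have "finite \<tau>" "vec.independent (gen ` \<sigma>)" "gen ` \<tau> \<subseteq> gen ` \<sigma>"
    using assms indep_lines_iff[OF assms(1)] finite_subset by blast+
  ultimately show ?thesis using indep_lines_iff vec.independent_mono by blast
qed

definition line_rank :: "('f::field) vecs set \<Rightarrow> nat" where
  "line_rank J = vec.dim (vec.span (\<Union>J))"

lemma line_rank_indep: "indep_lines J \<Longrightarrow> line_rank J = card J"
  by (simp add: indep_lines_def line_rank_def)

text \<open>Steinitz exchange for the vectors \<open>gen\<close>: if no line of \<open>U\<close>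
  extends \<open>T\<close>, then all of \<open>U\<close> lies in the span of \<open>T\<close>, which
  bounds the size of \<open>U\<close> by that of \<open>T\<close>.\<close>

lemma line_matroid:
  assumes J: "J \<subseteq> lines_in W" "finite J"
  shows "matroid_on J indep_lines (line_rank J)"
proof -
  have iff: "indep_lines T \<longleftrightarrow> vec.independent (gen ` T)" if "T \<subseteq> J" for T
    using that J indep_lines_iff[of T W] finite_subset by blast
  have inj: "inj_on gen J" using inj_on_subset[OF inj_on_gen J(1)] .
  have card: "card (gen ` T) = card T" if "T \<subseteq> J" for T
    using inj_on_subset[OF inj that] by (rule card_image)
  obtain B where B: "B \<subseteq> gen ` J" "vec.independent B" "gen ` J \<subseteq> vec.span B"
    using vec.maximal_independent_subset[of "gen ` J"] by blast
  have fB: "finite B" using B(1) J(2) finite_surj by blast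
  have "card B = vec.dim (gen ` J)" using B by (intro vec.basis_card_eq_dim)
  then have rk: "line_rank J = card B" unfolding line_rank_def span_Union_lines[OF J(1)] by simp
  show ?thesis unfolding matroid_on_def
  proof (intro conjI allI impI)
    fix T U assume "T \<subseteq> J" "indep_lines T" "U \<subseteq> T"
    then show "indep_lines U" using indep_lines_subset J by blast
  next
    fix T U assume TU: "T \<subseteq> J" "U \<subseteq> J" "indep_lines T \<and> indep_lines U \<and> card T < card U"
    show "\<exists>x\<in>U - T. indep_lines (insert x T)"
    proof (rule ccontr)
      assume no: "\<not> (\<exists>x\<in>U - T. indep_lines (insert x T))"
      have "gen ` U \<subseteq> vec.span (gen ` T)"
      proof
        fix y assume "y \<in> gen ` U"
        then obtain x where x: "x \<in> U" "y = gen x" by blast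
        show "y \<in> vec.span (gen ` T)"
        proof (cases "x \<in> T")
          case True
          then show ?thesis using x by (auto intro: vec.span_base)
        next
          case False
          then have "\<not> vec.independent (insert (gen x) (gen ` T))"
            using no x TU iff[of "insert x T"] by auto
          then show ?thesis using TU iff x(2) vec.independent_insertI by blast
        qed
      qed
      moreover have "finite (gen ` T)" "vec.independent (gen ` U)"
        using TU J(2) iff finite_subset by blast+
      ultimately have "card (gen ` U) \<le> card (gen ` T)" using vec.independent_span_bound by blast
      then show False using TU card by simp
    qed
  next
    obtain T where T: "T \<subseteq> J" "B = gen ` T" using B(1) subset_imageE by metis
    then show "\<exists>T\<subseteq>J. indep_lines T \<and> card T = line_rank J"
      using B(2) iff card rk by auto
  next
    fix T assume "T \<subseteq> J" "indep_lines T"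
    then have "vec.independent (gen ` T)" "gen ` T \<subseteq> vec.span B" using iff B(3) by auto
    then have "card (gen ` T) \<le> card B" using vec.independent_span_bound[OF fB] by blast
    then show "card T \<le> line_rank J" using card[OF \<open>T \<subseteq> J\<close>] rk by simp
  qed
qed

section \<open>Cardinality and dimension over a finite field\<close>

lemma card_span_independent:
  assumes "finite B" "vec.independent (B :: ('f::field) vecs)" "finite (UNIV :: 'f set)"
  shows "card (vec.span B) = card (UNIV :: 'f set) ^ card B \<and> finite (vec.span B)"
  using assms(1,2)
proof (induction B rule: finite_induct)
  case empty
  then show ?case by simp
next
  case (insert b B)
  have ind: "vec.independent B" "b \<notin> vec.span B" using insert by (auto simp: vec.independent_insert)
  then have IH: "card (vec.span B) = card (UNIV :: 'f set) ^ card B" "finite (vec.span B)" using insert.IH by auto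
  have "bij_betw (\<lambda>(c, x). vscale c b + x) (UNIV \<times> vec.span B) (vec.span (insert b B))"
    unfolding bij_betw_def
  proof
    show "inj_on (\<lambda>(c, x). vscale c b + x) (UNIV \<times> vec.span B)"
    proof (intro inj_onI, clarify)
      fix c x c' x' assume x: "x \<in> vec.span B" "x' \<in> vec.span B" "vscale c b + x = vscale c' b + x'"
      have "vscale (c - c') b = x' - x" using x(3) by (simp add: vec.scale_left_diff_distrib algebra_simps)
      then have m: "vscale (c - c') b \<in> vec.span B" using x by (metis vec.span_diff)
      have "c = c'"
      proof (rule ccontr)
        assume "c \<noteq> c'"
        then have "b = vscale (inverse (c - c')) (vscale (c - c') b)" by simp
        then show False using vec.span_scale[OF m] ind(2) by metis
      qed
      then show "c = c' \<and> x = x'" using x(3) by simp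
    qed
    show "(\<lambda>(c, x). vscale c b + x) ` (UNIV \<times> vec.span B) = vec.span (insert b B)"
    proof
      show "(\<lambda>(c, x). vscale c b + x) ` (UNIV \<times> vec.span B) \<subseteq> vec.span (insert b B)"
        using vec.span_mono[of B "insert b B"]
        by (auto intro!: vec.span_add vec.span_scale intro: vec.span_base)
      show "vec.span (insert b B) \<subseteq> (\<lambda>(c, x). vscale c b + x) ` (UNIV \<times> vec.span B)"
      proof
        fix y assume "y \<in> vec.span (insert b B)"
        then obtain k where "y - vscale k b \<in> vec.span B" using vec.span_breakdown_eq by blast
        then show "y \<in> (\<lambda>(c, x). vscale c b + x) ` (UNIV \<times> vec.span B)"
          by (intro image_eqI[of _ _ "(k, y - vscale k b)"]) auto
      qed
    qed
  qed
  then have "card (vec.span (insert b B)) = card ((UNIV :: 'f set) \<times> vec.span B)"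
    "finite (vec.span (insert b B)) \<longleftrightarrow> finite ((UNIV :: 'f set) \<times> vec.span B)"
    using bij_betw_same_card bij_betw_finite by metis+
  then show ?case using IH insert.hyps assms(3) by (simp add: card_cartesian_product)
qed

lemma card_subspace:
  assumes "vec.subspace W" "finite (W :: ('f::field) vecs)" "finite (UNIV :: 'f set)"
  shows "card W = card (UNIV :: 'f set) ^ vec.dim W"
proof -
  obtain B where B: "B \<subseteq> W" "vec.independent B" "W \<subseteq> vec.span B" "card B = vec.dim W"
    using vec.basis_exists by blast
  have "W = vec.span B" using B assms(1) vec.span_subspace by blast
  then show ?thesis using card_span_independent[OF _ B(2) assms(3)] B assms(2) finite_subset by metis
qed

lemma card_coord_space:
  assumes "finite (UNIV :: 'f::field set)"
  shows "finite (coord_space n :: 'f vecs) \<and> card (coord_space n :: 'f vecs) = card (UNIV :: 'f set) ^ n"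
proof (induction n)
  case 0
  have "coord_space 0 = {0 :: nat \<Rightarrow> 'f}" by (auto simp: coord_space_def fun_eq_iff)
  then show ?case by simp
next
  case (Suc n)
  have "bij_betw (\<lambda>(c, x). x(n := c)) (UNIV \<times> coord_space n) (coord_space (Suc n) :: 'f vecs)"
    by (rule bij_betw_byWitness[where f' = "\<lambda>x. (x n, x(n := 0))"])
      (auto simp: coord_space_def Suc_le_eq fun_eq_iff)
  then have "card (coord_space (Suc n) :: 'f vecs) = card ((UNIV :: 'f set) \<times> (coord_space n :: 'f vecs))"
    "finite (coord_space (Suc n) :: 'f vecs) \<longleftrightarrow> finite ((UNIV :: 'f set) \<times> (coord_space n :: 'f vecs))"
    using bij_betw_same_card bij_betw_finite by metis+
  then show ?case using Suc assms by (simp add: card_cartesian_product)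
qed

lemma subspace_coord_space: "vec.subspace (coord_space n)"
  by (auto simp: vec.subspace_def coord_space_def vscale_def)

text \<open>The dimension is read off from the number of vectors, without exhibiting the standard
  basis.\<close>

lemma dim_coord_space:
  assumes "finite (UNIV :: 'f::field set)" "card (UNIV :: 'f set) \<ge> 2"
  shows "vec.dim (coord_space n :: 'f vecs) = n"
proof -
  have "card (UNIV :: 'f set) ^ vec.dim (coord_space n :: 'f vecs) = card (UNIV :: 'f set) ^ n"
    using card_coord_space[OF assms(1), of n] card_subspace[OF subspace_coord_space _ assms(1), of n] by simp
  then show ?thesis using assms(2) by (subst (asm) power_inject_exp) auto
qed

section \<open>Counting\<close>

definition indep_sets :: "('f::field) vecs \<Rightarrow> nat \<Rightarrow> 'f vecs set set" where
  "indep_sets W k = {\<sigma>. \<sigma> \<subseteq> lines_in W \<and> indep_lines \<sigma> \<and> card \<sigma> = k}"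

definition subspaces :: "('f::field) vecs \<Rightarrow> nat \<Rightarrow> 'f vecs set" where
  "subspaces W k = {U. U \<subseteq> W \<and> vec.subspace U \<and> vec.dim U = k}"

definition ranked_sets :: "('f::field) vecs \<Rightarrow> nat \<Rightarrow> nat \<Rightarrow> 'f vecs set set" where
  "ranked_sets W j s = {J. J \<subseteq> lines_in W \<and> card J = j \<and> line_rank J = s}"

definition euler_sum :: "('f::field) vecs \<Rightarrow> nat \<Rightarrow> int" where
  "euler_sum W j = (\<Sum>J | J \<subseteq> lines_in W \<and> card J = j. \<Sum>T | T \<subseteq> J \<and> indep_lines T. (-1) ^ card T)"

text \<open>For a coordinate space and \<open>s = j - i\<close> this is the Betti number in bidegree
  \<open>(-i, 2j)\<close>. Allowing any \<open>W\<close> makes sums over subspaces and induction on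
  the dimension possible.\<close>

definition rank_sum :: "('f::field) vecs \<Rightarrow> nat \<Rightarrow> nat \<Rightarrow> int" where
  "rank_sum W j s = (\<Sum>J\<in>ranked_sets W j s. \<Sum>T | T \<subseteq> J \<and> indep_lines T. (-1) ^ (s + card T))"

lemma lines_in_mono: "U \<subseteq> W \<Longrightarrow> lines_in U \<subseteq> lines_in W"
  by (auto simp: lines_in_def)

lemma finite_lines_in: "finite W \<Longrightarrow> finite (lines_in W)"
  by (rule finite_subset[of _ "Pow W"]) (auto simp: lines_in_def)

lemma finite_ranked_sets: "finite W \<Longrightarrow> finite (ranked_sets W j s)"
  by (rule finite_subset[of _ "Pow (lines_in W)"]) (auto simp: ranked_sets_def finite_lines_in)

lemma finite_subspaces: "finite W \<Longrightarrow> finite (subspaces W k)"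
  by (rule finite_subset[of _ "Pow W"]) (auto simp: subspaces_def)

lemma span_lines_subset:
  assumes "J \<subseteq> lines_in W" "vec.subspace W"
  shows "vec.span (\<Union>J) \<subseteq> W"
  using assms by (intro vec.span_minimal) (auto simp: lines_in_def)

lemma indep_sets_eq_ranked: "finite W \<Longrightarrow> indep_sets W k = ranked_sets W k k"
  using finite_subset[OF _ finite_lines_in]
  by (auto simp: indep_sets_def ranked_sets_def indep_lines_def line_rank_def)

lemma matroid_on_cong:
  assumes "matroid_on A P r" "\<And>T. T \<subseteq> A \<Longrightarrow> P T \<longleftrightarrow> Q T"
  shows "matroid_on A Q r"
  unfolding matroid_on_def
proof (intro conjI allI impI)
  fix T U assume "T \<subseteq> A" "Q T" "U \<subseteq> T"
  then have "P U" using assms(1)[unfolded matroid_on_def, THEN conjunct1] assms(2)[of T] by simp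
  then show "Q U" using assms(2) \<open>U \<subseteq> T\<close> \<open>T \<subseteq> A\<close> by blast
next
  fix T U assume TU: "T \<subseteq> A" "U \<subseteq> A" "Q T \<and> Q U \<and> card T < card U"
  then obtain x where "x \<in> U - T" "P (insert x T)"
    using assms(1)[unfolded matroid_on_def, THEN conjunct2, THEN conjunct1] assms(2)[of T] assms(2)[of U]
    by meson
  then show "\<exists>x\<in>U - T. Q (insert x T)" using assms(2)[of "insert x T"] TU by blast
qed (use assms in \<open>auto simp: matroid_on_def\<close>)

locale line_counting =
  fixes p :: nat and field_type :: "'f::field itself"
  assumes p_ge_2: "p \<ge> 2" and card_field: "card (UNIV :: 'f set) = p"
begin

lemma finite_field: "finite (UNIV :: 'f set)"
  using p_ge_2 card_field by (intro card_ge_0_finite) simp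

lemma card_subspace_p: "vec.subspace W \<Longrightarrow> finite (W :: 'f vecs) \<Longrightarrow> card W = p ^ vec.dim W"
  using card_subspace[OF _ _ finite_field] card_field by simp

lemma finite_coord_space: "finite (coord_space n :: 'f vecs)"
  using card_coord_space[OF finite_field] by blast

lemma dim_coord: "vec.dim (coord_space n :: 'f vecs) = n"
  using dim_coord_space[OF finite_field] card_field p_ge_2 by simp

lemma dim_le_of_subset:
  assumes "U \<subseteq> W" "vec.subspace U" "vec.subspace W" "finite (W :: 'f vecs)"
  shows "vec.dim U \<le> vec.dim W"
proof -
  have "p ^ vec.dim U \<le> p ^ vec.dim W"
    using card_mono[OF assms(4,1)] card_subspace_p assms finite_subset[OF assms(1,4)] by simp
  then show ?thesis using p_ge_2 by (subst (asm) power_increasing_iff) auto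
qed

lemma subspace_eqI:
  assumes "U \<subseteq> W" "vec.subspace U" "vec.subspace W" "finite (W :: 'f vecs)" "vec.dim U = vec.dim W"
  shows "U = W"
  using card_subspace_p[OF assms(2)] card_subspace_p[OF assms(3,4)] assms finite_subset[OF assms(1,4)]
  by (intro card_subset_eq) auto

text \<open>The lines partition the non-zero vectors into classes of size
  \<open>p - 1\<close>.\<close>

lemma card_lines_in:
  assumes W: "vec.subspace W" "finite (W :: 'f vecs)"
  shows "card (lines_in W) * (p - 1) = p ^ vec.dim W - 1"
proof -
  have L: "vec.subspace L" "vec.dim L = 1" "finite L" "L \<subseteq> W" if "L \<in> lines_in W" for L
    using that W(2) finite_subset by (auto simp: lines_in_def)
  have c: "card (L - {0}) = p - 1" if "L \<in> lines_in W" for L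
    using card_subspace_p[OF L(1,3)[OF that]] L(2)[OF that] vec.subspace_0[OF L(1)[OF that]] L(3)[OF that]
    by (simp add: card_Diff_singleton)
  have "W - {0} = (\<Union>L\<in>lines_in W. L - {0})"
  proof
    show "W - {0} \<subseteq> (\<Union>L\<in>lines_in W. L - {0})"
    proof
      fix v assume v: "v \<in> W - {0}"
      then have "vec.independent {v}" by (simp add: vec.dependent_single)
      then have "vec.dim (vec.span {v}) = 1" using vec.dim_span_eq_card_independent[of "{v}"] by simp
      moreover have "vec.span {v} \<subseteq> W" using v W(1) by (intro vec.span_minimal) auto
      ultimately have "vec.span {v} \<in> lines_in W" by (simp add: lines_in_def)
      moreover have "v \<in> vec.span {v} - {0}" using v by (simp add: vec.span_base)
      ultimately show "v \<in> (\<Union>L\<in>lines_in W. L - {0})" by blast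
    qed
  qed (use L(4) in blast)
  moreover have "card (\<Union>L\<in>lines_in W. L - {0}) = (\<Sum>L\<in>lines_in W. card (L - {0}))"
  proof (rule card_UN_disjoint)
    show "\<forall>L\<in>lines_in W. \<forall>L'\<in>lines_in W. L \<noteq> L' \<longrightarrow> (L - {0}) \<inter> (L' - {0}) = {}"
    proof (intro ballI impI)
      fix L L' assume LL: "L \<in> lines_in W" "L' \<in> lines_in W" "L \<noteq> L'"
      show "(L - {0}) \<inter> (L' - {0}) = {}"
        using line_eq_span[OF L(1,2)[OF LL(1)]] line_eq_span[OF L(1,2)[OF LL(2)]] LL(3) by blast
    qed
  qed (use finite_lines_in[OF W(2)] L(3) in auto)
  ultimately have "card (W - {0}) = card (lines_in W) * (p - 1)" using c by simp
  then show ?thesis using card_subspace_p[OF W] vec.subspace_0[OF W(1)] W(2)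
    by (simp add: card_Diff_singleton)
qed

lemma card_lines_in_rat:
  assumes W: "vec.subspace W" "finite (W :: 'f vecs)"
  shows "(of_nat (card (lines_in W)) :: rat) * (of_nat p - 1) = of_nat p ^ vec.dim W - 1"
proof -
  have "(of_nat (card (lines_in W) * (p - 1)) :: rat) = of_nat (p ^ vec.dim W - 1)"
    using card_lines_in[OF W] by simp
  then show ?thesis using p_ge_2 by (simp add: of_nat_diff)
qed

text \<open>Double counting of pairs of an independent set of size \<open>Suc k\<close> and one of
  its lines. Each set has \<open>Suc k\<close> lines; removing one leaves a set whose span has
  dimension \<open>k\<close>, and the removed line is any of the lines outside this span. The factor
  \<open>of_nat p - 1\<close> clears the denominator in the number of lines.\<close>

lemma indep_sets_Suc:
  assumes W: "vec.subspace W" "finite (W :: 'f vecs)"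
  shows "of_nat (Suc k) * (of_nat p - 1) * (of_nat (card (indep_sets W (Suc k))) :: rat) =
     of_nat (card (indep_sets W k)) * (of_nat p ^ vec.dim W - of_nat p ^ k)"
proof -
  have fI: "finite (indep_sets W k)" for k
    using finite_ranked_sets[OF W(2)] indep_sets_eq_ranked[OF W(2)] by metis
  let ?A = "Sigma (indep_sets W (Suc k)) (\<lambda>\<tau>. \<tau>)"
  let ?B = "Sigma (indep_sets W k) (\<lambda>\<sigma>. lines_in W - lines_in (vec.span (\<Union>\<sigma>)))"
  have fin: "finite \<sigma>" if "\<sigma> \<subseteq> lines_in W" for \<sigma>
    using that finite_lines_in[OF W(2)] finite_subset by blast
  have "bij_betw (\<lambda>(\<tau>, L). (\<tau> - {L}, L)) ?A ?B"
  proof (rule bij_betw_byWitness[where f' = "\<lambda>(\<sigma>, L). (insert L \<sigma>, L)"])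
    show "\<forall>x\<in>?A. (\<lambda>(\<sigma>, L). (insert L \<sigma>, L)) ((\<lambda>(\<tau>, L). (\<tau> - {L}, L)) x) = x" by auto
    have notin: "L \<notin> \<sigma> \<and> indep_lines (insert L \<sigma>)"
      if "\<sigma> \<in> indep_sets W k" "L \<in> lines_in W - lines_in (vec.span (\<Union>\<sigma>))" for \<sigma> L
      using that indep_lines_insert_iff[of \<sigma> W L] by (auto simp: indep_sets_def)
    then show "\<forall>x\<in>?B. (\<lambda>(\<tau>, L). (\<tau> - {L}, L)) ((\<lambda>(\<sigma>, L). (insert L \<sigma>, L)) x) = x" by auto
    show "(\<lambda>(\<sigma>, L). (insert L \<sigma>, L)) ` ?B \<subseteq> ?A"
    proof (rule image_subsetI)
      fix x assume "x \<in> ?B"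
      then obtain \<sigma> L where x: "x = (\<sigma>, L)" and
        \<sigma>: "\<sigma> \<in> indep_sets W k" "L \<in> lines_in W" "L \<notin> lines_in (vec.span (\<Union>\<sigma>))" by blast
      then have "L \<notin> \<sigma>" "indep_lines (insert L \<sigma>)" using notin by auto
      then have "insert L \<sigma> \<in> indep_sets W (Suc k)"
        using \<sigma> fin[of \<sigma>] by (simp add: indep_sets_def)
      then show "(\<lambda>(\<sigma>, L). (insert L \<sigma>, L)) x \<in> ?A" by (simp add: x)
    qed
    show "(\<lambda>(\<tau>, L). (\<tau> - {L}, L)) ` ?A \<subseteq> ?B"
    proof (rule image_subsetI)
      fix x assume "x \<in> ?A"
      then obtain \<tau> L where x: "x = (\<tau>, L)" and \<tau>: "\<tau> \<in> indep_sets W (Suc k)" "L \<in> \<tau>" by blast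
      then have t: "\<tau> \<subseteq> lines_in W" "indep_lines \<tau>" "card \<tau> = Suc k" by (auto simp: indep_sets_def)
      have d: "indep_lines (\<tau> - {L})" "\<tau> - {L} \<subseteq> lines_in W" "L \<in> lines_in W" "insert L (\<tau> - {L}) = \<tau>"
        using indep_lines_subset[OF t(1,2)] t \<tau>(2) by auto
      have "L \<notin> lines_in (vec.span (\<Union>(\<tau> - {L})))"
        using indep_lines_insert_iff[OF d(2,3,1)] t(2) d(4) by simp
      moreover have "\<tau> - {L} \<in> indep_sets W k" using d t(3) \<tau>(2) by (simp add: indep_sets_def)
      ultimately show "(\<lambda>(\<tau>, L). (\<tau> - {L}, L)) x \<in> ?B" using d(3) by (simp add: x)
    qed
  qed
  then have "card ?A = card ?B" by (rule bij_betw_same_card)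
  moreover have "card ?A = card (indep_sets W (Suc k)) * Suc k"
  proof -
    have "card ?A = (\<Sum>\<tau>\<in>indep_sets W (Suc k). card \<tau>)"
      using fI fin by (intro card_SigmaI) (auto simp: indep_sets_def)
    then show ?thesis by (simp add: indep_sets_def)
  qed
  moreover have "(of_nat (card ?B) :: rat) * (of_nat p - 1) =
      of_nat (card (indep_sets W k)) * (of_nat p ^ vec.dim W - of_nat p ^ k)"
  proof -
    have one: "(of_nat (card (lines_in W - lines_in (vec.span (\<Union>\<sigma>)))) :: rat) * (of_nat p - 1) =
        of_nat p ^ vec.dim W - of_nat p ^ k" if \<sigma>: "\<sigma> \<in> indep_sets W k" for \<sigma>
    proof -
      let ?S = "vec.span (\<Union>\<sigma>)"
      have S: "vec.subspace ?S" "?S \<subseteq> W" "finite ?S" "vec.dim ?S = k"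
        using \<sigma> span_lines_subset[OF _ W(1), of \<sigma>] finite_subset[OF _ W(2)]
        unfolding indep_sets_def indep_lines_def by (auto simp del: vec.dim_span)
      have "card (lines_in W - lines_in ?S) = card (lines_in W) - card (lines_in ?S)"
        using lines_in_mono[OF S(2)] finite_lines_in[OF S(3)] by (intro card_Diff_subset)
      moreover have "card (lines_in ?S) \<le> card (lines_in W)"
        using lines_in_mono[OF S(2)] finite_lines_in[OF W(2)] by (rule card_mono[rotated])
      ultimately have "(of_nat (card (lines_in W - lines_in ?S)) :: rat) =
          of_nat (card (lines_in W)) - of_nat (card (lines_in ?S))" by (simp add: of_nat_diff)
      then show ?thesis
        using card_lines_in_rat[OF W] card_lines_in_rat[OF S(1,3)] S(4) by (simp add: left_diff_distrib)
    qed
    have "card ?B = (\<Sum>\<sigma>\<in>indep_sets W k. card (lines_in W - lines_in (vec.span (\<Union>\<sigma>))))"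
      using fI finite_lines_in[OF W(2)] by (intro card_SigmaI) auto
    then show ?thesis using one by (simp add: sum_distrib_right)
  qed
  moreover have "of_nat (Suc k) * (of_nat p - 1) * (of_nat (card (indep_sets W (Suc k))) :: rat) =
      of_nat (card (indep_sets W (Suc k)) * Suc k) * (of_nat p - 1)"
    by (simp only: of_nat_mult ac_simps)
  ultimately show ?thesis by simp
qed

lemma indep_sets_0: "indep_sets (W :: 'f vecs) 0 = {{}}"
proof
  show "indep_sets W 0 \<subseteq> {{}}" by (auto simp: indep_sets_def indep_lines_def)
  have "vec.dim ({} :: 'f vecs) = 0"
    using vec.dim_eq_card_independent[OF vec.independent_empty] by simp
  then show "{{}} \<subseteq> indep_sets W 0" by (simp add: indep_sets_def indep_lines_def)
qed

lemma indep_sets_prod: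
  assumes W: "vec.subspace W" "finite (W :: 'f vecs)"
  shows "of_nat (fact k) * (of_nat p - 1) ^ k * (of_nat (card (indep_sets W k)) :: rat) =
     (\<Prod>t<k. of_nat p ^ vec.dim W - of_nat p ^ t)"
proof (induction k)
  case 0
  then show ?case by (simp add: indep_sets_0)
next
  case (Suc k)
  have "of_nat (fact (Suc k)) * (of_nat p - 1) ^ Suc k * (of_nat (card (indep_sets W (Suc k))) :: rat) =
     of_nat (fact k) * (of_nat p - 1) ^ k *
       (of_nat (Suc k) * (of_nat p - 1) * of_nat (card (indep_sets W (Suc k))))"
    by (simp add: algebra_simps)
  also have "\<dots> = (of_nat (fact k) * (of_nat p - 1) ^ k * of_nat (card (indep_sets W k))) *
      (of_nat p ^ vec.dim W - of_nat p ^ k)"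
    unfolding indep_sets_Suc[OF W] by (simp only: mult.assoc)
  finally show ?case unfolding Suc.IH by simp
qed

lemma q_fact_Suc: "q_fact p (Suc k) = q_fact p k * (of_nat p ^ Suc k - 1)"
  by (simp add: q_fact_def prod.nat_ivl_Suc' mult.commute)

lemma q_fact_nonzero: "q_fact p k \<noteq> 0"
proof (induction k)
  case (Suc k)
  have "(1::rat) < of_nat p ^ Suc k" using p_ge_2 by (intro one_less_power) auto
  then show ?case using Suc by (simp add: q_fact_Suc del: power_Suc)
qed (simp add: q_fact_def)

text \<open>The factor with index \<open>t\<close> is \<open>p^t\<close> times
  \<open>p^(d - t) - 1\<close>: the powers collect to the exponent
  \<open>0 + 1 + ... + (k - 1)\<close>, and the remaining factors complete
  \<open>q_fact p (d - k)\<close> to \<open>q_fact p d\<close>.\<close>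

lemma prod_q_fact:
  "k \<le> d \<Longrightarrow> (\<Prod>t<k. of_nat p ^ d - of_nat p ^ t) * q_fact p (d - k) =
     of_nat p ^ (k * (k - 1) div 2) * q_fact p d"
proof (induction k)
  case (Suc k)
  have d: "d - k = Suc (d - Suc k)" using Suc.prems by simp
  have e: "Suc k * (Suc k - 1) div 2 = k + k * (k - 1) div 2"
  proof (cases k)
    case (Suc l)
    have "Suc k * (Suc k - 1) = 2 * k + k * (k - 1)" using Suc by simp
    then show ?thesis by simp
  qed simp
  have "(of_nat p ^ d - of_nat p ^ k :: rat) = of_nat p ^ k * (of_nat p ^ (d - k) - 1)"
    using Suc.prems by (simp add: right_diff_distrib flip: power_add)
  then have "(\<Prod>t<Suc k. of_nat p ^ d - of_nat p ^ t) * q_fact p (d - Suc k) =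
      of_nat p ^ k * ((\<Prod>t<k. of_nat p ^ d - of_nat p ^ t) * (q_fact p (d - Suc k) * (of_nat p ^ (d - k) - 1)))"
    by (simp add: ac_simps)
  also have "q_fact p (d - Suc k) * (of_nat p ^ (d - k) - 1) = q_fact p (d - k)"
    unfolding d q_fact_Suc ..
  finally show ?case using Suc unfolding e by (simp add: power_add)
qed simp

text \<open>The origin of the coefficients in part (b): up to sign they are the numbers of
  independent sets of \<open>k\<close> lines. The product counts ordered choices of vectors;
  \<open>fact k\<close> forgets the order and \<open>(p - 1) ^ k\<close> the scaling.\<close>

lemma card_indep_sets:
  assumes W: "vec.subspace W" "finite (W :: 'f vecs)" and k: "k \<le> vec.dim W"
  shows "(of_nat (card (indep_sets W k)) :: rat) = of_nat p ^ (k * (k - 1) div 2) * q_fact p (vec.dim W) /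
     (of_nat (fact k) * (of_nat p - 1) ^ k * q_fact p (vec.dim W - k))"
proof -
  have "of_nat (fact k) * (of_nat p - 1) ^ k * q_fact p (vec.dim W - k) \<noteq> 0"
    using p_ge_2 q_fact_nonzero by simp
  moreover have "of_nat (card (indep_sets W k)) * (of_nat (fact k) * (of_nat p - 1) ^ k * q_fact p (vec.dim W - k)) =
      of_nat p ^ (k * (k - 1) div 2) * q_fact p (vec.dim W)"
    unfolding prod_q_fact[OF k, symmetric] indep_sets_prod[OF W, symmetric] by (simp only: ac_simps)
  ultimately show ?thesis by (simp add: eq_divide_eq)
qed

text \<open>The sets are grouped by their span. A set of rank \<open>s\<close> inside a space
  \<open>U\<close> of dimension \<open>s\<close> spans all of \<open>U\<close>, so the fibre over
  \<open>U\<close> consists of the sets of rank \<open>s\<close> in \<open>U\<close>.\<close>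

lemma sum_ranked_sets:
  assumes W: "vec.subspace W" "finite (W :: 'f vecs)"
  shows "(\<Sum>J\<in>ranked_sets W j s. f J) = (\<Sum>U\<in>subspaces W s. \<Sum>J\<in>ranked_sets U j s. f J)"
proof -
  have fiber: "{J \<in> ranked_sets W j s. vec.span (\<Union>J) = U} = ranked_sets U j s" if U: "U \<in> subspaces W s" for U
  proof
    have U': "U \<subseteq> W" "vec.subspace U" "vec.dim U = s" "finite U"
      using U W(2) finite_subset by (auto simp: subspaces_def)
    show "{J \<in> ranked_sets W j s. vec.span (\<Union>J) = U} \<subseteq> ranked_sets U j s"
    proof clarify
      fix J assume J: "J \<in> ranked_sets W j s" "U = vec.span (\<Union>J)"
      have "J \<subseteq> lines_in (vec.span (\<Union>J))"
      proof
        fix L assume L: "L \<in> J"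
        then have "L \<subseteq> vec.span (\<Union>J)" using vec.span_superset[of "\<Union>J"] by blast
        then show "L \<in> lines_in (vec.span (\<Union>J))" using L J(1) by (auto simp: ranked_sets_def lines_in_def)
      qed
      then show "J \<in> ranked_sets (vec.span (\<Union>J)) j s" using J by (simp add: ranked_sets_def)
    qed
    show "ranked_sets U j s \<subseteq> {J \<in> ranked_sets W j s. vec.span (\<Union>J) = U}"
    proof clarify
      fix J assume J: "J \<in> ranked_sets U j s"
      then have JU: "J \<subseteq> lines_in U" "line_rank J = s" "card J = j" by (auto simp: ranked_sets_def)
      have "vec.span (\<Union>J) = U"
      proof (rule subspace_eqI)
        show "vec.span (\<Union>J) \<subseteq> U" by (rule span_lines_subset[OF JU(1) U'(2)])
        show "vec.dim (vec.span (\<Union>J)) = vec.dim U" using JU(2) U'(3) unfolding line_rank_def by simp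
      qed (use U' in auto)
      then show "J \<in> ranked_sets W j s \<and> vec.span (\<Union>J) = U"
        using JU lines_in_mono[OF U'(1)] by (auto simp: ranked_sets_def)
    qed
  qed
  have "(\<lambda>J. vec.span (\<Union>J)) ` ranked_sets W j s \<subseteq> subspaces W s"
  proof (intro image_subsetI)
    fix J assume "J \<in> ranked_sets W j s"
    then show "vec.span (\<Union>J) \<in> subspaces W s"
      unfolding ranked_sets_def line_rank_def subspaces_def using span_lines_subset[OF _ W(1)] by blast
  qed
  then have "(\<Sum>J\<in>ranked_sets W j s. f J) =
     (\<Sum>U\<in>subspaces W s. sum f {J \<in> ranked_sets W j s. vec.span (\<Union>J) = U})"
    by (intro sum.group[symmetric] finite_ranked_sets finite_subspaces W(2))
  then show ?thesis using fiber by simp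
qed

lemma subspaces_props:
  assumes "U \<in> subspaces W s" "finite (W :: 'f vecs)"
  shows "vec.subspace U" "finite U" "vec.dim U = s"
  using assms finite_subset by (auto simp: subspaces_def)

text \<open>Independent sets of \<open>k\<close> lines, grouped by span, are distributed evenly over
  the subspaces of dimension \<open>k\<close>; the Gaussian binomial is the quotient of the two
  counts.\<close>

lemma card_subspaces:
  assumes W: "vec.subspace W" "finite (W :: 'f vecs)" and k: "k \<le> vec.dim W"
  shows "of_nat (card (subspaces W k)) = gauss_binom p (vec.dim W) k"
proof -
  \<comment> \<open>The part of \<open>card_indep_sets\<close> that does not involve the dimension
    of the space; it is the same for \<open>W\<close> and for each \<open>U\<close>, and
    cancels.\<close>
  define c :: rat where "c = of_nat p ^ (k * (k - 1) div 2) / (of_nat (fact k) * (of_nat p - 1) ^ k)"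
  have "c \<noteq> 0" using p_ge_2 by (simp add: c_def)
  have "(of_nat (card (indep_sets W k)) :: rat) = (\<Sum>J\<in>ranked_sets W k k. 1)"
    by (simp add: indep_sets_eq_ranked[OF W(2)])
  also have "\<dots> = (\<Sum>U\<in>subspaces W k. \<Sum>J\<in>ranked_sets U k k. 1)" by (rule sum_ranked_sets[OF W])
  also have "\<dots> = (\<Sum>U\<in>subspaces W k. c * q_fact p k)"
  proof (rule sum.cong[OF refl])
    fix U assume "U \<in> subspaces W k"
    note U = subspaces_props[OF this W(2)]
    have "(\<Sum>J\<in>ranked_sets U k k. 1) = (of_nat (card (indep_sets U k)) :: rat)"
      by (simp add: indep_sets_eq_ranked[OF U(2)])
    also have "\<dots> = c * q_fact p k"
      using card_indep_sets[OF U(1,2), of k] by (simp add: U(3) c_def q_fact_def)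
    finally show "(\<Sum>J\<in>ranked_sets U k k. 1) = c * q_fact p k" .
  qed
  finally have "of_nat (card (subspaces W k)) * (c * q_fact p k) =
      c * q_fact p (vec.dim W) / q_fact p (vec.dim W - k)"
    using card_indep_sets[OF W k] by (simp add: c_def)
  then have "c * (of_nat (card (subspaces W k)) * q_fact p k * q_fact p (vec.dim W - k)) = c * q_fact p (vec.dim W)"
    using q_fact_nonzero by (simp add: eq_divide_eq ac_simps)
  then have "of_nat (card (subspaces W k)) * (q_fact p k * q_fact p (vec.dim W - k)) = q_fact p (vec.dim W)"
    using \<open>c \<noteq> 0\<close> by (simp add: mult.assoc)
  then show ?thesis unfolding gauss_binom_def using q_fact_nonzero by (simp add: eq_divide_eq)
qed

section \<open>Euler characteristics summed over sets of lines\<close>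

lemma rank_sum_subspaces:
  assumes W: "vec.subspace W" "finite (W :: 'f vecs)"
  shows "rank_sum W j s = (\<Sum>U\<in>subspaces W s. rank_sum U j s)"
  unfolding rank_sum_def by (rule sum_ranked_sets[OF W])

lemma line_rank_le:
  assumes W: "vec.subspace W" "finite (W :: 'f vecs)" and J: "J \<subseteq> lines_in W"
  shows "line_rank J \<le> vec.dim W"
  unfolding line_rank_def using W span_lines_subset[OF J W(1)] by (intro dim_le_of_subset) auto

text \<open>Sets of lines are sorted by rank; the factor \<open>(-1) ^ s\<close> undoes the sign
  that \<open>rank_sum\<close> includes to make each contribution a rank of cohomology.\<close>

lemma euler_sum_rank_sum:
  assumes W: "vec.subspace W" "finite (W :: 'f vecs)"
  shows "euler_sum W j = (\<Sum>s\<le>vec.dim W. (-1) ^ s * rank_sum W j s)"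
proof -
  let ?A = "{J. J \<subseteq> lines_in W \<and> card J = j}"
  let ?h = "\<lambda>J. \<Sum>T | T \<subseteq> J \<and> indep_lines T. (-1) ^ card T :: int"
  have "euler_sum W j = (\<Sum>s\<le>vec.dim W. sum ?h {J \<in> ?A. line_rank J = s})"
    unfolding euler_sum_def using line_rank_le[OF W] finite_lines_in[OF W(2)]
    by (intro sum.group[symmetric]) auto
  also have "\<dots> = (\<Sum>s\<le>vec.dim W. (-1) ^ s * rank_sum W j s)"
  proof (rule sum.cong[OF refl])
    fix s
    have "{J \<in> ?A. line_rank J = s} = ranked_sets W j s" by (auto simp: ranked_sets_def)
    then show "sum ?h {J \<in> ?A. line_rank J = s} = (-1) ^ s * rank_sum W j s"
      by (simp add: rank_sum_def sum_distrib_left power_add mult.assoc[symmetric] flip: power_mult_distrib)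
  qed
  finally show ?thesis .
qed

text \<open>Removing \<open>T\<close> leaves a free choice of the other elements. The case
  distinction matters because \<open>j - card T\<close> is truncated: for larger \<open>T\<close>
  the binomial would be 1 instead of 0.\<close>

lemma card_supersets:
  assumes "finite X" "T \<subseteq> X"
  shows "card {J. J \<subseteq> X \<and> card J = j \<and> T \<subseteq> J} = (if card T \<le> j then (card X - card T) choose (j - card T) else 0)"
proof (cases "card T \<le> j")
  case True
  have fT: "finite T" using assms finite_subset by blast
  have "bij_betw (\<lambda>J. J - T) {J. J \<subseteq> X \<and> card J = j \<and> T \<subseteq> J} {S. S \<subseteq> X - T \<and> card S = j - card T}"
  proof (rule bij_betw_byWitness[where f' = "\<lambda>S. S \<union> T"])
    show "(\<lambda>J. J - T) ` {J. J \<subseteq> X \<and> card J = j \<and> T \<subseteq> J} \<subseteq> {S. S \<subseteq> X - T \<and> card S = j - card T}"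
      using fT by (auto simp: card_Diff_subset)
    show "(\<lambda>S. S \<union> T) ` {S. S \<subseteq> X - T \<and> card S = j - card T} \<subseteq> {J. J \<subseteq> X \<and> card J = j \<and> T \<subseteq> J}"
    proof clarify
      fix S assume S: "S \<subseteq> X - T" "card S = j - card T"
      have "finite S" "S \<inter> T = {}" using S assms(1) finite_subset[of S X] by auto
      then show "S \<union> T \<subseteq> X \<and> card (S \<union> T) = j \<and> T \<subseteq> S \<union> T"
        using S True assms(2) fT by (auto simp: card_Un_disjoint)
    qed
  qed auto
  then have "card {J. J \<subseteq> X \<and> card J = j \<and> T \<subseteq> J} = card {S. S \<subseteq> X - T \<and> card S = j - card T}"
    by (rule bij_betw_same_card)
  also have "\<dots> = card (X - T) choose (j - card T)" using assms(1) by (intro n_subsets) simp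
  finally show ?thesis using True assms fT by (simp add: card_Diff_subset)
next
  case False
  have "{J. J \<subseteq> X \<and> card J = j \<and> T \<subseteq> J} = {}"
  proof (intro equals0I, elim CollectE conjE)
    fix J assume "J \<subseteq> X" "card J = j" "T \<subseteq> J"
    then show False using False card_mono[OF finite_subset[OF \<open>J \<subseteq> X\<close> assms(1)], of T] by simp
  qed
  then show ?thesis using False by (simp only: card.empty if_False)
qed

text \<open>For a fixed independent \<open>T\<close> the sum over \<open>J\<close> merely counts
  supersets, so the contribution depends on the size of \<open>T\<close> alone.\<close>

lemma euler_sum_eq:
  assumes W: "vec.subspace W" "finite (W :: 'f vecs)"
  shows "euler_sum W j = (\<Sum>k\<le>vec.dim W. (-1) ^ k * int (card (indep_sets W k)) *
     (if k \<le> j then int ((card (lines_in W) - k) choose (j - k)) else 0))"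
proof -
  let ?L = "lines_in W"
  let ?A = "{J. J \<subseteq> ?L \<and> card J = j}"
  let ?B = "{T. T \<subseteq> ?L \<and> indep_lines T}"
  let ?c = "\<lambda>k. if k \<le> j then int ((card ?L - k) choose (j - k)) else 0"
  have fL: "finite ?L" by (rule finite_lines_in[OF W(2)])
  have "euler_sum W j = (\<Sum>J\<in>?A. \<Sum>T | T \<in> ?B \<and> T \<subseteq> J. (-1) ^ card T)"
    unfolding euler_sum_def by (intro sum.cong refl) auto
  also have "\<dots> = (\<Sum>T\<in>?B. \<Sum>J | J \<in> ?A \<and> T \<subseteq> J. (-1) ^ card T)"
    using fL by (intro sum.swap_restrict) auto
  also have "\<dots> = (\<Sum>T\<in>?B. (-1) ^ card T * ?c (card T))"
  proof (rule sum.cong[OF refl])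
    fix T assume T: "T \<in> ?B"
    have "{J. J \<in> ?A \<and> T \<subseteq> J} = {J. J \<subseteq> ?L \<and> card J = j \<and> T \<subseteq> J}" by auto
    then show "(\<Sum>J | J \<in> ?A \<and> T \<subseteq> J. (-1) ^ card T) = (-1) ^ card T * ?c (card T)"
      using card_supersets[OF fL, of T j] T by simp
  qed
  also have "\<dots> = (\<Sum>k\<le>vec.dim W. sum (\<lambda>T. (-1) ^ card T * ?c (card T)) {T \<in> ?B. card T = k})"
  proof (intro sum.group[symmetric])
    have "card T \<le> vec.dim W" if "T \<subseteq> lines_in W" "indep_lines T" for T
      using line_rank_le[OF W that(1)] line_rank_indep[OF that(2)] by simp
    then show "card ` ?B \<subseteq> {..vec.dim W}" by auto
  qed (use fL in auto)
  also have "\<dots> = (\<Sum>k\<le>vec.dim W. (-1) ^ k * int (card (indep_sets W k)) * ?c k)"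
  proof (rule sum.cong[OF refl])
    fix k
    have "{T \<in> ?B. card T = k} = indep_sets W k" by (auto simp: indep_sets_def)
    moreover have "(\<Sum>T\<in>indep_sets W k. (-1) ^ card T * ?c (card T)) = (\<Sum>T\<in>indep_sets W k. (-1) ^ k * ?c k)"
      by (intro sum.cong refl) (simp add: indep_sets_def)
    ultimately show "sum (\<lambda>T. (-1) ^ card T * ?c (card T)) {T \<in> ?B. card T = k} =
        (-1) ^ k * int (card (indep_sets W k)) * ?c k"
      by (simp only: sum_constant) (simp only: ac_simps)
  qed
  finally show ?thesis .
qed

lemma card_lines_in_eq: "vec.subspace W \<Longrightarrow> finite (W :: 'f vecs) \<Longrightarrow>
    card (lines_in W) = (p ^ vec.dim W - 1) div (p - 1)"
  using card_lines_in[of W] p_ge_2 by (metis nonzero_mult_div_cancel_right diff_is_0_eq not_less_eq_eq numeral_2_eq_2 One_nat_def)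

text \<open>The number of lines and the numbers of independent sets are functions of the dimension,
  and \<open>euler_sum_eq\<close> involves nothing else.\<close>

lemma euler_sum_dim:
  assumes "vec.subspace U" "finite (U :: 'f vecs)" "vec.subspace W" "finite (W :: 'f vecs)"
    and dim: "vec.dim U = vec.dim W"
  shows "euler_sum U j = euler_sum W j"
proof -
  have "card (indep_sets U k) = card (indep_sets W k)" if "k \<le> vec.dim W" for k
  proof -
    have "(of_nat (card (indep_sets U k)) :: rat) = of_nat (card (indep_sets W k))"
      using card_indep_sets[OF assms(1,2), of k] card_indep_sets[OF assms(3,4), of k] that dim by simp
    then show ?thesis by simp
  qed
  then show ?thesis unfolding euler_sum_eq[OF assms(1,2)] euler_sum_eq[OF assms(3,4)]
    using assms by (intro sum.cong) (auto simp: card_lines_in_eq)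
qed

text \<open>Avoids transporting along a linear isomorphism: the Euler characteristic expresses the sum over
  spanning sets by the same sums for proper subspaces.\<close>

lemma rank_sum_dim:
  assumes "vec.subspace U" "finite (U :: 'f vecs)"
  shows "rank_sum U j (vec.dim U) = rank_sum (coord_space (vec.dim U) :: 'f vecs) j (vec.dim U)"
  using assms
proof (induction "vec.dim U" arbitrary: U rule: less_induct)
  case less
  let ?d = "vec.dim U"
  let ?C = "coord_space ?d :: 'f vecs"
  note C = subspace_coord_space[of ?d, where ?'a = 'f] finite_coord_space[of ?d]
  \<comment> \<open>By induction every subspace of smaller dimension contributes the value of the
    coordinate space of that dimension, so only the number of such subspaces matters.\<close>
  have lower: "rank_sum X j s = int (card (subspaces X s)) * rank_sum (coord_space s :: 'f vecs) j s"
    if X: "vec.subspace X" "finite X" "vec.dim X = ?d" "s < ?d" for s and X :: "'f vecs"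
  proof -
    have "rank_sum Y j s = rank_sum (coord_space s :: 'f vecs) j s" if "Y \<in> subspaces X s" for Y
      using less.hyps[of Y] subspaces_props[OF that X(2)] X(4) by simp
    then show ?thesis unfolding rank_sum_subspaces[OF X(1,2), of j s] by simp
  qed
  \<comment> \<open>The spanning sets form the top term; all other quantities in this equation are
    already known to depend only on the dimension.\<close>
  have top: "(-1) ^ ?d * rank_sum X j ?d = euler_sum X j - (\<Sum>s<?d. (-1) ^ s * rank_sum X j s)"
    if "vec.subspace X" "finite X" "vec.dim X = ?d" for X :: "'f vecs"
    using euler_sum_rank_sum[OF that(1,2), of j] that(3)
    by (simp add: lessThan_Suc_atMost[symmetric])
  have "card (subspaces U s) = card (subspaces ?C s)" if "s < ?d" for s
  proof -
    have "(of_nat (card (subspaces U s)) :: rat) = of_nat (card (subspaces ?C s))"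
      using card_subspaces[OF less.prems, of s] card_subspaces[OF C, of s] that dim_coord[of ?d] by simp
    then show ?thesis by simp
  qed
  then have "rank_sum U j s = rank_sum ?C j s" if "s < ?d" for s
    using lower[OF less.prems refl that] lower[OF C dim_coord that] that by simp
  then have "(-1) ^ ?d * rank_sum U j ?d = (-1) ^ ?d * rank_sum ?C j ?d"
    unfolding top[OF less.prems refl] top[OF C dim_coord]
    using euler_sum_dim[OF less.prems C] dim_coord[of ?d] by simp
  then show ?case by simp
qed

section \<open>Betti numbers of the complex of lines\<close>

lemma betti_lines_rank_sum:
  assumes "i \<le> j"
  shows "int (betti_lines TYPE('k::idom) TYPE('f) n i (2 * j)) = rank_sum (coord_space n :: 'f vecs) j (j - i)"
proof -
  let ?V = "lines_in (coord_space n) :: 'f vecs set"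
  let ?K = "line_complex n :: 'f vecs set set"
  have fV: "finite ?V" by (intro finite_lines_in finite_coord_space)
  have K: "T \<in> ?K \<longleftrightarrow> indep_lines T" if "T \<subseteq> J" "J \<subseteq> ?V" for T J
    using that by (auto simp: line_complex_eq)
  have mat: "matroid_on J (\<lambda>T. T \<in> ?K) (line_rank J)" if J: "J \<subseteq> ?V" for J
    using line_matroid[OF J finite_subset[OF J fV]] by (rule matroid_on_cong) (use K J in blast)
  have down: "T \<in> ?K" if "S \<in> ?K" "T \<subseteq> S" for S T
    using that indep_lines_subset[of S "coord_space n" T] by (auto simp: line_complex_eq)
  have "int (betti_lines TYPE('k) TYPE('f) n i (2 * j)) =
     (\<Sum>J | J \<subseteq> ?V \<and> card J = j \<and> line_rank J + i = j.
        \<Sum>T | T \<subseteq> J \<and> T \<in> ?K. (-1) ^ (line_rank J + card T))"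
    unfolding betti_lines_def lines_eq_lines_in by (rule bigraded_betti_matroid[OF fV mat down])
  also have "\<dots> = rank_sum (coord_space n :: 'f vecs) j (j - i)"
    unfolding rank_sum_def
  proof (rule sum.cong)
    \<comment> \<open>Here \<open>i \<le> j\<close> is used: it makes
      \<open>line_rank J = j - i\<close> with truncated subtraction equivalent to the additive
      condition of Hochster's formula.\<close>
    show "{J. J \<subseteq> ?V \<and> card J = j \<and> line_rank J + i = j} = ranked_sets (coord_space n) j (j - i)"
      using assms by (auto simp: ranked_sets_def)
    fix J assume "J \<in> ranked_sets (coord_space n :: 'f vecs) j (j - i)"
    then have J: "J \<subseteq> ?V" "line_rank J = j - i" by (auto simp: ranked_sets_def)
    have "{T. T \<subseteq> J \<and> T \<in> ?K} = {T. T \<subseteq> J \<and> indep_lines T}" using K J(1) by blast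
    then show "(\<Sum>T | T \<subseteq> J \<and> T \<in> ?K. (-1) ^ (line_rank J + card T)) =
        (\<Sum>T | T \<subseteq> J \<and> indep_lines T. (-1) ^ (j - i + card T) :: int)" by (simp add: J(2))
  qed
  finally show ?thesis .
qed

text \<open>A set of lines of rank \<open>j - i\<close> spans a unique subspace of that dimension,
  and by \<open>rank_sum_dim\<close> every such subspace contributes the Betti number of the
  coordinate space.\<close>

lemma betti_lines_below:
  assumes "i \<le> j" "j - i \<le> n"
  shows "(of_nat (betti_lines TYPE('k::idom) TYPE('f) n i (2 * j)) :: rat) =
     gauss_binom p n (j - i) * of_nat (betti_lines TYPE('k) TYPE('f) (j - i) i (2 * j))"
proof -
  let ?s = "j - i"
  let ?W = "coord_space n :: 'f vecs"
  note W = subspace_coord_space[of n, where ?'a = 'f] finite_coord_space[of n]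
  have "rank_sum U j ?s = rank_sum (coord_space ?s :: 'f vecs) j ?s" if "U \<in> subspaces ?W ?s" for U
    using rank_sum_dim[of U j] subspaces_props[OF that W(2)] by simp
  then have "rank_sum ?W j ?s = int (card (subspaces ?W ?s)) * rank_sum (coord_space ?s :: 'f vecs) j ?s"
    unfolding rank_sum_subspaces[OF W, of j ?s] by simp
  then have "int (betti_lines TYPE('k) TYPE('f) n i (2 * j)) =
      int (card (subspaces ?W ?s) * betti_lines TYPE('k) TYPE('f) ?s i (2 * j))"
    using betti_lines_rank_sum[OF assms(1), where ?'k = 'k] by simp
  then have "betti_lines TYPE('k) TYPE('f) n i (2 * j) =
      card (subspaces ?W ?s) * betti_lines TYPE('k) TYPE('f) ?s i (2 * j)"
    by (simp only: of_nat_eq_iff)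
  then show ?thesis using card_subspaces[OF W, of ?s] assms(2) by (simp add: dim_coord)
qed

lemma minus_one_power_diff:
  assumes "l \<le> n"
  shows "(-1 :: rat) ^ (n - l) = (-1) ^ n * (-1) ^ l"
proof -
  have "(-1 :: rat) ^ n = (-1) ^ (n - l) * (-1) ^ l" using assms by (simp flip: power_add)
  moreover have "(-1 :: rat) ^ l * (-1) ^ l = 1" by (simp flip: power_mult_distrib)
  ultimately show ?thesis by (simp only: mult.assoc mult_1_right)
qed

text \<open>Two evaluations of \<open>euler_sum\<close> are compared, one by independent sets and
  one by ranks. After multiplication by \<open>(-1) ^ n\<close> the term of rank \<open>n\<close>
  has sign 1 and is the Betti number sought; the lower ranks form the subtracted sum.\<close>

lemma betti_lines_top:
  assumes "i \<le> j" "j - i = n"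
  shows "(of_nat (betti_lines TYPE('k::idom) TYPE('f) n i (2 * j)) :: rat) =
     (\<Sum>k=0..n. (-1) ^ (n - k) * of_nat p ^ (k * (k - 1) div 2) * q_fact p n /
        (of_nat (fact k) * (of_nat p - 1) ^ k * q_fact p (n - k)) *
        of_nat (((p ^ n - 1) div (p - 1) - k) choose (j - k))) -
     (\<Sum>l<n. (-1) ^ (n - l) * of_nat (betti_lines TYPE('k) TYPE('f) n (j - l) (2 * j)))"
proof -
  let ?W = "coord_space n :: 'f vecs"
  let ?m = "(p ^ n - 1) div (p - 1)"
  let ?b = "\<lambda>i. betti_lines TYPE('k) TYPE('f) n i (2 * j)"
  note W = subspace_coord_space[of n, where ?'a = 'f] finite_coord_space[of n]
  \<comment> \<open>This keeps \<open>j - l\<close> exact for all ranks \<open>l \<le> n\<close> and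
    settles the case distinction \<open>k \<le> j\<close> in \<open>euler_sum_eq\<close>.\<close>
  have nj: "n \<le> j" using assms by simp
  have rs: "rank_sum ?W j l = int (?b (j - l))" if "l \<le> n" for l
    using betti_lines_rank_sum[of "j - l" j n, where ?'k = 'k] that nj by simp
  have "rat_of_int (euler_sum ?W j) = (\<Sum>k\<le>n. (-1) ^ k * of_nat (card (indep_sets ?W k)) * of_nat ((?m - k) choose (j - k)))"
    unfolding euler_sum_eq[OF W] dim_coord using nj
    by (simp add: card_lines_in_eq[OF W] dim_coord)
  moreover have "rat_of_int (euler_sum ?W j) = (\<Sum>l\<le>n. (-1) ^ l * of_nat (?b (j - l)))"
    unfolding euler_sum_rank_sum[OF W] dim_coord using rs by simp
  ultimately have eq: "(\<Sum>l\<le>n. (-1) ^ l * of_nat (?b (j - l)) :: rat) =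
      (\<Sum>k\<le>n. (-1) ^ k * of_nat (card (indep_sets ?W k)) * of_nat ((?m - k) choose (j - k)))" by simp
  have "(\<Sum>k=0..n. (-1) ^ (n - k) * of_nat p ^ (k * (k - 1) div 2) * q_fact p n /
        (of_nat (fact k) * (of_nat p - 1) ^ k * q_fact p (n - k)) * of_nat ((?m - k) choose (j - k))) =
      (\<Sum>k\<le>n. (-1) ^ n * ((-1) ^ k * of_nat (card (indep_sets ?W k)) * of_nat ((?m - k) choose (j - k))))"
    by (intro sum.cong) (auto simp: card_indep_sets[OF W] dim_coord minus_one_power_diff)
  also have "\<dots> = (-1) ^ n * (\<Sum>l\<le>n. (-1) ^ l * of_nat (?b (j - l)))"
    unfolding eq by (simp only: sum_distrib_left)
  also have "\<dots> = (\<Sum>l\<le>n. (-1) ^ (n - l) * of_nat (?b (j - l)))"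
    by (simp add: sum_distrib_left minus_one_power_diff mult.assoc)
  also have "\<dots> = (\<Sum>l<n. (-1) ^ (n - l) * of_nat (?b (j - l))) + of_nat (?b (j - n))"
    by (simp add: lessThan_Suc_atMost[symmetric])
  moreover have "j - n = i" using assms by simp
  ultimately show ?thesis by simp
qed

end

theorem theorem3p9:
  fixes p n m i j :: nat
  assumes "prime p"
    and "card (UNIV :: 'f::field set) = p"
    and "ring_of_integers TYPE('k::idom) \<or> prime_field TYPE('k)"
    and "n \<ge> 1"
    and "m = (p ^ n - 1) div (p - 1)"
    and "i \<le> j"
  shows "(j - i < n \<longrightarrow>
            of_nat (betti_lines TYPE('k) TYPE('f) n i (2 * j)) =
              gauss_binom p n (j - i) *
              of_nat (betti_lines TYPE('k) TYPE('f) (j - i) i (2 * j))) \<and>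
         (j - i = n \<longrightarrow>
            of_nat (betti_lines TYPE('k) TYPE('f) n i (2 * j)) =
              (\<Sum>k=0..n. (-1) ^ (n - k) * of_nat p ^ (k * (k - 1) div 2) * q_fact p n /
                  (of_nat (fact k) * (of_nat p - 1) ^ k * q_fact p (n - k)) *
                  of_nat ((m - k) choose (j - k))) -
              (\<Sum>l<n. (-1) ^ (n - l) *
                  of_nat (betti_lines TYPE('k) TYPE('f) n (j - l) (2 * j))))"
proof -
  interpret line_counting p "TYPE('f)"
    using assms(1,2) by unfold_locales (auto intro: prime_ge_2_nat)
  show ?thesis unfolding assms(5)
    by (intro conjI impI betti_lines_below[OF assms(6) less_imp_le] betti_lines_top[OF assms(6)])
qed

end
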